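(* The invariants $D[T]$ and $D[D]$ of unoriented links are topologically equivalent. Specifically, for every unoriented link diagram $L$ with $n\ge 1$ components, $$D[T](L)(z,w,a,E) = \left(\frac{z}{w}\right)^{n-1} D[D](L)(w,a,\widehat{E}),\qquad \widehat{E}=E\,\frac{z}{w}.$$
   Context: $z,w,a,E$ are indeterminates. Two link invariants are topologically equivalent if they distinguish exactly the same pairs of links. Regular isotopy is the equivalence relation on planar link diagrams generated by planar isotopy and Reidemeister moves II and III. For a crossing, swinging the overcrossing arc counterclockwise sweeps two of the four local regions; joining these two regions is the $A$-smoothing, joining the other two is the $B$-smoothing. A crossing (drawn in the plane as an X) is of positive type if its $A$-smoothing is horizontal (one arc on top and one arc at the bottom) and of negative type if its $A$-smoothing is vertical. An unoriented Conway quadruple $L_+,L_-,L_0,L_\infty$ consists of four unoriented diagrams identical except near one specified crossing, which is of positive type in $L_+$, switched in $L_-$, and replaced in $L_0$ and $L_\infty$ by, respectively, the $A$-smoothing (horizontal) and the $B$-smoothing (vertical) of the crossing of $L_+$. A union of $r$ unlinked knots $\mathcal{K}^r=\sqcup_{i=1}^r K_i$ is an $r$-component link diagram representing a split link whose $r$ split components are (possibly non-trivial) knots. $T=T(w,a)$, the (known) regular isotopy version of the Dubrovnik polynomial, is the regular isotopy invariant of unoriented links determined by: $T(L_+)-T(L_-)=w\,(T(L_0)-T(L_\infty))$ for every unoriented Conway quadruple (any crossing); $T(\text{diagram with a positive curl})=a\,T(\text{diagram without the curl})$ and $T(\text{diagram with a negative curl})=a^{-1}T(\text{diagram without the curl})$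 (a curl is a Reidemeister I kink, its sign being the sign of its crossing for either orientation of the strand); $T=1$ on the standard crossingless unknot diagram. $D[T]=D[T](z,w,a,E)$ is the unique regular isotopy invariant of unoriented links, with values in Laurent polynomials in $z,w,a,E$, such that: (1) $D[T](L_+)-D[T](L_-)=z\,\big(D[T](L_0)-D[T](L_\infty)\big)$ for every unoriented Conway quadruple whose specified crossing involves two different components; (2) $D[T](\mathcal{K}^r)=E^{1-r}T(\mathcal{K}^r)$ for every union $\mathcal{K}^r$ of $r\geq1$ unlinked knots. $D[D]=D[D](z,a,E)$ denotes the 3-variable invariant obtained from $D[T]$ in the case $w=z$ (so that $T(w,a)$ becomes the Dubrovnik polynomial $D(z,a)$); $D[D](L)(w,a,\widehat{E})$ is its value with $z$ replaced by $w$ and $E$ by $\widehat{E}$. *)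

theory Defs
  imports "HOL-Library.Poly_Mapping"
begin

section \<open>Unoriented link diagrams\<close>

text \<open>
  A planar link diagram in general position with respect to the height function is read from
  bottom to top as a word in elementary tiles: a local minimum (\<open>Cup\<close>), a local maximum (\<open>Cap\<close>),
  or a crossing of two ascending strands (\<open>X\<close>).  The letter \<open>(e, p)\<close> puts the tile \<open>e\<close> on top of
  the picture so far, with exactly \<open>p\<close> strands passing vertically to the left of it.

  \<open>X Pos\<close> is the crossing whose overstrand runs from bottom right to top left: turning
  the overstrand counterclockwise sweeps the west and the east region, so the \<open>A\<close>-smoothing
  is horizontal.  \<open>X Neg\<close> has its overstrand running from bottom left to top right.
\<close>

datatype crossing_type = Pos | Neg

datatype tile = Cup | Cap | X crossing_type

type_synonym diagram = "(tile \<times> nat) list"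

fun switch :: "crossing_type \<Rightarrow> crossing_type" where
  "switch Pos = Neg"
| "switch Neg = Pos"

fun inputs :: "tile \<Rightarrow> nat" where
  "inputs Cup = 0"
| "inputs Cap = 2"
| "inputs (X c) = 2"

fun outputs :: "tile \<Rightarrow> nat" where
  "outputs Cup = 2"
| "outputs Cap = 0"
| "outputs (X c) = 2"

text \<open>\<open>tangle k w l\<close>: the word \<open>w\<close> is a tangle diagram with \<open>k\<close> bottom and \<open>l\<close> top endpoints.\<close>

fun tangle :: "nat \<Rightarrow> diagram \<Rightarrow> nat \<Rightarrow> bool" where
  "tangle k [] l \<longleftrightarrow> k = l"
| "tangle k ((e, p) # w) l \<longleftrightarrow> p + inputs e \<le> k \<and> tangle (k - inputs e + outputs e) w l"

text \<open>The empty diagram is excluded: links have at least one component.\<close>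

definition link_diagram :: "diagram \<Rightarrow> bool" where
  "link_diagram L \<longleftrightarrow> L \<noteq> [] \<and> tangle 0 L 0"

definition unknot :: diagram where
  "unknot = [(Cup, 0), (Cap, 0)]"


subsection \<open>Components\<close>

text \<open>
  The horizontal line at level \<open>t\<close> (just before letter number \<open>t\<close>) meets the diagram in
  \<open>width L t\<close> points; the point \<open>(t, j)\<close> is the one having \<open>j\<close> others to its left.
\<close>

definition width :: "diagram \<Rightarrow> nat \<Rightarrow> nat" where
  "width L t = (THE k. tangle 0 (take t L) k)"

definition points :: "diagram \<Rightarrow> (nat \<times> nat) set" where
  "points L = {(t, j). t \<le> length L \<and> j < width L t}"

text \<open>\<open>joined L P Q\<close>: an arc of \<open>L\<close> within a single letter has endpoints \<open>P\<close> and \<open>Q\<close>.\<close>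

inductive joined :: "diagram \<Rightarrow> nat \<times> nat \<Rightarrow> nat \<times> nat \<Rightarrow> bool" for L where
  left: "t < length L \<Longrightarrow> L ! t = (e, p) \<Longrightarrow> j < p \<Longrightarrow> joined L (t, j) (Suc t, j)"
| right: "t < length L \<Longrightarrow> L ! t = (e, p) \<Longrightarrow> p + inputs e + d < width L t \<Longrightarrow>
    joined L (t, p + inputs e + d) (Suc t, p + outputs e + d)"
| cup: "t < length L \<Longrightarrow> L ! t = (Cup, p) \<Longrightarrow> joined L (Suc t, p) (Suc t, Suc p)"
| cap: "t < length L \<Longrightarrow> L ! t = (Cap, p) \<Longrightarrow> joined L (t, p) (t, Suc p)"
| rising: "t < length L \<Longrightarrow> L ! t = (X c, p) \<Longrightarrow> joined L (t, p) (Suc t, Suc p)"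
| falling: "t < length L \<Longrightarrow> L ! t = (X c, p) \<Longrightarrow> joined L (t, Suc p) (Suc t, p)"

definition same_component :: "diagram \<Rightarrow> nat \<times> nat \<Rightarrow> nat \<times> nat \<Rightarrow> bool" where
  "same_component L = equivclp (joined L)"

definition components :: "diagram \<Rightarrow> (nat \<times> nat) set set" where
  "components L = points L // {(P, Q). P \<in> points L \<and> Q \<in> points L \<and> same_component L P Q}"

definition num_components :: "diagram \<Rightarrow> nat" where
  "num_components L = card (components L)"


subsection \<open>Planar isotopy, regular isotopy and link equivalence\<close>

text \<open>
  Two words represent planar isotopic diagrams iff they are related by: exchanging the heights of
  horizontally disjoint tiles, cancelling or creating a pair of critical points of the height
  function, and moving a crossing through a critical point of one of its two strands.  In the
  last case the crossing is turned by a quarter turn, which switches its type.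
\<close>

inductive planar_move :: "diagram \<Rightarrow> diagram \<Rightarrow> bool" where
  exchange: "planar_move [(x, p), (y, p + outputs x + d)] [(y, p + inputs x + d), (x, p)]"
| snake_left: "planar_move [(Cup, i), (Cap, Suc i)] []"
| snake_right: "planar_move [(Cup, Suc i), (Cap, i)] []"
| cup_slide: "planar_move [(Cup, Suc i), (X c, i)] [(Cup, i), (X (switch c), Suc i)]"
| cap_slide: "planar_move [(X c, i), (Cap, Suc i)] [(X (switch c), Suc i), (Cap, i)]"

text \<open>
  A kink in an ascending strand, with its loop on the right or on the left.  Both strands are
  ascending (or both descending) at the crossing, so the sign of the kink is positive iff the
  overstrand runs from bottom left to top right, i.e. iff the crossing is \<open>X Neg\<close>.
\<close>

inductive kink :: "crossing_type \<Rightarrow> diagram \<Rightarrow> bool" for c where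
  loop_right: "kink c [(Cup, Suc i), (X c, i), (Cap, Suc i)]"
| loop_left: "kink c [(Cup, i), (X c, Suc i), (Cap, i)]"

abbreviation positive_curl :: "diagram \<Rightarrow> bool" where
  "positive_curl \<equiv> kink Neg"

abbreviation negative_curl :: "diagram \<Rightarrow> bool" where
  "negative_curl \<equiv> kink Pos"

inductive reidemeister1 :: "diagram \<Rightarrow> diagram \<Rightarrow> bool" where
  "kink c l \<Longrightarrow> reidemeister1 l []"

inductive reidemeister2 :: "diagram \<Rightarrow> diagram \<Rightarrow> bool" where
  "reidemeister2 [(X c, i), (X (switch c), i)] []"

text \<open>
  Among the eight choices of the three crossings, the two excluded ones are those
  in which no strand is on top of both others.
\<close>

inductive reidemeister3 :: "diagram \<Rightarrow> diagram \<Rightarrow> bool" where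
  "\<not> (c1 = c3 \<and> c2 \<noteq> c1) \<Longrightarrow>
    reidemeister3 [(X c1, i), (X c2, Suc i), (X c3, i)] [(X c3, Suc i), (X c2, i), (X c1, Suc i)]"

definition local_change :: "(diagram \<Rightarrow> diagram \<Rightarrow> bool) \<Rightarrow> diagram \<Rightarrow> diagram \<Rightarrow> bool" where
  "local_change M L L' \<longleftrightarrow> link_diagram L \<and> link_diagram L' \<and>
     (\<exists>u l r v. M l r \<and> L = u @ l @ v \<and> L' = u @ r @ v)"

definition regular_isotopic :: "diagram \<Rightarrow> diagram \<Rightarrow> bool" where
  "regular_isotopic =
     equivclp (local_change (sup planar_move (sup reidemeister2 reidemeister3)))"

definition link_equivalent :: "diagram \<Rightarrow> diagram \<Rightarrow> bool" where
  "link_equivalent =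
     equivclp (local_change
       (sup planar_move (sup reidemeister1 (sup reidemeister2 reidemeister3))))"


subsection \<open>Conway quadruples and unions of unlinked knots\<close>

text \<open>
  The specified crossing is the letter between the words \<open>u\<close> and \<open>v\<close>.  Its horizontal smoothing
  consists of a maximum with a minimum above it, its vertical smoothing of two vertical strands.
\<close>

definition conway_quadruple ::
  "diagram \<Rightarrow> nat \<Rightarrow> diagram \<Rightarrow> diagram \<Rightarrow> diagram \<Rightarrow> diagram \<Rightarrow> diagram \<Rightarrow> bool" where
  "conway_quadruple u i v Lplus Lminus L0 Linf \<longleftrightarrow>
     link_diagram Lplus \<and>
     Lplus = u @ [(X Pos, i)] @ v \<and>
     Lminus = u @ [(X Neg, i)] @ v \<and>
     L0 = u @ [(Cap, i), (Cup, i)] @ v \<and>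
     Linf = u @ v"

definition mixed_crossing :: "diagram \<Rightarrow> nat \<Rightarrow> nat \<Rightarrow> bool" where
  "mixed_crossing L t i \<longleftrightarrow> \<not> same_component L (t, i) (t, Suc i)"

definition knot_diagram :: "diagram \<Rightarrow> bool" where
  "knot_diagram K \<longleftrightarrow> link_diagram K \<and> num_components K = 1"

text \<open>
  Concatenation of closed diagrams stacks them in disjoint horizontal strips, so \<open>concat Ks\<close>
  is a split diagram with split components \<open>Ks\<close>.
\<close>

definition unlinked_knots :: "nat \<Rightarrow> diagram \<Rightarrow> bool" where
  "unlinked_knots r L \<longleftrightarrow> link_diagram L \<and>
     (\<exists>Ks. length Ks = r \<and> (\<forall>K\<in>set Ks. knot_diagram K) \<and> link_equivalent L (concat Ks))"


section \<open>Laurent polynomials\<close>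

text \<open>
  The ring of Laurent polynomials in \<open>z, w, a, E\<close> with integer coefficients is the group ring of the
  free abelian group of monomials; monomials are written additively, as maps from indeterminates
  to exponents.
\<close>

datatype indet = iz | iw | ia | iE

type_synonym monomial = "indet \<Rightarrow>\<^sub>0 int"

type_synonym laurent = "monomial \<Rightarrow>\<^sub>0 int"

definition ipow :: "indet \<Rightarrow> int \<Rightarrow> laurent" where
  "ipow x k = frag_of (frag_cmul k (frag_of x))"

definition laurent_in :: "indet set \<Rightarrow> laurent \<Rightarrow> bool" where
  "laurent_in S f \<longleftrightarrow> (\<forall>m \<in> Poly_Mapping.keys f. Poly_Mapping.keys m \<subseteq> S)"

text \<open>Simultaneous substitution of the monomial \<open>\<sigma> x\<close> for every indeterminate \<open>x\<close>.\<close>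

definition subst :: "(indet \<Rightarrow> monomial) \<Rightarrow> laurent \<Rightarrow> laurent" where
  "subst \<sigma> = frag_extend (\<lambda>m. frag_of (frag_extend \<sigma> m))"


section \<open>The invariants\<close>

definition regular_isotopy_invariant :: "(diagram \<Rightarrow> laurent) \<Rightarrow> bool" where
  "regular_isotopy_invariant F \<longleftrightarrow>
     (\<forall>L L'. link_diagram L \<and> link_diagram L' \<and> regular_isotopic L L' \<longrightarrow> F L = F L')"

definition is_T :: "(diagram \<Rightarrow> laurent) \<Rightarrow> bool" where
  "is_T T \<longleftrightarrow>
     regular_isotopy_invariant T \<and>
     (\<forall>L. link_diagram L \<longrightarrow> laurent_in {iw, ia} (T L)) \<and>
     (\<forall>u i v Lplus Lminus L0 Linf.
        conway_quadruple u i v Lplus Lminus L0 Linf \<longrightarrow>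
        T Lplus - T Lminus = ipow iw 1 * (T L0 - T Linf)) \<and>
     (\<forall>u l v. link_diagram (u @ l @ v) \<and> positive_curl l \<longrightarrow>
        T (u @ l @ v) = ipow ia 1 * T (u @ v)) \<and>
     (\<forall>u l v. link_diagram (u @ l @ v) \<and> negative_curl l \<longrightarrow>
        T (u @ l @ v) = ipow ia (-1) * T (u @ v)) \<and>
     T unknot = 1"

text \<open>
  The defining properties of \<open>D[T]\<close>.  They determine the values on all link diagrams, but this
  is not made part of the definition.
\<close>

definition is_DT :: "(diagram \<Rightarrow> laurent) \<Rightarrow> (diagram \<Rightarrow> laurent) \<Rightarrow> bool" where
  "is_DT T F \<longleftrightarrow>
     regular_isotopy_invariant F \<and>
     (\<forall>u i v Lplus Lminus L0 Linf.
        conway_quadruple u i v Lplus Lminus L0 Linf \<and> mixed_crossing Lplus (length u) i \<longrightarrow>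
        F Lplus - F Lminus = ipow iz 1 * (F L0 - F Linf)) \<and>
     (\<forall>r L. r \<ge> 1 \<and> unlinked_knots r L \<longrightarrow> F L = ipow iE (1 - int r) * T L)"

text \<open>\<open>D[D](z,a,E)\<close> is \<open>D[T](z,w,a,E)\<close> in the case \<open>w = z\<close>.\<close>

definition DD_of :: "(diagram \<Rightarrow> laurent) \<Rightarrow> diagram \<Rightarrow> laurent" where
  "DD_of DT L = subst (frag_of(iw := frag_of iz)) (DT L)"

text \<open>The replacement of \<open>z\<close> by \<open>w\<close> and of \<open>E\<close> by \<open>E z / w\<close>.\<close>

definition hat_subst :: "laurent \<Rightarrow> laurent" where
  "hat_subst = subst (frag_of(iz := frag_of iw, iE := frag_of iE + frag_of iz - frag_of iw))"

definition topologically_equivalent :: "(diagram \<Rightarrow> laurent) \<Rightarrow> (diagram \<Rightarrow> laurent) \<Rightarrow> bool" where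
  "topologically_equivalent F G \<longleftrightarrow>
     (\<forall>L L'. link_diagram L \<and> link_diagram L' \<longrightarrow> (F L = F L' \<longleftrightarrow> G L = G L'))"

end

theory Submission
  imports Defs
begin

text \<open>
  Write \<open>\<sigma>\<close> for the substitution \<open>z \<mapsto> w\<close>, \<open>w \<mapsto> w\<close>, \<open>E \<mapsto> E z / w\<close>.  Both \<open>D[T](L)\<close> and \<open>(z/w)\<^sup>n\<^sup>-\<^sup>1 \<sigma>(D[T](L))\<close> satisfy the
  skein relation at crossings of two different components and agree on unions of unlinked knots.
  They coincide because a regular isotopy invariant \<open>H\<close> that satisfies this relation and vanishes
  on unions of unlinked knots is zero: by induction on the number of components, \<open>H\<close> does not see
  which strand of a mixed crossing is on top, so the components can be pulled apart.

  For the topological equivalence, \<open>D[D](L)\<close> has to determine the number \<open>n\<close> of components.  The same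
  uniqueness gives \<open>D[T](L) = E\<^sup>1\<^sup>-\<^sup>n\<close> at \<open>a = 1\<close>, once \<open>T = 1\<close> is known there.  At \<open>a = 1\<close> the invariant
  \<open>T\<close> also respects the first Reidemeister move and removes circles, and closed words reduce to the
  empty one: modulo the skein relation, the diagrams with \<open>n\<close> upper endpoints are spanned by those
  in which the arc at the rightmost endpoint runs over everything else, recursively.
\<close>

section \<open>Tangle words up to regular isotopy\<close>

text \<open>Components are classes of connected points, hence global, while moves and smoothings are
  local. The bridge is the number of two-colourings of the strands: it is 2^n for n components, and
  it can be computed by cutting the word at any level and summing over the colours at the cut, like
  a transfer matrix. Invariance of n under moves, and the loss of exactly one component when a mixed
  crossing is smoothed in either way, are read off from this count. That loss is why (z/w)^(n-1)
  turns the factor \<open>w\<close> of the substituted relation into \<open>z\<close>.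

  Pulling components apart uses colours too: a colouring that separates one component from the rest
  serves to sort the strands at every level, with one colour always on top; crossings that disagree
  are switched.

  At a = 1 curls of both signs have the same value, so the skein relation at a curl, where the unit
  \<open>w\<close> cancels, forces the factor 1 for a circle. Then \<open>T - 1\<close> obeys the
  same homogeneous relation as \<open>T\<close>, because constants cancel on both sides, and the
  span argument only has to show that it is zero.\<close>

lemma tangle_append: "tangle k (u @ v) l \<longleftrightarrow> (\<exists>m. tangle k u m \<and> tangle m v l)"
proof (induction u arbitrary: k)
  case (Cons x u)
  then show ?case
    by (cases x) (simp only: append_Cons tangle.simps, blast)
qed simp

lemma tangle_appendI: "tangle k u m \<Longrightarrow> tangle m v l \<Longrightarrow> tangle k (u @ v) l"
  by (auto simp: tangle_append)

lemma tangle_unique: "tangle k w l \<Longrightarrow> tangle k w l' \<Longrightarrow> l = l'"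
  by (induction w arbitrary: k) auto

lemma tangle_append_iff: "tangle k u m \<Longrightarrow> tangle k (u @ v) l \<longleftrightarrow> tangle m v l"
  using tangle_unique by (auto simp: tangle_append)

definition shift :: "nat \<Rightarrow> diagram \<Rightarrow> diagram" where
  "shift d w = map (\<lambda>(e, p). (e, p + d)) w"

lemma shift_simps [simp]:
  "shift d [] = []"
  "shift d ((e, p) # w) = (e, p + d) # shift d w"
  "shift d (u @ v) = shift d u @ shift d v"
  "shift 0 w = w"
  by (auto simp: shift_def)

text \<open>Naming the strands to the right of the tile by \<open>d\<close> replaces the truncated
  subtraction in \<open>tangle\<close> by addition.\<close>

lemma tangle_ConsE:
  assumes "tangle k ((e, p) # w) l"
  obtains d where "k = p + inputs e + d" "tangle (p + outputs e + d) w l"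
proof -
  have "p + inputs e \<le> k"
    using assms by simp
  then obtain d where "k = p + inputs e + d"
    using le_iff_add by blast
  then show thesis
    using assms that[of d] by (simp add: add.commute add.left_commute)
qed

lemma tangle_ConsI:
  assumes "tangle (p + outputs e + d) w l" "k = p + inputs e + d"
  shows "tangle k ((e, p) # w) l"
  using assms by (simp add: add.commute add.left_commute)

lemma tangle_widen: "tangle k w l \<Longrightarrow> tangle (k + d) w (l + d)"
proof (induction w arbitrary: k)
  case (Cons x w)
  obtain e p where x: "x = (e, p)" by (cases x)
  obtain c where c: "k = p + inputs e + c" "tangle (p + outputs e + c) w l"
    using Cons.prems unfolding x by (rule tangle_ConsE)
  have "tangle (p + outputs e + (c + d)) w (l + d)"
    using Cons.IH[OF c(2)] by (simp add: add.assoc)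
  then show ?case
    unfolding x by (rule tangle_ConsI) (simp add: c)
qed simp

lemma tangle_shift: "tangle k w l \<Longrightarrow> tangle (d + k) (shift d w) (d + l)"
proof (induction w arbitrary: k)
  case (Cons x w)
  obtain e p where x: "x = (e, p)" by (cases x)
  obtain c where c: "k = p + inputs e + c" "tangle (p + outputs e + c) w l"
    using Cons.prems unfolding x by (rule tangle_ConsE)
  have "tangle (p + d + outputs e + c) (shift d w) (d + l)"
    using Cons.IH[OF c(2)] by (simp add: ac_simps)
  then show ?case
    unfolding x shift_simps by (rule tangle_ConsI) (simp add: c)
qed simp

abbreviation regular_move :: "diagram \<Rightarrow> diagram \<Rightarrow> bool" where
  "regular_move \<equiv> sup planar_move (sup reidemeister2 reidemeister3)"

lemma regular_move_tangle: "regular_move a b \<Longrightarrow> tangle k a l \<Longrightarrow> tangle k b l"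
  by (auto elim!: planar_move.cases reidemeister2.cases reidemeister3.cases)

text \<open>\<open>regular_isotopic\<close> relates closed words only. The version with open ends
  can be used inside a context, so each manipulation is proved once, for the piece of the diagram
  that it touches.\<close>

definition isotopy_step :: "nat \<Rightarrow> nat \<Rightarrow> diagram \<Rightarrow> diagram \<Rightarrow> bool" where
  "isotopy_step k l w w' \<longleftrightarrow> tangle k w l \<and> tangle k w' l \<and>
     (\<exists>u a b v. regular_move a b \<and> w = u @ a @ v \<and> w' = u @ b @ v)"

definition isotopic :: "nat \<Rightarrow> nat \<Rightarrow> diagram \<Rightarrow> diagram \<Rightarrow> bool" where
  "isotopic k l = equivclp (isotopy_step k l)"

lemma isotopic_refl [simp]: "isotopic k l w w"
  by (simp add: isotopic_def)

lemma isotopic_sym [sym]: "isotopic k l w w' \<Longrightarrow> isotopic k l w' w"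
  by (simp add: isotopic_def equivclp_sym)

lemma isotopic_trans [trans]: "isotopic k l w w' \<Longrightarrow> isotopic k l w' w'' \<Longrightarrow> isotopic k l w w''"
  unfolding isotopic_def by (rule equivclp_trans)

lemma isotopic_tangle: "isotopic k l w w' \<Longrightarrow> tangle k w l \<longleftrightarrow> tangle k w' l"
  unfolding isotopic_def
  by (induction rule: equivclp_induct) (auto simp: isotopy_step_def)

lemma isotopic_context:
  assumes "isotopic k' l' a b" "tangle k u k'" "tangle l' v l"
  shows "isotopic k l (u @ a @ v) (u @ b @ v)"
  using assms(1) unfolding isotopic_def
proof (induction rule: equivclp_induct)
  case (step y z)
  have "isotopy_step k l (u @ c @ v) (u @ d @ v)" if step: "isotopy_step k' l' c d" for c d
  proof -
    obtain u' a' b' v' where "regular_move a' b'" "c = u' @ a' @ v'" "d = u' @ b' @ v'"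
      using step by (auto simp: isotopy_step_def)
    moreover have "tangle k (u @ c @ v) l" "tangle k (u @ d @ v) l"
      using assms(2,3) step by (auto simp: isotopy_step_def tangle_append)
    ultimately show ?thesis
      unfolding isotopy_step_def by (metis append.assoc)
  qed
  then show ?case
    using step by (metis equivclp_into_equivclp)
qed simp

lemma isotopic_move:
  assumes "regular_move a b" "tangle k (u @ a @ v) l"
  shows "isotopic k l (u @ a @ v) (u @ b @ v)"
proof -
  have "tangle k (u @ b @ v) l"
    using assms regular_move_tangle by (fastforce simp: tangle_append)
  then have "isotopy_step k l (u @ a @ v) (u @ b @ v)"
    using assms unfolding isotopy_step_def by blast
  then show ?thesis
    by (auto simp: isotopic_def)
qed

lemma isotopic_planar:
  assumes "planar_move a b" "tangle k (u @ a @ v) l"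
  shows "isotopic k l (u @ a @ v) (u @ b @ v)"
  using assms by (intro isotopic_move) auto

lemma isotopic_reidemeister2:
  assumes "tangle k (u @ [(X c, i), (X (switch c), i)] @ v) l"
  shows "isotopic k l (u @ [(X c, i), (X (switch c), i)] @ v) (u @ v)"
  using isotopic_move[of "[(X c, i), (X (switch c), i)]" "[]"] assms
  by (auto simp: reidemeister2.simps)

lemma isotopic_reidemeister3:
  assumes "\<not> (c1 = c3 \<and> c2 \<noteq> c1)" "tangle k (u @ [(X c1, i), (X c2, Suc i), (X c3, i)] @ v) l"
  shows "isotopic k l (u @ [(X c1, i), (X c2, Suc i), (X c3, i)] @ v)
    (u @ [(X c3, Suc i), (X c2, i), (X c1, Suc i)] @ v)"
  using assms by (intro isotopic_move) (auto intro: reidemeister3.intros)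

lemma isotopic_append:
  assumes "isotopic k l a b" "tangle l v m"
  shows "isotopic k m (a @ v) (b @ v)"
  using isotopic_context[OF assms(1), of k "[]" v m] assms(2) by simp

lemma isotopic_prepend:
  assumes "isotopic k l a b" "tangle m u k"
  shows "isotopic m l (u @ a) (u @ b)"
  using isotopic_context[OF assms(1), of m u "[]" l] assms(2) by simp

lemma isotopic_exchange_tile:
  assumes "tangle m w n" "k = p + inputs e + d" "l = p + outputs e + d"
  shows "isotopic (k + m) (l + n) (shift k w @ [(e, p)]) ((e, p) # shift l w)"
  using assms(1)
proof (induction w arbitrary: m)
  case Nil
  then show ?case by simp
next
  case (Cons x w)
  obtain y q where x: "x = (y, q)" by (cases x)
  let ?m = "m - inputs y + outputs y"
  have w: "tangle ?m w n" and q: "q + inputs y \<le> m"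
    using Cons.prems x by auto
  have "isotopic (k + m) (l + n) ([(y, q + k)] @ shift k w @ [(e, p)]) ([(y, q + k)] @ (e, p) # shift l w)"
    using q by (intro isotopic_prepend[OF Cons.IH[OF w]]) simp
  moreover have "planar_move [(e, p), (y, q + l)] [(y, q + k), (e, p)]"
    using planar_move.exchange[of e p y "d + q"] assms by (simp add: algebra_simps)
  then have "isotopic (k + m) (l + n) ([] @ [(e, p), (y, q + l)] @ shift l w)
    ([] @ [(y, q + k), (e, p)] @ shift l w)"
  proof (rule isotopic_planar)
    have "k + m - inputs e + outputs e - inputs y + outputs y = l + ?m"
      using q assms by auto
    then show "tangle (k + m) ([] @ [(e, p), (y, q + l)] @ shift l w) (l + n)"
      using q assms tangle_shift[OF w, of l] by auto
  qed
  ultimately show ?case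
    unfolding x by (auto intro: isotopic_trans isotopic_sym)
qed

text \<open>\<open>w\<close> lies to the right of all strands of \<open>u\<close>, so the heights
  can be exchanged tile by tile. The offset of \<open>w\<close> changes because \<open>u\<close> may
  alter the number of strands on its left.\<close>

lemma isotopic_exchange:
  assumes "tangle k u l" "tangle m w n"
  shows "isotopic (k + m) (l + n) (shift k w @ u) (u @ shift l w)"
  using assms(1)
proof (induction u arbitrary: k)
  case (Cons x u)
  obtain e p where x: "x = (e, p)" by (cases x)
  obtain d where k: "k = p + inputs e + d"
    using Cons.prems x by (auto simp: le_iff_add)
  define k' where "k' = p + outputs e + d"
  have u: "tangle k' u l"
    using Cons.prems by (simp add: x k k'_def add.commute add.left_commute)
  have "isotopic (k + m) (l + n) ((shift k w @ [(e, p)]) @ u) (((e, p) # shift k' w) @ u)"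
    using isotopic_exchange_tile[OF assms(2) k k'_def] tangle_widen[OF u, of n]
    by (rule isotopic_append)
  moreover have "isotopic (k + m) (l + n) ([(e, p)] @ shift k' w @ u) ([(e, p)] @ u @ shift l w)"
    using Cons.IH[OF u] by (rule isotopic_prepend) (simp add: k k'_def)
  ultimately show ?case
    unfolding x by (auto intro: isotopic_trans)
qed simp


subsection \<open>Sliding an overstrand past a tile\<close>

text \<open>In \<open>X Neg\<close> the strand that ascends to the right is on top.\<close>

definition over_right :: "nat \<Rightarrow> nat \<Rightarrow> diagram" where
  "over_right i n = map (Pair (X Neg)) [i..<i + n]"

lemma over_right_0 [simp]: "over_right i 0 = []"
  by (simp add: over_right_def)

lemma over_right_Suc: "over_right i (Suc n) = over_right i n @ [(X Neg, i + n)]"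
  by (simp add: over_right_def)

lemma over_right_Suc_left: "over_right i (Suc n) = (X Neg, i) # over_right (Suc i) n"
  by (simp add: over_right_def upt_rec[of i])

lemma over_right_add: "over_right i (m + n) = over_right i m @ over_right (i + m) n"
  by (induction n) (simp_all add: over_right_Suc add.assoc)

lemma shift_over_right [simp]: "shift d (over_right i n) = over_right (i + d) n"
  by (induction n) (simp_all add: over_right_Suc)

lemma tangle_over_right: "i + n < k \<Longrightarrow> tangle k (over_right i n) k"
  by (induction n) (auto simp: over_right_Suc tangle_append)

lemma tangle_over_right_iff: "i + n < k \<Longrightarrow> tangle k (over_right i n) l \<longleftrightarrow> k = l"
  using tangle_over_right tangle_unique by blast

text \<open>The overstrand passes a minimum or maximum by a slide and the second Reidemeister move,
  and a crossing by the third. With \<open>X Neg\<close> in the first two places the excluded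
  pattern of three crossings cannot occur, whatever the type of the tile.\<close>

lemma slide_right_tile:
  assumes "k = Suc (i + inputs e + d)" "l = Suc (i + outputs e + d)"
  shows "isotopic k l (over_right i (inputs e) @ [(e, i)]) ((e, Suc i) # over_right i (outputs e))"
proof (cases e)
  case Cup
  have "isotopic k l ([] @ [(Cup, Suc i), (X Neg, i)] @ [(X Neg, Suc i)])
      ([] @ [(Cup, i), (X (switch Neg), Suc i)] @ [(X Neg, Suc i)])"
    using assms Cup by (intro isotopic_planar planar_move.intros) auto
  also have "isotopic k l \<dots> ([(Cup, i)] @ [])"
    using isotopic_reidemeister2[of k "[(Cup, i)]" Pos "Suc i" "[]"] assms Cup by simp
  finally show ?thesis
    using Cup by (simp add: over_right_def upt_rec numeral_2_eq_2 isotopic_sym)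
next
  case Cap
  have "isotopic k l ([(X Neg, i)] @ [(X Pos, i), (Cap, Suc i)] @ [])
      ([(X Neg, i)] @ [(X (switch Pos), Suc i), (Cap, i)] @ [])"
    using assms Cap by (intro isotopic_planar planar_move.intros) auto
  moreover have "isotopic k l ([] @ [(X Neg, i), (X (switch Neg), i)] @ [(Cap, Suc i)]) ([] @ [(Cap, Suc i)])"
    using assms Cap by (intro isotopic_reidemeister2) auto
  ultimately have "isotopic k l [(X Neg, i), (X Neg, Suc i), (Cap, i)] [(Cap, Suc i)]"
    by (auto intro: isotopic_trans isotopic_sym)
  then show ?thesis
    using Cap by (simp add: over_right_def upt_rec numeral_2_eq_2)
next
  case (X c)
  then have "isotopic k l ([] @ [(X Neg, i), (X Neg, Suc i), (X c, i)] @ [])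
      ([] @ [(X c, Suc i), (X Neg, i), (X Neg, Suc i)] @ [])"
    using assms by (intro isotopic_reidemeister3) auto
  then show ?thesis
    using X by (simp add: over_right_def upt_rec numeral_2_eq_2)
qed

text \<open>The overstrand crosses \<open>q\<close> strands left of the tile, then the strands of
  the tile, then \<open>r\<close> strands right of it; the outer crossings pass the tile by height
  exchange. Below, the tile is one place further right since the overstrand is still on its
  left.\<close>

lemma slide_right:
  assumes n: "n = q + inputs e + r" "n' = q + outputs e + r"
    and k: "k = Suc (i + n + d)" "l = Suc (i + n' + d)"
  shows "isotopic k l (over_right i n @ [(e, i + q)]) ((e, Suc (i + q)) # over_right i n')"
proof -
  have "isotopic k l
      (over_right i (q + inputs e) @ shift (i + q + inputs e) (over_right 0 r) @ [(e, i + q)])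
      (over_right i (q + inputs e) @ (e, i + q) # shift (i + q + outputs e) (over_right 0 r))"
    using assms tangle_over_right[of 0 r "Suc (r + d)"] isotopic_exchange_tile[of "Suc (r + d)" "over_right 0 r"
        "Suc (r + d)" "i + q + inputs e" "i + q" e 0]
    by (intro isotopic_prepend) (auto simp: tangle_over_right ac_simps)
  also have "isotopic k l \<dots>
      (over_right i q @ ((e, Suc (i + q)) # over_right (i + q) (outputs e)) @ over_right (i + q + outputs e) r)"
  proof -
    have "isotopic k l (over_right i q @ (over_right (i + q) (inputs e) @ [(e, i + q)]) @
        over_right (i + q + outputs e) r) (over_right i q @ ((e, Suc (i + q)) # over_right (i + q) (outputs e)) @
        over_right (i + q + outputs e) r)"
      using assms by (intro isotopic_context[OF slide_right_tile[of k "i + q" e "r + d" l]])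
        (auto simp: tangle_over_right)
    then show ?thesis
      by (simp add: over_right_add)
  qed
  also have "isotopic k l \<dots>
      (([(e, Suc (i + q))] @ over_right i q) @ over_right (i + q) (outputs e) @ over_right (i + q + outputs e) r)"
  proof -
    have "isotopic (Suc (i + q) + (inputs e + (r + d))) (Suc (i + q) + (outputs e + (r + d)))
      (shift (Suc (i + q)) [(e, 0)] @ over_right i q) (over_right i q @ shift (Suc (i + q)) [(e, 0)])"
      by (intro isotopic_exchange) (auto simp: tangle_over_right)
    then have a: "isotopic k l (over_right i q @ [(e, Suc (i + q))]) ([(e, Suc (i + q))] @ over_right i q)"
      using assms by (auto simp: ac_simps intro: isotopic_sym)
    have b: "tangle l (over_right (i + q) (outputs e) @ over_right (i + q + outputs e) r) l"
      using assms by (intro tangle_appendI[of _ _ l] tangle_over_right) auto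
    show ?thesis
      using isotopic_append[OF a b] by simp
  qed
  finally show ?thesis
    by (simp add: n over_right_add add.assoc)
qed


section \<open>Monomial substitutions\<close>

lemma frag_of_mult: "(frag_of m :: laurent) * frag_of n = frag_of (m + n)"
  by (simp add: mult_single)

lemma laurent_induct [case_names zero one diff]:
  fixes f :: laurent
  assumes "P 0" "\<And>m. m \<in> Poly_Mapping.keys f \<Longrightarrow> P (frag_of m)" "\<And>a b. P a \<Longrightarrow> P b \<Longrightarrow> P (a - b)"
  shows "P f"
  using subset_refl assms by (rule frag_induction)

lemma subst_0 [simp]: "subst \<sigma> 0 = 0"
  by (simp add: subst_def)

lemma subst_diff: "subst \<sigma> (f - g) = subst \<sigma> f - subst \<sigma> g"
  by (simp add: subst_def frag_extend_diff)

lemma subst_frag_of: "subst \<sigma> (frag_of m) = frag_of (frag_extend \<sigma> m)"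
  by (simp add: subst_def)

lemma subst_1 [simp]: "subst \<sigma> 1 = 1"
  using subst_frag_of[of \<sigma> 0] by simp

lemma subst_mult: "subst \<sigma> (f * g) = subst \<sigma> f * subst \<sigma> g"
proof (induction f rule: laurent_induct)
  case (one m)
  show ?case
  proof (induction g rule: laurent_induct)
    case (one n)
    then show ?case
      by (simp add: frag_of_mult subst_frag_of frag_extend_add)
  qed (simp_all add: subst_diff algebra_simps)
qed (simp_all add: subst_diff algebra_simps)

lemma subst_subst: "subst \<tau> (subst \<sigma> f) = subst (\<lambda>x. frag_extend \<tau> (\<sigma> x)) f"
proof (induction f rule: laurent_induct)
  case (one m)
  have "frag_extend \<tau> (frag_extend \<sigma> m) = frag_extend (\<lambda>x. frag_extend \<tau> (\<sigma> x)) m"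
    by (induction m rule: frag_induction[OF subset_refl]) (simp_all add: frag_extend_diff)
  then show ?case
    by (simp add: subst_frag_of)
qed (simp_all add: subst_diff)

lemma subst_id_on:
  assumes "laurent_in S f" "\<And>x. x \<in> S \<Longrightarrow> \<sigma> x = frag_of x"
  shows "subst \<sigma> f = f"
proof (induction f rule: laurent_induct)
  case (one m)
  then have "frag_extend \<sigma> m = frag_extend frag_of m"
    using assms by (intro frag_extend_eq) (auto simp: laurent_in_def)
  then show ?case
    by (simp add: subst_frag_of flip: frag_expansion)
qed (simp_all add: subst_diff)

lemma ipow_0 [simp]: "ipow x 0 = 1"
  by (simp add: ipow_def)

lemma ipow_add: "ipow x (j + k) = ipow x j * ipow x k"
  by (simp add: ipow_def frag_of_mult frag_cmul_distrib)

lemma ipow_inverse: "ipow x k * ipow x (- k) = 1"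
  by (simp flip: ipow_add)

lemma subst_ipow: "subst \<sigma> (ipow x k) = frag_of (frag_cmul k (\<sigma> x))"
  by (simp add: ipow_def subst_frag_of frag_extend_cmul)

lemma ipow_inject: "ipow x j = ipow x k \<longleftrightarrow> j = k"
proof
  assume "ipow x j = ipow x k"
  then have "frag_cmul j (frag_of x) = frag_cmul k (frag_of x)"
    unfolding ipow_def frag_of_eq .
  from arg_cong[OF this, of "\<lambda>m. Poly_Mapping.lookup m x"] show "j = k"
    by simp
qed simp


section \<open>Reduction of closed words by the skein relation\<close>

text \<open>The arc from a new point \<open>j\<close> to a new rightmost point that runs over everything else.\<close>

definition arc :: "nat \<Rightarrow> nat \<Rightarrow> diagram" where
  "arc j n = (Cup, j) # over_right (Suc j) (n - j)"

lemma tangle_arc: "j \<le> n \<Longrightarrow> tangle n (arc j n) (n + 2)"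
  by (auto simp: arc_def tangle_over_right_iff)

lemma shift_arc [simp]: "shift d (arc j n) = arc (j + d) (n + d)"
  by (simp add: arc_def)

lemma isotopic_planarI:
  assumes "planar_move a b" "w = u @ a @ v" "w' = u @ b @ v" "tangle k w l"
  shows "isotopic k l w w'"
  using isotopic_planar assms by blast

lemma planar_exchangeI:
  "q' = p + outputs x + d \<Longrightarrow> q = p + inputs x + d \<Longrightarrow> planar_move [(x, p), (y, q')] [(y, q), (x, p)]"
  using planar_move.exchange by blast

lemma over_right_exchange:
  assumes "k = p + inputs e + m + Suc d" "l = p + outputs e + m + Suc d"
  shows "isotopic k l (over_right (p + inputs e) m @ [(e, p)]) ((e, p) # over_right (p + outputs e) m)"
  using isotopic_exchange_tile[of "m + Suc d" "over_right 0 m" "m + Suc d" "p + inputs e" p e 0 "p + outputs e"]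
    assms by (simp add: tangle_over_right_iff add.assoc)

section \<open>A further tile on top of an overcrossing arc\<close>

lemma arc_tile_left:
  assumes "j = p + inputs e + d" "n = j + r" "j' = p + outputs e + d" "n' = j' + r" "l = n' + 2"
  shows "isotopic n l (arc j n @ [(e, p)]) ((e, p) # arc j' n')"
  using isotopic_exchange_tile[OF tangle_arc[of d "d + r"], of "p + inputs e" p e 0] assms
  by (simp add: ac_simps)

text \<open>The tile lies strictly between the two ends of the arc, so it passes down under the
  right leg and then past the cup.\<close>

lemma arc_tile_right:
  assumes "n = j + q + inputs e + r" "n' = j + q + outputs e + r" "l = n' + 2"
  shows "isotopic n l (arc j n @ [(e, Suc (j + q))]) ((e, j + q) # arc j n')"
proof -
  have "isotopic (n + 2) l (over_right (Suc j) (n - j) @ [(e, Suc j + q)])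
      ((e, Suc (Suc j + q)) # over_right (Suc j) (n' - j))"
    using assms by (intro slide_right[of _ q e r _ _ _ 0]) auto
  from isotopic_prepend[OF this, of n "[(Cup, j)]"]
  have "isotopic n l (arc j n @ [(e, Suc (j + q))])
      ([(Cup, j), (e, Suc (Suc j + q))] @ over_right (Suc j) (n' - j))"
    using assms by (simp add: arc_def)
  also have "isotopic n l \<dots> ((e, j + q) # arc j n')"
    using assms by (intro isotopic_planarI[where u = "[]", OF planar_exchangeI[of _ j Cup q]])
      (auto simp: arc_def tangle_over_right_iff)
  finally show ?thesis .
qed

text \<open>In \<open>X Pos\<close> the strand arriving from the right is on top. Here this is the
  left leg of the arc, so the crossing merely prolongs the arc by one more overcrossing.\<close>

lemma arc_leg_left:
  assumes "n = Suc (j + m)" "l = n + 2"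
  shows "isotopic n l (arc (Suc j) n @ [(X Pos, j)]) (arc j n)"
proof -
  have "isotopic l l (over_right (j + inputs (X Pos)) m @ [(X Pos, j)])
      ((X Pos, j) # over_right (j + outputs (X Pos)) m)"
    using assms by (intro over_right_exchange[where d = 0]) auto
  from isotopic_prepend[OF this, of n "[(Cup, Suc j)]"]
  have "isotopic n l (arc (Suc j) n @ [(X Pos, j)]) ([(Cup, Suc j), (X Pos, j)] @ over_right (Suc (Suc j)) m)"
    using assms by (simp add: arc_def numeral_2_eq_2)
  also have "isotopic n l \<dots> (arc j n)"
    using assms by (intro isotopic_planarI[where u = "[]", OF planar_move.cup_slide])
      (auto simp: arc_def Suc_diff_le over_right_Suc_left tangle_over_right_iff)
  finally show ?thesis .
qed

text \<open>Sliding the first crossing of the right leg through the cup turns it into the inverse of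
  the added crossing, and the two cancel.\<close>

lemma arc_leg_right:
  assumes "n = Suc (j + m)" "l = n + 2"
  shows "isotopic n l (arc j n @ [(X Neg, j)]) (arc (Suc j) n)"
proof -
  let ?m = "over_right (Suc (Suc j)) m"
  have "isotopic l l (over_right (j + inputs (X Neg)) m @ [(X Neg, j)])
      ((X Neg, j) # over_right (j + outputs (X Neg)) m)"
    using assms by (intro over_right_exchange[where d = 0]) auto
  from isotopic_prepend[OF this, of n "[(Cup, j), (X Neg, Suc j)]"]
  have "isotopic n l (arc j n @ [(X Neg, j)]) ([(Cup, j), (X Neg, Suc j), (X Neg, j)] @ ?m)"
    using assms by (simp add: arc_def numeral_2_eq_2 Suc_diff_le over_right_Suc_left)
  also have "isotopic n l \<dots> ([(Cup, Suc j), (X Pos, j), (X Neg, j)] @ ?m)"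
    using assms by (intro isotopic_sym[OF isotopic_planarI[where u = "[]", OF planar_move.cup_slide]])
      (auto simp: tangle_over_right_iff)
  also have "isotopic n l \<dots> ([(Cup, Suc j)] @ ?m)"
    using assms isotopic_reidemeister2[of n "[(Cup, Suc j)]" Pos j ?m l]
    by (auto simp: tangle_over_right_iff)
  finally show ?thesis
    using assms by (simp add: arc_def)
qed

text \<open>The capped strand and the left leg form a snake. Once it is straightened, that strand
  continues along the right leg and runs over the others.\<close>

lemma arc_cap_left:
  assumes "n = Suc (j + m)"
  shows "isotopic n n (arc (Suc j) n @ [(Cap, j)]) (over_right j m)"
proof -
  have "isotopic (n + 2) n (over_right (j + inputs Cap) m @ [(Cap, j)])
      ((Cap, j) # over_right (j + outputs Cap) m)"
    using assms by (intro over_right_exchange[where d = 0]) auto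
  from isotopic_prepend[OF this, of n "[(Cup, Suc j)]"]
  have "isotopic n n (arc (Suc j) n @ [(Cap, j)]) ([(Cup, Suc j), (Cap, j)] @ over_right j m)"
    using assms by (simp add: arc_def numeral_2_eq_2)
  also have "isotopic n n \<dots> (over_right j m)"
    using assms by (intro isotopic_planarI[where u = "[]", OF planar_move.snake_right])
      (auto simp: tangle_over_right_iff)
  finally show ?thesis .
qed

text \<open>The capped strand is the first one that the right leg crosses, so the cap closes this
  crossing to a kink. The kink stays for now, because regular isotopy cannot remove it.\<close>

lemma arc_cap_right:
  assumes "n = Suc (j + m)"
  shows "isotopic n n (arc j n @ [(Cap, j)]) ([(Cup, j), (X Neg, Suc j), (Cap, j)] @ over_right j m)"
proof -
  have "isotopic (n + 2) n (over_right (j + inputs Cap) m @ [(Cap, j)])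
      ((Cap, j) # over_right (j + outputs Cap) m)"
    using assms by (intro over_right_exchange[where d = 0]) auto
  from isotopic_prepend[OF this, of n "[(Cup, j), (X Neg, Suc j)]"] show ?thesis
    using assms by (simp add: arc_def numeral_2_eq_2 Suc_diff_le over_right_Suc_left)
qed

text \<open>The strand that is capped with the right leg ends up running back to the left over the
  \<open>m\<close> strands that the arc crossed. Each slide of a crossing through the cap reverses
  its type, whence \<open>X Pos\<close> at descending positions.\<close>

lemma arc_cap_last:
  assumes "n = Suc (j + m + d)"
  shows "isotopic n n ((Cup, j) # over_right (Suc j) m @ [(Cap, Suc (j + m))])
    (map (Pair (X Pos)) (rev [j..<j + m]))"
  using assms
proof (induction m arbitrary: d)
  case 0
  then show ?case
    by (intro isotopic_planarI[where u = "[]" and v = "[]", OF planar_move.snake_left]) auto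
next
  case (Suc m)
  let ?u = "(Cup, j) # over_right (Suc j) m"
  let ?k = "Suc (Suc (j + m))"
  have "isotopic n n (?u @ [(X Neg, Suc (j + m)), (Cap, ?k)]) (?u @ [(X Pos, ?k), (Cap, Suc (j + m))])"
    using Suc.prems planar_move.cap_slide[of Neg "Suc (j + m)"]
    by (intro isotopic_planarI[where u = ?u and v = "[]"])
      (auto intro!: tangle_appendI[of _ _ "n + 2"] simp: tangle_over_right_iff)
  also have "isotopic n n \<dots> (((X Pos, j + m) # ?u) @ [(Cap, Suc (j + m))])"
  proof -
    have "isotopic (j + m + (2 + d)) (j + m + 2 + (2 + d))
        (shift (j + m) [(X Pos, 0)] @ ?u) (?u @ shift (j + m + 2) [(X Pos, 0)])"
      by (intro isotopic_exchange) (auto simp: tangle_over_right_iff)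
    then have "isotopic n (n + 2) (?u @ [(X Pos, ?k)]) ((X Pos, j + m) # ?u)"
      using Suc.prems by (simp add: isotopic_sym)
    from isotopic_append[OF this, of "[(Cap, Suc (j + m))]" n] show ?thesis
      using Suc.prems by simp
  qed
  also have "isotopic n n \<dots> ([(X Pos, j + m)] @ map (Pair (X Pos)) (rev [j..<j + m]))"
    using isotopic_prepend[OF Suc.IH[of "Suc d"], of n "[(X Pos, j + m)]"] Suc.prems by simp
  finally show ?case
    by (simp add: over_right_Suc)
qed

text \<open>The model is \<open>T - 1\<close> at a = 1. The empty word is not a link diagram, but
  all reductions end there, so the normalisation is imposed on it.\<close>

locale link_skein =
  fixes U :: "diagram \<Rightarrow> 'r :: comm_ring_1" and \<omega> :: 'r
  assumes isotopic: "tangle 0 w 0 \<Longrightarrow> isotopic 0 0 w w' \<Longrightarrow> U w = U w'"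
    and kink: "tangle 0 (u @ l @ v) 0 \<Longrightarrow> kink c l \<Longrightarrow> U (u @ l @ v) = U (u @ v)"
    and circle: "tangle 0 (u @ [(Cup, i), (Cap, i)] @ v) 0 \<Longrightarrow>
      U (u @ [(Cup, i), (Cap, i)] @ v) = U (u @ v)"
    and skein: "tangle 0 (u @ [(X Pos, i)] @ v) 0 \<Longrightarrow>
      U (u @ [(X Pos, i)] @ v) - U (u @ [(X Neg, i)] @ v) =
      \<omega> * (U (u @ [(Cap, i), (Cup, i)] @ v) - U (u @ v))"
    and empty: "U [] = 0"
begin

text \<open>Kinks and circles can be removed under \<open>U\<close> but not by regular isotopy.
  Equal values under all closures is a weaker relation that admits both and is still compatible with
  contexts.\<close>

definition same_value :: "nat \<Rightarrow> nat \<Rightarrow> diagram \<Rightarrow> diagram \<Rightarrow> bool" where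
  "same_value k l x y \<longleftrightarrow> (\<forall>u v. tangle 0 u k \<longrightarrow> tangle l v 0 \<longrightarrow> U (u @ x @ v) = U (u @ y @ v))"

lemma same_value_trans [trans]:
  "same_value k l x y \<Longrightarrow> same_value k l y z \<Longrightarrow> same_value k l x z"
  by (simp add: same_value_def)

lemma same_value_isotopic: "isotopic k l x y \<Longrightarrow> tangle k x l \<Longrightarrow> same_value k l x y"
  unfolding same_value_def
  by (intro allI impI isotopic) (auto intro: tangle_appendI isotopic_context)

lemma same_value_kink: "kink c x \<Longrightarrow> tangle k x k \<Longrightarrow> same_value k k x []"
  unfolding same_value_def by (auto intro!: kink tangle_appendI)

lemma same_value_circle: "i \<le> k \<Longrightarrow> same_value k k [(Cup, i), (Cap, i)] []"
  unfolding same_value_def using circle by (fastforce intro!: tangle_appendI)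

lemma same_value_context:
  assumes "same_value k' l' x y" "tangle k u k'" "tangle l' v l"
  shows "same_value k l (u @ x @ v) (u @ y @ v)"
  unfolding same_value_def
proof (intro allI impI)
  fix u' v' assume "tangle 0 u' k" "tangle l v' 0"
  then have "tangle 0 (u' @ u) k'" "tangle l' (v @ v') 0"
    using assms by (auto intro: tangle_appendI)
  with assms(1) show "U (u' @ (u @ x @ v) @ v') = U (u' @ (u @ y @ v) @ v')"
    unfolding same_value_def by (metis append.assoc)
qed

lemma same_value_sym: "same_value k l x y \<Longrightarrow> same_value k l y x"
  by (simp add: same_value_def)

text \<open>A kink is inserted in the left leg of the minimum, and isotopy turns the result into a
  crossing on top of the minimum. The kink has type \<open>switch c\<close> because its crossing
  makes a quarter turn on the way.\<close>

lemma cup_twist: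
  assumes "i \<le> k" "l = k + 2"
  shows "same_value k l [(Cup, i), (X c, i)] [(Cup, i)]"
proof -
  have "same_value k l ([(Cup, i)] @ [(Cup, i), (X (switch c), Suc i), (Cap, i)] @ []) ([(Cup, i)] @ [] @ [])"
    using assms by (intro same_value_context[of l l] same_value_kink[OF kink.loop_left]) auto
  then have 1: "same_value k l [(Cup, i)] [(Cup, i), (Cup, i), (X (switch c), Suc i), (Cap, i)]"
    by (simp add: same_value_sym)
  have "isotopic k l [(Cup, i), (Cup, i), (X (switch c), Suc i), (Cap, i)]
      [(Cup, i), (Cup, i), (X c, i), (Cap, Suc i)]"
    using assms by (intro isotopic_sym[OF isotopic_planarI[where u = "[(Cup, i), (Cup, i)]" and v = "[]",
      OF planar_move.cap_slide]]) auto
  also have "isotopic k l \<dots> [(Cup, i), (Cup, i + 2), (X c, i), (Cap, Suc i)]"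
    using assms by (intro isotopic_sym[OF isotopic_planarI[where u = "[]" and v = "[(X c, i), (Cap, Suc i)]",
      OF planar_exchangeI[of _ i Cup 0]]]) auto
  also have "isotopic k l \<dots> [(Cup, i), (X c, i), (Cup, i + 2), (Cap, Suc i)]"
    using assms by (intro isotopic_sym[OF isotopic_planarI[where u = "[(Cup, i)]" and v = "[(Cap, Suc i)]",
      OF planar_exchangeI[of _ i "X c" 0]]]) auto
  also have "isotopic k l \<dots> [(Cup, i), (X c, i)]"
    using assms planar_move.snake_right[of "Suc i"]
    by (intro isotopic_planarI[where u = "[(Cup, i), (X c, i)]" and v = "[]"]) auto
  finally have "same_value k l [(Cup, i), (Cup, i), (X (switch c), Suc i), (Cap, i)] [(Cup, i), (X c, i)]"
    using assms by (intro same_value_isotopic) auto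
  with 1 show ?thesis
    by (blast intro: same_value_sym same_value_trans)
qed

lemma cap_twist:
  assumes "i \<le> l" "k = l + 2"
  shows "same_value k l [(X c, i), (Cap, i)] [(Cap, i)]"
proof -
  have "same_value k l ([] @ [(Cup, i), (X (switch c), Suc i), (Cap, i)] @ [(Cap, i)]) ([] @ [] @ [(Cap, i)])"
    using assms by (intro same_value_context[of k k] same_value_kink[OF kink.loop_left]) auto
  then have 1: "same_value k l [(Cap, i)] [(Cup, i), (X (switch c), Suc i), (Cap, i), (Cap, i)]"
    by (simp add: same_value_sym)
  have "isotopic k l [(Cup, i), (X (switch c), Suc i), (Cap, i), (Cap, i)]
      [(Cup, Suc i), (X c, i), (Cap, i), (Cap, i)]"
    using assms by (intro isotopic_sym[OF isotopic_planarI[where u = "[]" and v = "[(Cap, i), (Cap, i)]",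
      OF planar_move.cup_slide]]) auto
  also have "isotopic k l \<dots> [(Cup, Suc i), (X c, i), (Cap, i + 2), (Cap, i)]"
    using assms by (intro isotopic_planarI[where u = "[(Cup, Suc i), (X c, i)]" and v = "[]",
      OF planar_exchangeI[of _ i Cap 0]]) auto
  also have "isotopic k l \<dots> [(Cup, Suc i), (Cap, i + 2), (X c, i), (Cap, i)]"
    using assms by (intro isotopic_planarI[where u = "[(Cup, Suc i)]" and v = "[(Cap, i)]",
      OF planar_exchangeI[of _ i "X c" 0]]) auto
  also have "isotopic k l \<dots> [(X c, i), (Cap, i)]"
    using assms planar_move.snake_left[of "Suc i"]
    by (intro isotopic_planarI[where u = "[]" and v = "[(X c, i), (Cap, i)]"]) auto
  finally have "same_value k l [(Cup, i), (X (switch c), Suc i), (Cap, i), (Cap, i)] [(X c, i), (Cap, i)]"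
    using assms by (intro same_value_isotopic) auto
  with 1 show ?thesis
    by (blast intro: same_value_sym same_value_trans)
qed

text \<open>As each new arc ends at the rightmost point and lies over all earlier ones, there is
  exactly one such diagram for every way of pairing the \<open>n\<close> endpoints, and none for odd
  \<open>n\<close>.\<close>

inductive basis :: "nat \<Rightarrow> diagram \<Rightarrow> bool" where
  nil: "basis 0 []"
| arc: "basis n b \<Longrightarrow> j \<le> n \<Longrightarrow> basis (n + 2) (b @ arc j n)"

lemma basis_tangle: "basis n b \<Longrightarrow> tangle 0 b n"
proof (induction rule: basis.induct)
  case (arc n b j)
  then show ?case
    by (blast intro: tangle_appendI tangle_arc)
qed simp

text \<open>Membership in the span of the basis modulo skein relations, expressed by test closures.\<close>

definition spanned :: "nat \<Rightarrow> diagram \<Rightarrow> bool" where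
  "spanned n w \<longleftrightarrow> tangle 0 w n \<and>
     (\<forall>v. tangle n v 0 \<longrightarrow> (\<forall>b. basis n b \<longrightarrow> U (b @ v) = 0) \<longrightarrow> U (w @ v) = 0)"

lemma spanned_basis: "basis n b \<Longrightarrow> spanned n b"
  by (simp add: spanned_def basis_tangle)

text \<open>Putting \<open>x\<close> below a closure \<open>v\<close> yields a closure of
  \<open>w\<close>, so it is enough to append \<open>x\<close> to basis diagrams.\<close>

lemma spanned_append:
  assumes w: "spanned n w" and x: "tangle n x m" and b: "\<And>b. basis n b \<Longrightarrow> spanned m (b @ x)"
  shows "spanned m (w @ x)"
  unfolding spanned_def
proof (intro conjI allI impI)
  show "tangle 0 (w @ x) m"
    using w x by (auto simp: spanned_def intro: tangle_appendI)
next
  fix v assume v: "tangle m v 0" "\<forall>b. basis m b \<longrightarrow> U (b @ v) = 0"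
  then have "\<forall>b. basis n b \<longrightarrow> U (b @ x @ v) = 0"
    using b by (auto simp: spanned_def)
  then show "U ((w @ x) @ v) = 0"
    using w x v(1) by (auto simp: spanned_def intro: tangle_appendI)
qed

lemma spanned_same_value:
  assumes "same_value n m x y" "tangle 0 b n" "tangle n x m" "spanned m (b @ y)"
  shows "spanned m (b @ x)"
  using assms by (auto simp: spanned_def same_value_def intro: tangle_appendI)

lemma spanned_isotopic:
  assumes "isotopic n m x y" "tangle 0 b n" "tangle n x m" "spanned m (b @ y)"
  shows "spanned m (b @ x)"
  using assms spanned_same_value same_value_isotopic by blast

lemma spanned_skein:
  assumes "spanned n (b @ [(X (switch c), i)])" "spanned n (b @ [(Cap, i), (Cup, i)])" "spanned n b"
  shows "spanned n (b @ [(X c, i)])"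
  unfolding spanned_def
proof (intro conjI allI impI)
  show t: "tangle 0 (b @ [(X c, i)]) n"
    using assms(1) by (auto simp: spanned_def tangle_append)
  fix v assume v: "tangle n v 0" "\<forall>b. basis n b \<longrightarrow> U (b @ v) = 0"
  have "tangle 0 (b @ [(X Pos, i)] @ v) 0"
    using t v(1) by (fastforce simp: tangle_append)
  from skein[OF this] assms v show "U ((b @ [(X c, i)]) @ v) = 0"
    by (cases c) (auto simp: spanned_def)
qed

lemma spanned_word:
  assumes "spanned n w"
    and "\<And>x. x \<in> set xs \<Longrightarrow> tangle n [x] n"
    and "\<And>x b. x \<in> set xs \<Longrightarrow> basis n b \<Longrightarrow> spanned n (b @ [x])"
  shows "spanned n (w @ xs)"
  using assms
proof (induction xs arbitrary: w)
  case (Cons x xs)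
  have "spanned n (w @ [x])"
    using Cons.prems by (rule spanned_append[of n w]) auto
  then have "spanned n ((w @ [x]) @ xs)"
    using Cons.prems by (intro Cons.IH) auto
  then show ?case by simp
qed simp

lemma spanned_arc: "spanned n w \<Longrightarrow> j \<le> n \<Longrightarrow> spanned (n + 2) (w @ arc j n)"
  by (blast intro: spanned_append tangle_arc spanned_basis basis.arc)

text \<open>Stability of the span under each kind of tile. The index of \<open>closed_cap\<close>
  counts the endpoints above the cap, so that \<open>closed_cap n\<close> followed by
  \<open>closed_cup n\<close> handles the horizontal smoothing of a crossing on \<open>n + 2\<close>
  strands.\<close>

definition closed_cup :: "nat \<Rightarrow> bool" where
  "closed_cup n \<longleftrightarrow> (\<forall>b p. basis n b \<longrightarrow> p \<le> n \<longrightarrow> spanned (n + 2) (b @ [(Cup, p)]))"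

definition closed_cap :: "nat \<Rightarrow> bool" where
  "closed_cap n \<longleftrightarrow> (\<forall>b p. basis (n + 2) b \<longrightarrow> p \<le> n \<longrightarrow> spanned n (b @ [(Cap, p)]))"

definition closed_cross :: "nat \<Rightarrow> bool" where
  "closed_cross n \<longleftrightarrow> (\<forall>b c p. basis n b \<longrightarrow> p + 2 \<le> n \<longrightarrow> spanned n (b @ [(X c, p)]))"

lemma basis_Suc_SucE:
  assumes "basis (n + 2) b0"
  obtains b j where "b0 = b @ arc j n" "basis n b" "j \<le> n"
  using assms by cases auto

lemma basis_0: "basis 0 b \<longleftrightarrow> b = []"
  using basis.cases[of 0 b] basis.nil by fastforce

lemma not_basis_1: "\<not> basis (Suc 0) b"
  using basis.cases[of "Suc 0" b] by fastforce

lemma spanned_cup: "closed_cup n \<Longrightarrow> spanned n w \<Longrightarrow> p \<le> n \<Longrightarrow> spanned (n + 2) (w @ [(Cup, p)])"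
  by (rule spanned_append[of n]) (auto simp: closed_cup_def)

lemma spanned_crossings:
  assumes "closed_cross n" "spanned n w"
    and "\<And>x. x \<in> set xs \<Longrightarrow> \<exists>c p. x = (X c, p) \<and> p + 2 \<le> n"
  shows "spanned n (w @ xs)"
proof (rule spanned_word[OF assms(2)])
  fix x assume "x \<in> set xs"
  then obtain c p where x: "x = (X c, p)" "p + 2 \<le> n"
    using assms(3) by blast
  then show "tangle n [x] n" by simp
  show "spanned n (b @ [x])" if "basis n b" for b
    using assms(1) that x by (simp add: closed_cross_def)
qed

text \<open>A minimum to the left of the right end of the topmost arc is pushed below the arc; at
  the far right it is itself an arc without crossings.\<close>

lemma closed_cup_step:
  assumes "closed_cup n"
  shows "closed_cup (n + 2)"
  unfolding closed_cup_def
proof (intro allI impI)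
  fix b0 p assume b0: "basis (n + 2) b0" and p: "p \<le> n + 2"
  obtain b j where b: "b0 = b @ arc j n" "basis n b" "j \<le> n"
    using b0 by (rule basis_Suc_SucE)
  have cup: "spanned (n + 2) (b @ [(Cup, q)])" if "q \<le> n" for q
    using assms b that by (auto simp: closed_cup_def)
  have t: "tangle n (arc j n @ [(Cup, p)]) (n + 2 + 2)"
    using p b by (intro tangle_appendI[OF tangle_arc]) auto
  consider "p \<le> j" | "Suc j \<le> p" "p \<le> Suc n" | "p = n + 2"
    using p by linarith
  then have "spanned (n + 2 + 2) (b @ arc j n @ [(Cup, p)])"
  proof cases
    case 1
    have i: "isotopic n (n + 2 + 2) (arc j n @ [(Cup, p)]) ((Cup, p) # arc (j + 2) (n + 2))"
      using 1 b by (intro arc_tile_left[where d = "j - p" and r = "n - j"]) auto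
    have s: "spanned (n + 2 + 2) ((b @ [(Cup, p)]) @ arc (j + 2) (n + 2))"
      using 1 b by (intro spanned_arc cup) auto
    show ?thesis
      using spanned_isotopic[OF i basis_tangle[OF b(2)]] t s by simp
  next
    case 2
    define q where "q = p - Suc j"
    have i: "isotopic n (n + 2 + 2) (arc j n @ [(Cup, Suc (j + q))]) ((Cup, j + q) # arc j (n + 2))"
      using 2 b by (intro arc_tile_right[where r = "n - j - q"]) (auto simp: q_def)
    have s: "spanned (n + 2 + 2) ((b @ [(Cup, j + q)]) @ arc j (n + 2))"
      using 2 b by (intro spanned_arc cup) (auto simp: q_def)
    have "p = Suc (j + q)"
      using 2 by (simp add: q_def)
    then show ?thesis
      using spanned_isotopic[OF i basis_tangle[OF b(2)]] t s by simp
  next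
    case 3
    then have "spanned (n + 2 + 2) (b0 @ arc p (n + 2))"
      using b0 by (intro spanned_arc spanned_basis) auto
    with 3 show ?thesis
      by (simp add: b arc_def)
  qed
  then show "spanned (n + 2 + 2) (b0 @ [(Cup, p)])"
    by (simp add: b)
qed

text \<open>A cap that misses both ends of the topmost arc is pushed below it, which leaves a
  smaller instance. Otherwise it absorbs the arc, and what remains are at most crossings of
  \<open>n\<close> strands.\<close>

lemma closed_cap_step:
  assumes "closed_cross n" "\<And>m. n = m + 2 \<Longrightarrow> closed_cap m"
  shows "closed_cap n"
  unfolding closed_cap_def
proof (intro allI impI)
  fix b0 p assume b0: "basis (n + 2) b0" and p: "p \<le> n"
  obtain b j where b: "b0 = b @ arc j n" "basis n b" "j \<le> n"
    using b0 by (rule basis_Suc_SucE)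
  note bt = basis_tangle[OF b(2)]
  have t: "tangle n (arc j n @ [(Cap, p)]) n"
    using p b by (intro tangle_appendI[OF tangle_arc]) auto
  have crossings: "spanned n (b @ xs)" if "\<And>x. x \<in> set xs \<Longrightarrow> \<exists>c p. x = (X c, p) \<and> p + 2 \<le> n" for xs
    using assms(1) spanned_basis[OF b(2)] that by (rule spanned_crossings)
  consider "p + 2 \<le> j" | "j = Suc p" | "j = p" "p < n" | "j = p" "p = n"
    | "Suc j \<le> p" "p < n" | "Suc j \<le> p" "p = n"
    using p by linarith
  then have "spanned n (b @ arc j n @ [(Cap, p)])"
  proof cases
    case 1
    then obtain m where m: "n = m + 2"
      using b(3) by (metis le_add2 le_iff_add le_trans add.commute)
    have i: "isotopic n n (arc j n @ [(Cap, p)]) ((Cap, p) # arc (j - 2) m)"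
      using 1 b m by (intro arc_tile_left[where d = "j - p - 2" and r = "n - j"]) auto
    have s: "spanned n ((b @ [(Cap, p)]) @ arc (j - 2) m)"
      unfolding m using 1 b m assms(2)[OF m] by (intro spanned_arc) (auto simp: closed_cap_def)
    show ?thesis
      using spanned_isotopic[OF i bt] t s by simp
  next
    case 2
    have i: "isotopic n n (arc j n @ [(Cap, p)]) (over_right p (n - j))"
      using 2 b arc_cap_left[of n p "n - j"] by simp
    have s: "spanned n (b @ over_right p (n - j))"
      using 2 b by (intro crossings) (auto simp: over_right_def)
    show ?thesis
      using spanned_isotopic[OF i bt] t s by simp
  next
    case 3
    define m where "m = n - Suc j"
    have m: "n = Suc (j + m)"
      using 3 by (simp add: m_def)
    have "same_value n n ([] @ [(Cup, j), (X Neg, Suc j), (Cap, j)] @ over_right j m) ([] @ [] @ over_right j m)"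
      using m by (intro same_value_context[of n n] same_value_kink[OF kink.loop_left])
        (auto simp: tangle_over_right_iff)
    then have i: "same_value n n (arc j n @ [(Cap, p)]) (over_right j m)"
      using same_value_isotopic[OF arc_cap_right[OF m]] t 3 by (auto intro: same_value_trans)
    have s: "spanned n (b @ over_right j m)"
      using m by (intro crossings) (auto simp: over_right_def)
    show ?thesis
      using spanned_same_value[OF i bt] t s by simp
  next
    \<comment> \<open>The arc has no crossings, and the cap closes it to a circle.\<close>
    case 4
    then have i: "same_value n n (arc j n @ [(Cap, p)]) []"
      using same_value_circle[of n n] by (simp add: arc_def)
    then show ?thesis
      using spanned_same_value[OF i bt t] spanned_basis[OF b(2)] by simp
  next
    case 5
    define q m where "q = p - Suc j" and "m = n - 2"
    have m: "n = m + 2" "p = Suc (j + q)" and q: "j + q \<le> m"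
      using 5 by (simp_all add: m_def q_def)
    have i: "isotopic n n (arc j n @ [(Cap, Suc (j + q))]) ((Cap, j + q) # arc j m)"
      using m q by (intro arc_tile_right[where r = "m - j - q"]) auto
    have s: "spanned n ((b @ [(Cap, j + q)]) @ arc j m)"
      unfolding m using q b m assms(2)[OF m(1)] by (intro spanned_arc) (auto simp: closed_cap_def)
    show ?thesis
      using spanned_isotopic[OF i bt] t s m by simp
  next
    \<comment> \<open>The cap sits on the last crossing of the right leg. That crossing is a twist
      of the cap and disappears; the shortened arc is then absorbed.\<close>
    case 6
    define m where "m = n - Suc j"
    have m: "n = Suc (j + m)"
      using 6 by (simp add: m_def)
    let ?u = "(Cup, j) # over_right (Suc j) m"
    have "same_value n n (?u @ [(X Neg, n), (Cap, n)] @ []) (?u @ [(Cap, n)] @ [])"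
      using m by (intro same_value_context[of "n + 2" n] cap_twist)
        (auto simp: tangle_over_right_iff)
    also have "same_value n n (?u @ [(Cap, n)] @ []) (map (Pair (X Pos)) (rev [j..<j + m]))"
      using arc_cap_last[of n j m 0] m
      by (intro same_value_isotopic) (auto simp: tangle_over_right_iff intro!: tangle_appendI[of _ _ "n + 2"])
    finally have i: "same_value n n (arc j n @ [(Cap, p)]) (map (Pair (X Pos)) (rev [j..<j + m]))"
      using m 6 by (simp add: arc_def over_right_Suc Suc_diff_le)
    have s: "spanned n (b @ map (Pair (X Pos)) (rev [j..<j + m]))"
      using m by (intro crossings) auto
    show ?thesis
      using spanned_same_value[OF i bt] t s by simp
  qed
  then show "spanned n (b0 @ [(Cap, p)])"
    by (simp add: b)
qed

text \<open>For a crossing that touches an end of the topmost arc, one of the two types reduces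
  directly, either prolonging or shortening the arc. The skein relation gives the other type, as
  both smoothings are in the span.\<close>

lemma closed_cross_step:
  assumes "closed_cup n" "closed_cap n" "closed_cross n"
  shows "closed_cross (n + 2)"
proof -
  have skein': "spanned (n + 2) (b0 @ [(X c, p)])"
    if b0: "basis (n + 2) b0" and p: "p \<le> n" and s: "spanned (n + 2) (b0 @ [(X (switch c), p)])" for b0 c p
  proof -
    have "spanned (n + 2) ((b0 @ [(Cap, p)]) @ [(Cup, p)])"
      using assms b0 p by (intro spanned_cup) (auto simp: closed_cap_def)
    then show ?thesis
      using s spanned_basis[OF b0] by (intro spanned_skein[OF s]) simp_all
  qed
  have inner: "spanned (n + 2) (b0 @ [(X c, p)])" if b0: "basis (n + 2) b0" and p: "p < n" for b0 c p
  proof -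
    obtain b j where b: "b0 = b @ arc j n" "basis n b" "j \<le> n"
      using b0 by (rule basis_Suc_SucE)
    note bt = basis_tangle[OF b(2)]
    have t: "tangle n (arc j n @ [(X c, p)]) (n + 2)" for c
      using p b by (intro tangle_appendI[OF tangle_arc]) auto
    consider "p + 2 \<le> j" | "j = Suc p" | "j = p" | "Suc j \<le> p"
      by linarith
    then show ?thesis
    proof cases
      case 1
      have i: "isotopic n (n + 2) (arc j n @ [(X c, p)]) ((X c, p) # arc j n)"
        using 1 b by (intro arc_tile_left[where d = "j - p - 2" and r = "n - j"]) auto
      have s: "spanned (n + 2) ((b @ [(X c, p)]) @ arc j n)"
        using 1 b assms(3) by (intro spanned_arc) (auto simp: closed_cross_def)
      show ?thesis
        using spanned_isotopic[OF i bt t] s b(1) by simp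
    next
      case 2
      have i: "isotopic n (n + 2) (arc j n @ [(X Pos, p)]) (arc p n)"
        using 2 b arc_leg_left[of n p "n - j"] by simp
      have s: "spanned (n + 2) (b @ arc p n)"
        using 2 b by (intro spanned_arc spanned_basis) auto
      have "spanned (n + 2) (b0 @ [(X Pos, p)])"
        using spanned_isotopic[OF i bt t] s b(1) by simp
      then show ?thesis
        using skein'[OF b0, of p c] p by (cases c) auto
    next
      case 3
      have i: "isotopic n (n + 2) (arc j n @ [(X Neg, p)]) (arc (Suc j) n)"
        using 3 p arc_leg_right[of n p "n - Suc j"] by simp
      have s: "spanned (n + 2) (b @ arc (Suc j) n)"
        using 3 p b by (intro spanned_arc spanned_basis) auto
      have "spanned (n + 2) (b0 @ [(X Neg, p)])"
        using spanned_isotopic[OF i bt t] s b(1) by simp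
      then show ?thesis
        using skein'[OF b0, of p c] p by (cases c) auto
    next
      case 4
      define q where "q = p - Suc j"
      have q: "p = Suc (j + q)"
        using 4 by (simp add: q_def)
      have i: "isotopic n (n + 2) (arc j n @ [(X c, p)]) ((X c, j + q) # arc j n)"
        unfolding q using p q by (intro arc_tile_right[where r = "n - j - q - 2"]) auto
      have s: "spanned (n + 2) ((b @ [(X c, j + q)]) @ arc j n)"
        using p q b assms(3) by (intro spanned_arc) (auto simp: closed_cross_def)
      show ?thesis
        using spanned_isotopic[OF i bt t] s b(1) q by simp
    qed
  qed
  have last: "spanned (n + 2) (b0 @ [(X c, n)])" if b0: "basis (n + 2) b0" for b0 c
  proof -
    obtain b j where b: "b0 = b @ arc j n" "basis n b" "j \<le> n"
      using b0 by (rule basis_Suc_SucE)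
    note bt = basis_tangle[OF b(2)]
    have t: "tangle n (arc j n @ [(X c, n)]) (n + 2)" for c
      using b by (intro tangle_appendI[OF tangle_arc]) auto
    show ?thesis
    proof (cases "j = n")
      case True
      then have i: "same_value n (n + 2) (arc j n @ [(X c, n)]) (arc j n)"
        using cup_twist[of n n] by (simp add: arc_def)
      then show ?thesis
        using spanned_same_value[OF i bt t] spanned_basis[OF b0] b(1) by simp
    next
      case False
      define m where "m = n - Suc j"
      have m: "n = Suc (j + m)"
        using False b by (simp add: m_def)
      let ?u = "(Cup, j) # over_right (Suc j) m"
      have i: "isotopic n (n + 2) (?u @ [(X Neg, n), (X (switch Neg), n)] @ []) (?u @ [])"
        using m by (intro isotopic_reidemeister2)
          (auto simp: tangle_over_right_iff intro!: tangle_appendI[of _ _ "n + 2"])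
      then have i: "isotopic n (n + 2) (arc j n @ [(X Pos, n)]) ?u"
        using m by (simp add: arc_def over_right_Suc Suc_diff_le)
      \<comment> \<open>After the cancellation all remaining crossings are at positions below
        \<open>n\<close>, where \<open>inner\<close> applies.\<close>
      have s: "spanned (n + 2) ((b @ [(Cup, j)]) @ over_right (Suc j) m)"
      proof (rule spanned_word)
        show "spanned (n + 2) (b @ [(Cup, j)])"
          using assms(1) b by (simp add: closed_cup_def)
      qed (use eq_imp_le[OF m[symmetric]] in \<open>auto simp: over_right_def simp del: add_2_eq_Suc' intro!: inner\<close>)
      have "spanned (n + 2) (b0 @ [(X Pos, n)])"
        using spanned_isotopic[OF i bt t] s b(1) by simp
      then show ?thesis
        using skein'[OF b0, of n c] by (cases c) auto
    qed
  qed
  show ?thesis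
    unfolding closed_cross_def using inner last by (metis add_le_cancel_right le_neq_implies_less)
qed

text \<open>The induction advances by two since an arc has two ends. At \<open>n + 2\<close>
  crossings are treated before caps, because a cap that absorbs an arc leaves crossings on the same
  number of strands.\<close>

lemma closed_all: "closed_cup n \<and> closed_cap n \<and> closed_cross n"
proof (induction n rule: induct_nat_012)
  case 0
  have "closed_cross 0"
    by (simp add: closed_cross_def)
  moreover have "closed_cup 0"
    using spanned_basis[OF basis.arc[OF basis.nil, of 0]]
    by (simp add: closed_cup_def arc_def basis_0)
  ultimately show ?case
    using closed_cap_step[of 0] by simp
next
  case 1
  have "\<not> basis (Suc 0 + 2) b" for b
    using basis_Suc_SucE not_basis_1 by blast
  then show ?case
    using not_basis_1 by (simp add: closed_cross_def closed_cup_def closed_cap_def)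
next
  case (ge2 n)
  then have "closed_cross (n + 2)" "closed_cup (n + 2)"
    using closed_cross_step closed_cup_step by blast+
  moreover from this have "closed_cap (n + 2)"
    using ge2 closed_cap_step[of "n + 2"] by simp
  ultimately show ?case by simp
qed

text \<open>The only basis diagram without endpoints is the empty word, so the empty closure serves
  as the test.\<close>

theorem vanishes: "tangle 0 w 0 \<Longrightarrow> U w = 0"
proof -
  have "spanned n w" if "tangle 0 w n" for n
    using that
  proof (induction w arbitrary: n rule: rev_induct)
    case Nil
    then show ?case
      by (auto intro: spanned_basis basis.nil)
  next
    case (snoc x w)
    obtain e p where x: "x = (e, p)" by (cases x)
    obtain m where m: "tangle 0 w m" "tangle m [x] n"
      using snoc.prems by (auto simp: tangle_append)
    have "spanned n (b @ [x])" if b: "basis m b" for b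
    proof (cases e)
      case Cup
      then show ?thesis
        using m(2) x closed_all[of m] b by (auto simp: closed_cup_def)
    next
      case Cap
      then have "m = n + 2" "p \<le> n"
        using m(2) x by auto
      then show ?thesis
        using Cap x closed_all[of n] b by (auto simp: closed_cap_def)
    next
      case (X c)
      then have "m = n" "p + 2 \<le> n"
        using m(2) x by auto
      then show ?thesis
        using X x closed_all[of n] b by (auto simp: closed_cross_def)
    qed
    then show ?case
      by (rule spanned_append[OF snoc.IH[OF m(1)] m(2)])
  qed
  then have "spanned 0 w" if "tangle 0 w 0"
    using that by blast
  then show "tangle 0 w 0 \<Longrightarrow> U w = 0"
    using empty by (force simp: spanned_def basis_0 dest: spec[of _ "[]"])
qed

end

text \<open>A move with empty right side acts on strands that pass through, so it can never consume
  a whole closed diagram. Hence excluding the empty word from link diagrams does not cut any chain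
  of moves.\<close>

lemma isotopy_step_empty: "isotopy_step 0 0 w w' \<Longrightarrow> w = [] \<longleftrightarrow> w' = []"
  unfolding isotopy_step_def
  by (auto elim!: planar_move.cases reidemeister2.cases reidemeister3.cases)

lemma isotopic_empty: "isotopic 0 0 w w' \<Longrightarrow> w = [] \<longleftrightarrow> w' = []"
  unfolding isotopic_def by (induction rule: equivclp_induct) (auto dest: isotopy_step_empty)

lemma isotopic_imp_regular_isotopic:
  assumes "isotopic 0 0 w w'" "w \<noteq> []"
  shows "regular_isotopic w w'"
  using assms(1) unfolding isotopic_def
proof (induction rule: equivclp_induct)
  case base
  then show ?case by (simp add: regular_isotopic_def)
next
  case (step y z)
  have "y \<noteq> []" "z \<noteq> []"
    using isotopic_empty[unfolded isotopic_def, OF step.hyps(1)] step.hyps(2) assms(2) isotopy_step_empty by blast+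
  then have "local_change regular_move y z \<or> local_change regular_move z y"
    using step.hyps(2) by (auto simp: isotopy_step_def local_change_def link_diagram_def)
  with step.IH show ?case
    unfolding regular_isotopic_def by (rule equivclp_into_equivclp)
qed

lemma invariant_isotopic:
  assumes "regular_isotopy_invariant F" "link_diagram w" "isotopic 0 0 w w'"
  shows "F w = F w'"
proof -
  have "link_diagram w'"
    using assms isotopic_tangle[OF assms(3)] isotopic_empty[OF assms(3)] by (auto simp: link_diagram_def)
  then show ?thesis
    using assms isotopic_imp_regular_isotopic by (auto simp: regular_isotopy_invariant_def link_diagram_def)
qed

section \<open>The specialisation of \<open>T\<close> at a = 1\<close>

definition at_a_1 :: "laurent \<Rightarrow> laurent" where
  "at_a_1 = subst (frag_of(ia := 0))"

lemma at_a_1_T: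
  assumes T: "is_T T" and L: "link_diagram L"
  shows "at_a_1 (T L) = 1"
proof -
  \<comment> \<open>The value at the empty word is set by hand; removing the last circle is then the
    normalisation \<open>T unknot = 1\<close>.\<close>
  define U where "U w = (if w = [] then 0 else at_a_1 (T w) - 1)" for w
  have inv: "U w = U w'" if "tangle 0 w 0" "isotopic 0 0 w w'" for w w'
  proof (cases "w = []")
    case False
    then have "link_diagram w"
      using that by (simp add: link_diagram_def)
    then have "T w = T w'"
      using T that invariant_isotopic by (auto simp: is_T_def)
    then show ?thesis
      using isotopic_empty[OF that(2)] by (simp add: U_def)
  qed (use isotopic_empty[OF that(2)] in \<open>simp add: U_def\<close>)
  have skein: "U (u @ [(X Pos, i)] @ v) - U (u @ [(X Neg, i)] @ v) =
      ipow iw 1 * (U (u @ [(Cap, i), (Cup, i)] @ v) - U (u @ v))"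
    if t: "tangle 0 (u @ [(X Pos, i)] @ v) 0" for u v i
  proof -
    have "u \<noteq> []"
      using t by auto
    have "conway_quadruple u i v (u @ [(X Pos, i)] @ v) (u @ [(X Neg, i)] @ v)
        (u @ [(Cap, i), (Cup, i)] @ v) (u @ v)"
      using t by (simp add: conway_quadruple_def link_diagram_def)
    then have "T (u @ [(X Pos, i)] @ v) - T (u @ [(X Neg, i)] @ v) =
        ipow iw 1 * (T (u @ [(Cap, i), (Cup, i)] @ v) - T (u @ v))"
      using T unfolding is_T_def by blast
    from arg_cong[OF this, of at_a_1] show ?thesis
      using \<open>u \<noteq> []\<close> by (simp add: U_def at_a_1_def subst_diff subst_mult subst_frag_of ipow_def)
  qed
  have kink: "U (u @ l @ v) = U (u @ v)" if t: "tangle 0 (u @ l @ v) 0" and k: "kink c l" for u l v c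
  proof -
    have "u \<noteq> []"
      using t k by (auto elim: kink.cases)
    have "link_diagram (u @ l @ v)"
      using t \<open>u \<noteq> []\<close> by (simp add: link_diagram_def)
    then have "T (u @ l @ v) = ipow ia (if c = Neg then 1 else - 1) * T (u @ v)"
      using T k unfolding is_T_def by (cases c) auto
    from arg_cong[OF this, of at_a_1] show ?thesis
      using \<open>u \<noteq> []\<close> by (simp add: U_def at_a_1_def subst_mult subst_ipow)
  qed
  have w_cancel: "x = y" if "ipow iw 1 * (x - y) = 0" for x y
  proof -
    have "x - y = (ipow iw 1 * ipow iw (- 1)) * (x - y)"
      by (simp add: ipow_inverse)
    also have "\<dots> = ipow iw (- 1) * (ipow iw 1 * (x - y))"
      by (simp only: mult_ac)
    finally show ?thesis
      using that by simp
  qed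
  text \<open>A circle beside a strand comes from smoothing a kink in that strand.\<close>
  have circle_right: "U (u @ [(Cup, Suc i), (Cap, Suc i)] @ v) = U (u @ v)"
    if u: "tangle 0 u k" and v: "tangle k v 0" and i: "i < k" for u v i k
  proof -
    let ?k = "\<lambda>x. u @ [(Cup, Suc i)] @ x @ [(Cap, Suc i)] @ v"
    have t: "tangle 0 (?k [(X c, i)]) 0" for c
      using u v i by (intro tangle_appendI[OF u]) auto
    have kinks: "U (?k [(X c, i)]) = U (u @ v)" for c
      using kink[of u "[(Cup, Suc i), (X c, i), (Cap, Suc i)]" v c] t kink.loop_right by auto
    have "isotopic 0 0 (u @ [(Cup, Suc i), (Cap, i)] @ [(Cup, i), (Cap, Suc i)] @ v)
        (u @ [(Cup, i), (Cap, Suc i)] @ v)"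
      using u v i isotopic_planar[OF planar_move.snake_right, of 0 u i "[(Cup, i), (Cap, Suc i)] @ v" 0]
      by (auto simp: tangle_append_iff[OF u])
    also have "isotopic 0 0 (u @ [(Cup, i), (Cap, Suc i)] @ v) (u @ [] @ v)"
      using u v i planar_move.snake_left by (intro isotopic_planar) (auto intro!: tangle_appendI[OF u])
    finally have "isotopic 0 0 (?k [(Cap, i), (Cup, i)]) (u @ v)"
      by simp
    moreover have "tangle 0 (?k [(Cap, i), (Cup, i)]) 0"
      using u v i by (simp add: tangle_append_iff[OF u])
    ultimately have "U (?k [(Cap, i), (Cup, i)]) = U (u @ v)"
      by (intro inv)
    with skein[of "u @ [(Cup, Suc i)]" i "[(Cap, Suc i)] @ v"] t[of Pos]
    have "ipow iw 1 * (U (u @ v) - U (?k [])) = 0"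
      using kinks[of Pos] kinks[of Neg] by simp
    from w_cancel[OF this] show ?thesis by simp
  qed
  have circle_left: "U (u @ [(Cup, i), (Cap, i)] @ v) = U (u @ v)"
    if u: "tangle 0 u k" and v: "tangle k v 0" and i: "i < k" for u v i k
  proof -
    let ?k = "\<lambda>x. u @ [(Cup, i)] @ x @ [(Cap, i)] @ v"
    have t: "tangle 0 (?k [(X c, Suc i)]) 0" for c
      using u v i by (intro tangle_appendI[OF u]) auto
    have kinks: "U (?k [(X c, Suc i)]) = U (u @ v)" for c
      using kink[of u "[(Cup, i), (X c, Suc i), (Cap, i)]" v c] t kink.loop_left by auto
    have "isotopic 0 0 (u @ [(Cup, i), (Cap, Suc i)] @ [(Cup, Suc i), (Cap, i)] @ v)
        (u @ [(Cup, Suc i), (Cap, i)] @ v)"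
      using u v i isotopic_planar[OF planar_move.snake_left, of 0 u i "[(Cup, Suc i), (Cap, i)] @ v" 0]
      by (auto simp: tangle_append_iff[OF u])
    also have "isotopic 0 0 (u @ [(Cup, Suc i), (Cap, i)] @ v) (u @ [] @ v)"
      using u v i planar_move.snake_right by (intro isotopic_planar) (auto intro!: tangle_appendI[OF u])
    finally have "isotopic 0 0 (?k [(Cap, Suc i), (Cup, Suc i)]) (u @ v)"
      by simp
    moreover have "tangle 0 (?k [(Cap, Suc i), (Cup, Suc i)]) 0"
      using u v i by (simp add: tangle_append_iff[OF u])
    ultimately have "U (?k [(Cap, Suc i), (Cup, Suc i)]) = U (u @ v)"
      by (intro inv)
    with skein[of "u @ [(Cup, i)]" "Suc i" "[(Cap, i)] @ v"] t[of Pos]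
    have "ipow iw 1 * (U (u @ v) - U (?k [])) = 0"
      using kinks[of Pos] kinks[of Neg] by simp
    from w_cancel[OF this] show ?thesis by simp
  qed
  have circle: "U (u @ [(Cup, i), (Cap, i)] @ v) = U (u @ v)"
    if t: "tangle 0 (u @ [(Cup, i), (Cap, i)] @ v) 0" for u v i
  proof -
    let ?c = "[(Cup, 0), (Cap, 0)] :: diagram"
    obtain k where k: "tangle 0 u k" "tangle k v 0" "i \<le> k"
      using t by (auto simp: tangle_append)
    consider "i < k" | i' where "i = Suc i'" "i = k" | "i = 0" "k = 0"
      using k(3) by (metis bot_nat_0.not_eq_extremum le_neq_implies_less not0_implies_Suc)
    then show ?thesis
    proof cases
      case 1
      show ?thesis using circle_left[OF k(1,2) 1] .
    next
      case 2
      with circle_right[OF k(1,2), of i'] show ?thesis by simp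
    next
      \<comment> \<open>No strand passes at this level. The circle is moved beyond the adjacent
        minimum above or maximum below, where it stands beside a strand; a lone circle is left to
        the normalisation.\<close>
      case 3
      show ?thesis
      proof (cases v)
        case (Cons x v')
        obtain e p where x: "x = (e, p)" by (cases x)
        have "tangle 0 ((e, p) # v') 0"
          using 3 k(2) Cons x by simp
        then have "e = Cup" "p = 0"
          by (cases e; simp)+
        then have v: "v = (Cup, 0) # v'" "tangle 2 v' 0"
          using 3 k(2) Cons x by (simp_all add: numeral_2_eq_2)
        have "isotopic (0 + 0) (2 + 0) (shift 0 ?c @ [(Cup, 0)]) ([(Cup, 0)] @ shift 2 ?c)"
          by (intro isotopic_exchange) auto
        then have "isotopic 0 0 (u @ (?c @ [(Cup, 0)]) @ v') (u @ ([(Cup, 0)] @ [(Cup, 2), (Cap, 2)]) @ v')"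
          using k 3 v by (intro isotopic_context[of 0 2]) (auto simp: numeral_2_eq_2)
        then have "U (u @ ?c @ v) = U ((u @ [(Cup, 0)]) @ [(Cup, 2), (Cap, 2)] @ v')"
          using inv[of "u @ ?c @ v"] t 3 v by simp
        also have "\<dots> = U ((u @ [(Cup, 0)]) @ v')"
          using circle_right[OF tangle_appendI[OF k(1)], of "[(Cup, 0)]" 2 v' 1] 3 v
          by (simp add: numeral_2_eq_2)
        finally show ?thesis
          using 3 v by simp
      next
        case Nil
        show ?thesis
        proof (cases u rule: rev_cases)
          case Nil
          then show ?thesis
            using T 3 \<open>v = []\<close> by (simp add: U_def is_T_def unknot_def at_a_1_def)
        next
          case (snoc u' x)
          obtain e p where x: "x = (e, p)" by (cases x)
          obtain m where m: "tangle 0 u' m" "tangle m [x] 0"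
            using k 3 snoc by (auto simp: tangle_append)
          have ep: "e = Cap \<and> p = 0 \<and> m = 2"
            using m(2) unfolding x by (cases e) auto
          have u: "u = u' @ [(Cap, 0)]" "tangle 0 u' 2"
            using snoc m(1) x ep by auto
          have "isotopic (2 + 0) (0 + 0) (shift 2 ?c @ [(Cap, 0)]) ([(Cap, 0)] @ shift 0 ?c)"
            by (intro isotopic_exchange) auto
          then have "isotopic 0 0 (u' @ ([(Cap, 0)] @ ?c)) (u' @ ([(Cup, 2), (Cap, 2)] @ [(Cap, 0)]))"
            using u by (intro isotopic_prepend[OF isotopic_sym, of 2 0]) (auto simp: numeral_2_eq_2)
          then have "U (u @ ?c) = U (u' @ [(Cup, 2), (Cap, 2)] @ [(Cap, 0)])"
            using inv[of "u @ ?c"] t 3 u \<open>v = []\<close> by simp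
          also have "\<dots> = U (u' @ [(Cap, 0)])"
            using circle_right[of u' 2 "[(Cap, 0)]" 1] u by (simp add: numeral_2_eq_2)
          finally show ?thesis
            using 3 u \<open>v = []\<close> by simp
        qed
      qed
    qed
  qed
  interpret link_skein U "ipow iw 1"
    by unfold_locales (use inv kink circle skein in \<open>auto simp: U_def\<close>)
  have "U L = 0"
    using L by (intro vanishes) (simp add: link_diagram_def)
  then show ?thesis
    using L by (simp add: U_def link_diagram_def)
qed


section \<open>Two-colourings\<close>

fun col_step :: "tile \<times> nat \<Rightarrow> bool list \<Rightarrow> bool list \<Rightarrow> bool" where
  "col_step (e, Suc p) s s' \<longleftrightarrow> (\<exists>x r r'. s = x # r \<and> s' = x # r' \<and> col_step (e, p) r r')"
| "col_step (Cup, 0) s s' \<longleftrightarrow> (\<exists>x. s' = x # x # s)"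
| "col_step (Cap, 0) s s' \<longleftrightarrow> (\<exists>x. s = x # x # s')"
| "col_step (X c, 0) s s' \<longleftrightarrow> (\<exists>x y r. s = x # y # r \<and> s' = y # x # r)"

text \<open>The list \<open>c\<close> omits the initial state, so \<open>(s # c) ! t\<close> is the
  state just before letter \<open>t\<close>, in agreement with the levels of
  \<open>points\<close>.\<close>

fun run :: "bool list \<Rightarrow> diagram \<Rightarrow> bool list list \<Rightarrow> bool list \<Rightarrow> bool" where
  "run s [] c s' \<longleftrightarrow> c = [] \<and> s = s'"
| "run s (x # w) c s' \<longleftrightarrow> (\<exists>s1 c'. c = s1 # c' \<and> col_step x s s1 \<and> run s1 w c' s')"

definition reach :: "bool list \<Rightarrow> diagram \<Rightarrow> bool list \<Rightarrow> bool" where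
  "reach s w s' \<longleftrightarrow> (\<exists>c. run s w c s')"

definition runs :: "bool list \<Rightarrow> diagram \<Rightarrow> bool list \<Rightarrow> nat" where
  "runs s w s' = card {c. run s w c s'}"

abbreviation states :: "nat \<Rightarrow> bool list set" where
  "states n \<equiv> {s. length s = n}"

lemma finite_states [simp]: "finite (states n)"
  using finite_lists_length_eq[of "UNIV :: bool set" n] by simp

lemma col_step_length:
  "col_step (e, p) s s' \<Longrightarrow> p + inputs e \<le> length s \<and> length s' = length s - inputs e + outputs e"
proof (induction "(e, p)" s s' arbitrary: p rule: col_step.induct)
  case (1 p s s')
  then show ?case by (fastforce simp: Suc_diff_le)
qed auto

lemma run_tangle: "run s w c s' \<Longrightarrow> tangle (length s) w (length s')"
proof (induction w arbitrary: s c)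
  case (Cons x w)
  then show ?case
    by (cases x) (force dest: col_step_length)
qed simp

lemma reach_tangle: "reach s w s' \<Longrightarrow> tangle (length s) w (length s')"
  by (auto simp: reach_def run_tangle)

lemma reach_simps [simp]:
  "reach s [] s' \<longleftrightarrow> s = s'"
  "reach s (x # w) s' \<longleftrightarrow> (\<exists>s1. col_step x s s1 \<and> reach s1 w s')"
  by (auto simp: reach_def)

lemma reach_append: "reach s (u @ v) s' \<longleftrightarrow> (\<exists>s1. reach s u s1 \<and> reach s1 v s')"
  by (induction u arbitrary: s) auto

lemma reach_appendI: "reach s u s1 \<Longrightarrow> reach s1 v s' \<Longrightarrow> reach s (u @ v) s'"
  by (auto simp: reach_append)

lemma run_append:
  "run s (u @ v) c s' \<longleftrightarrow> (\<exists>c1 c2 s1. c = c1 @ c2 \<and> run s u c1 s1 \<and> run s1 v c2 s')"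
proof (induction u arbitrary: s c)
  case (Cons x u)
  show ?case
    by (simp add: Cons.IH) (metis append_Cons)
qed auto

lemma run_Cons_set:
  "{c. run s (x # w) c s'} = (\<Union>s1 \<in> {s1. col_step x s s1}. Cons s1 ` {c. run s1 w c s'})"
  by auto

lemma finite_col_step: "finite {s1. col_step x s s1}"
proof (cases x)
  case (Pair e p)
  have "{s1. col_step x s s1} \<subseteq> states (length s - inputs e + outputs e)"
    using col_step_length Pair by auto
  then show ?thesis
    using finite_states finite_subset by blast
qed

lemma finite_runs: "finite {c. run s w c s'}"
proof (induction w arbitrary: s)
  case (Cons x w)
  then show ?case
    unfolding run_Cons_set by (intro finite_UN_I finite_col_step finite_imageI) auto
qed simp

lemma runs_Nil: "runs s [] s' = of_bool (s = s')"
proof -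
  have "{c. run s [] c s'} = (if s = s' then {[]} else {})"
    by auto
  then show ?thesis
    by (simp add: runs_def)
qed

lemma runs_eq_0: "runs s w s' = 0 \<longleftrightarrow> \<not> reach s w s'"
  by (auto simp: runs_def reach_def finite_runs)

lemma runs_Cons': "runs s (x # w) s' = (\<Sum>s1 \<in> {s1. col_step x s s1}. runs s1 w s')"
proof -
  have "runs s (x # w) s' = card (\<Union>s1 \<in> {s1. col_step x s s1}. Cons s1 ` {c. run s1 w c s'})"
    unfolding runs_def run_Cons_set ..
  also have "\<dots> = (\<Sum>s1 \<in> {s1. col_step x s s1}. card (Cons s1 ` {c. run s1 w c s'}))"
    by (intro card_UN_disjoint finite_col_step ballI impI finite_imageI finite_runs) auto
  also have "\<dots> = (\<Sum>s1 \<in> {s1. col_step x s s1}. runs s1 w s')"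
    by (simp add: card_image runs_def)
  finally show ?thesis .
qed

lemma runs_Cons:
  assumes "tangle (length s) [x] m"
  shows "runs s (x # w) s' = (\<Sum>s1 \<in> states m. of_bool (col_step x s s1) * runs s1 w s')"
proof -
  have "{s1. col_step x s s1} \<subseteq> states m"
    using assms by (cases x) (auto dest: col_step_length)
  then have "runs s (x # w) s' = (\<Sum>s1 \<in> states m. if col_step x s s1 then runs s1 w s' else 0)"
    unfolding runs_Cons' by (subst sum.inter_filter[symmetric]) (auto intro: sum.cong)
  then show ?thesis
    by (simp add: of_bool_def if_distrib[of "\<lambda>x. x * _"] cong: if_cong)
qed

text \<open>Matrix multiplication: every colouring has exactly one state at the cut.\<close>

lemma runs_append:
  assumes "tangle (length s) u m"
  shows "runs s (u @ v) s' = (\<Sum>s1 \<in> states m. runs s u s1 * runs s1 v s')"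
  using assms
proof (induction u arbitrary: s)
  case Nil
  have "(\<Sum>s1 \<in> states m. runs s [] s1 * runs s1 v s') = (\<Sum>s1 \<in> {s}. runs s [] s1 * runs s1 v s')"
    using Nil by (intro sum.mono_neutral_right) (auto simp: runs_Nil)
  then show ?case
    by (simp add: runs_Nil)
next
  case (Cons x u)
  obtain n where n: "tangle (length s) [x] n" "tangle n u m"
    using Cons.prems tangle_append[of _ "[x]" u] by auto
  have "runs s ((x # u) @ v) s' =
      (\<Sum>s1 \<in> states n. \<Sum>s2 \<in> states m. of_bool (col_step x s s1) * (runs s1 u s2 * runs s2 v s'))"
    using n by (simp add: runs_Cons[OF n(1)] Cons.IH sum_distrib_left)
  also have "\<dots> = (\<Sum>s2 \<in> states m. (\<Sum>s1 \<in> states n. of_bool (col_step x s s1) * runs s1 u s2) * runs s2 v s')"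
    by (subst sum.swap) (simp add: sum_distrib_right mult.assoc)
  finally show ?case
    by (simp add: runs_Cons[OF n(1)])
qed

lemma runs_context:
  assumes "tangle (length s) u k" "tangle k a l" "tangle k b l"
    and "\<And>r r'. length r = k \<Longrightarrow> length r' = l \<Longrightarrow> runs r a r' = runs r b r'"
  shows "runs s (u @ a @ v) s' = runs s (u @ b @ v) s'"
proof -
  have "runs r (a @ v) s' = runs r (b @ v) s'" if "length r = k" for r
    using assms(2-4) that runs_append[of r _ l v s'] by simp
  then show ?thesis
    by (simp add: runs_append[OF assms(1)])
qed


subsection \<open>Invariance of the number of colourings\<close>

lemma runs_shift_Suc:
  "runs (x # s) (shift (Suc d) w) t =
    (case t of [] \<Rightarrow> 0 | y # t' \<Rightarrow> of_bool (x = y) * runs s (shift d w) t')"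
proof (induction w arbitrary: s)
  case Nil
  then show ?case
    by (auto simp: runs_Nil split: list.splits)
next
  case (Cons l w)
  obtain e p where l: "l = (e, p)" by (cases l)
  have "{s1. col_step (e, Suc (p + d)) (x # s) s1} = Cons x ` {s1. col_step (e, p + d) s s1}"
    by auto
  then have "runs (x # s) (shift (Suc d) (l # w)) t =
      (\<Sum>s1 \<in> {s1. col_step (e, p + d) s s1}. runs (x # s1) (shift (Suc d) w) t)"
    by (simp add: l runs_Cons' sum.reindex del: col_step.simps)
  then show ?case
    by (auto simp: Cons l runs_Cons' sum_distrib_left split: list.splits)
qed

text \<open>Strands to the left of a move only carry their colours along, so each move has to be
  checked at position 0 only.\<close>

lemma runs_shift_cong:
  assumes "\<And>s s'. m \<le> length s \<Longrightarrow> runs s a s' = runs s b s'" "d + m \<le> length s"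
  shows "runs s (shift d a) s' = runs s (shift d b) s'"
  using assms(2)
proof (induction d arbitrary: s s')
  case (Suc d)
  then show ?case
    by (cases s; cases s') (simp_all add: runs_shift_Suc)
qed (use assms(1) in simp)

lemma runs_unique:
  assumes "\<And>c c'. run s a c s' \<Longrightarrow> run s a c' s' \<Longrightarrow> c = c'"
  shows "runs s a s' = of_bool (reach s a s')"
proof (cases "reach s a s'")
  case True
  then obtain c where "run s a c s'"
    by (auto simp: reach_def)
  then have "{c. run s a c s'} = {c}"
    using assms by auto
  then show ?thesis
    using True by (simp add: runs_def)
qed (simp add: runs_eq_0)

text \<open>In each of the moves the boundary colours determine those inside, so the counts are 0 or
  1 and only reachability has to be compared.\<close>

lemma runs_eqI:
  assumes "\<And>c c'. run s a c s' \<Longrightarrow> run s a c' s' \<Longrightarrow> c = c'"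
    and "\<And>c c'. run s b c s' \<Longrightarrow> run s b c' s' \<Longrightarrow> c = c'"
    and "reach s a s' \<longleftrightarrow> reach s b s'"
  shows "runs s a s' = runs s b s'"
  using assms by (simp add: runs_unique)

lemma runs_planar_move:
  assumes "planar_move a b" "tangle (length s) a (length s')"
  shows "runs s a s' = runs s b s'"
  using assms
proof cases
  case (exchange x p y d)
  have "runs r [(x, 0), (y, outputs x + d)] r' = runs r [(y, inputs x + d), (x, 0)] r'" for r r'
    by (cases x; intro runs_eqI; fastforce simp: numeral_2_eq_2)
  then have "runs s (shift p [(x, 0), (y, outputs x + d)]) s' = runs s (shift p [(y, inputs x + d), (x, 0)]) s'"
    using assms(2) exchange by (intro runs_shift_cong[of 0]) auto
  then show ?thesis
    using exchange by (simp add: ac_simps)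
next
  case (snake_left i)
  have "runs r [(Cup, 0), (Cap, Suc 0)] r' = runs r [] r'" if len: "1 \<le> length r" for r r'
  proof -
    obtain a t where r: "r = a # t"
      using len by (cases r) auto
    show ?thesis
      unfolding r
    proof (rule runs_eqI)
      have "col_step (Cup, 0) (a # t) (a # a # a # t)" "col_step (Cap, Suc 0) (a # a # a # t) (a # t)"
        by simp_all
      then show "reach (a # t) [(Cup, 0), (Cap, Suc 0)] r' \<longleftrightarrow> reach (a # t) [] r'"
        unfolding reach_simps by auto
    qed auto
  qed
  then have "runs s (shift i [(Cup, 0), (Cap, Suc 0)]) s' = runs s (shift i []) s'"
    using assms(2) snake_left by (intro runs_shift_cong[of 1]) auto
  then show ?thesis
    using snake_left by simp
next
  case (snake_right i)
  have "runs r [(Cup, Suc 0), (Cap, 0)] r' = runs r [] r'" if len: "1 \<le> length r" for r r'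
  proof -
    obtain a t where r: "r = a # t"
      using len by (cases r) auto
    show ?thesis
      unfolding r
    proof (rule runs_eqI)
      have "col_step (Cup, Suc 0) (a # t) (a # a # a # t)" "col_step (Cap, 0) (a # a # a # t) (a # t)"
        by simp_all
      then show "reach (a # t) [(Cup, Suc 0), (Cap, 0)] r' \<longleftrightarrow> reach (a # t) [] r'"
        unfolding reach_simps by auto
    qed auto
  qed
  then have "runs s (shift i [(Cup, Suc 0), (Cap, 0)]) s' = runs s (shift i []) s'"
    using assms(2) snake_right by (intro runs_shift_cong[of 1]) auto
  then show ?thesis
    using snake_right by simp
next
  case (cup_slide i c)
  have "runs r [(Cup, Suc 0), (X c, 0)] r' = runs r [(Cup, 0), (X (switch c), Suc 0)] r'" for r r'
    by (auto intro!: runs_eqI)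
  then have "runs s (shift i [(Cup, Suc 0), (X c, 0)]) s' = runs s (shift i [(Cup, 0), (X (switch c), Suc 0)]) s'"
    using assms(2) cup_slide by (intro runs_shift_cong[of 0]) auto
  then show ?thesis
    using cup_slide by simp
next
  case (cap_slide c i)
  have "runs r [(X c, 0), (Cap, Suc 0)] r' = runs r [(X (switch c), Suc 0), (Cap, 0)] r'" for r r'
    by (auto intro!: runs_eqI)
  then have "runs s (shift i [(X c, 0), (Cap, Suc 0)]) s' = runs s (shift i [(X (switch c), Suc 0), (Cap, 0)]) s'"
    using assms(2) cap_slide by (intro runs_shift_cong[of 0]) auto
  then show ?thesis
    using cap_slide by simp
qed

lemma runs_regular_move:
  assumes "regular_move a b" "tangle (length s) a (length s')"
  shows "runs s a s' = runs s b s'"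
proof -
  consider "planar_move a b" | "reidemeister2 a b" | "reidemeister3 a b"
    using assms(1) by auto
  then show ?thesis
  proof cases
    case 1
    then show ?thesis
      using runs_planar_move assms(2) by blast
  next
    case 2
    then obtain c i where ab: "a = [(X c, i), (X (switch c), i)]" "b = []"
      by (auto elim: reidemeister2.cases)
    have "runs r [(X c, 0), (X (switch c), 0)] r' = runs r [] r'" if "2 \<le> length r" for r r'
      using that by (cases r; cases "tl r") (auto intro!: runs_eqI)
    then have "runs s (shift i [(X c, 0), (X (switch c), 0)]) s' = runs s (shift i []) s'"
      using assms(2) ab by (intro runs_shift_cong[of 2]) auto
    then show ?thesis
      using ab by simp
  next
    case 3
    then obtain c1 c2 c3 i where ab: "a = [(X c1, i), (X c2, Suc i), (X c3, i)]"
        "b = [(X c3, Suc i), (X c2, i), (X c1, Suc i)]"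
      by (auto elim: reidemeister3.cases)
    have "runs r [(X c1, 0), (X c2, Suc 0), (X c3, 0)] r' = runs r [(X c3, Suc 0), (X c2, 0), (X c1, Suc 0)] r'"
      for r r'
      by (auto intro!: runs_eqI)
    then have "runs s (shift i [(X c1, 0), (X c2, Suc 0), (X c3, 0)]) s' =
        runs s (shift i [(X c3, Suc 0), (X c2, 0), (X c1, Suc 0)]) s'"
      using assms(2) ab by (intro runs_shift_cong[of 0]) auto
    then show ?thesis
      using ab by simp
  qed
qed

lemma runs_isotopic:
  assumes "isotopic k l a b" "length s = k" "length s' = l"
  shows "runs s a s' = runs s b s'"
  using assms(1) unfolding isotopic_def
proof (induction rule: equivclp_induct)
  case (step y z)
  have "runs s c s' = runs s d s'" if "isotopy_step k l c d" for c d
  proof -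
    obtain u a' b' v where *: "regular_move a' b'" "c = u @ a' @ v" "d = u @ b' @ v" "tangle k c l"
      using \<open>isotopy_step k l c d\<close> unfolding isotopy_step_def by blast
    then obtain m n where "tangle k u m" "tangle m a' n"
      by (auto simp: tangle_append)
    then show ?thesis
      using assms regular_move_tangle[OF *(1)] unfolding *(2,3)
      by (intro runs_context runs_regular_move[OF *(1)]) auto
  qed
  then show ?case
    using step by metis
qed simp

lemma col_step_crossing: "col_step (X c, p) = col_step (X c', p)"
proof (intro ext)
  show "col_step (X c, p) s s' = col_step (X c', p) s s'" for s s'
    by (induction p arbitrary: s s') auto
qed

lemma runs_switch: "runs s (u @ [(X c, i)] @ v) s' = runs s (u @ [(X c', i)] @ v) s'"
  by (induction u arbitrary: s) (auto simp: runs_Cons' col_step_crossing[of c i c'])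


subsection \<open>Pointwise operations on colourings\<close>

text \<open>Any \<open>f\<close> is admissible because tiles only copy, compare and permute
  colours.\<close>

lemma col_step_map2:
  "col_step x s s' \<Longrightarrow> col_step x r r' \<Longrightarrow> length s = length r \<Longrightarrow> col_step x (map2 f s r) (map2 f s' r')"
proof (induction x s s' arbitrary: r r' rule: col_step.induct)
  case (1 e p s s')
  then show ?case by fastforce
qed auto

lemma col_step_length_eq:
  "col_step x s s' \<Longrightarrow> col_step x r r' \<Longrightarrow> length s = length r \<Longrightarrow> length s' = length r'"
  by (cases x) (metis col_step_length)

lemma run_map2:
  assumes "run s w c s'" "run r w d r'" "length s = length r"
  shows "run (map2 f s r) w (map2 (map2 f) c d) (map2 f s' r') \<and> list_all2 (\<lambda>a b. length a = length b) c d"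
  using assms
proof (induction w arbitrary: s r c d)
  case (Cons x w)
  obtain s1 c' where s: "c = s1 # c'" "col_step x s s1" "run s1 w c' s'"
    using Cons.prems(1) by auto
  obtain r1 d' where r: "d = r1 # d'" "col_step x r r1" "run r1 w d' r'"
    using Cons.prems(2) by auto
  have l: "length s1 = length r1"
    using s(2) r(2) Cons.prems(3) by (rule col_step_length_eq)
  have "col_step x (map2 f s r) (map2 f s1 r1)"
    using s(2) r(2) Cons.prems(3) by (rule col_step_map2)
  with Cons.IH[OF s(3) r(3) l] show ?case
    using s(1) r(1) l by auto
qed simp

lemma reach_map2:
  "reach s w s' \<Longrightarrow> reach r w r' \<Longrightarrow> length s = length r \<Longrightarrow> reach (map2 f s r) w (map2 f s' r')"
  unfolding reach_def using run_map2 by blast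

abbreviation xor :: "bool list \<Rightarrow> bool list \<Rightarrow> bool list" where
  "xor \<equiv> map2 (\<lambda>x y. x = (\<not> y))"

lemma xor_xor: "length s = length r \<Longrightarrow> xor (xor s r) r = s"
  by (induction s r rule: list_induct2) auto

lemma map2_xor_xor: "list_all2 (\<lambda>a b. length a = length b) c d \<Longrightarrow> map2 xor (map2 xor c d) d = c"
  by (induction rule: list_all2_induct) (auto simp: xor_xor)

text \<open>Colourings form a vector space over the field with two elements. Translation by one
  fixed colouring with ends \<open>r\<close> and \<open>r'\<close> is undone by repeating it, hence
  is a bijection.\<close>

lemma runs_xor:
  assumes "reach r w r'" "length s = length r" "length s' = length r'"
  shows "runs (xor s r) w (xor s' r') = runs s w s'"
proof -
  obtain d where d: "run r w d r'"
    using assms(1) by (auto simp: reach_def)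
  have le: "runs s w s' \<le> runs (xor s r) w (xor s' r')" if "length s = length r" for s s'
    unfolding runs_def
  proof (rule card_inj_on_le)
    show "inj_on (\<lambda>c. map2 xor c d) {c. run s w c s'}"
      using run_map2[OF _ d that] by (intro inj_on_inverseI[of _ "\<lambda>c. map2 xor c d"]) (auto simp: map2_xor_xor)
    show "(\<lambda>c. map2 xor c d) ` {c. run s w c s'} \<subseteq> {c. run (xor s r) w c (xor s' r')}"
      using run_map2[OF _ d that] by auto
  qed (rule finite_runs)
  show ?thesis
    using le[of s s'] le[of "xor s r" "xor s' r'"] assms(2,3) by (simp add: xor_xor)
qed

text \<open>A crossing permutes the colours; a minimum or maximum creates or removes two equal
  ones.\<close>

lemma col_step_parity: "col_step x s s' \<Longrightarrow> even (count_list s True) \<longleftrightarrow> even (count_list s' True)"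
  by (induction x s s' rule: col_step.induct) (auto split: if_splits)

lemma reach_parity: "reach s w s' \<Longrightarrow> even (count_list s True) \<longleftrightarrow> even (count_list s' True)"
  by (induction w arbitrary: s) (auto dest: col_step_parity)


subsection \<open>Smoothing a crossing of two colours\<close>

lemma col_step_append: "col_step (e, length A) (A @ s) s' \<longleftrightarrow> (\<exists>r. s' = A @ r \<and> col_step (e, 0) s r)"
  by (induction A arbitrary: s') auto

text \<open>
  If some colouring gives the two strands at a crossing different colours, then the rest of the
  diagram joins opposite ends of the crossing: the number of strands of colour \<open>True\<close> is even at
  every level, also after combining two colourings pointwise.
\<close>

lemma opposite_ends:
  assumes u: "reach [] u (A @ a # b # B)" and v: "reach (A @ b # a # B) v []" and ab: "a \<noteq> b"
    and u': "reach [] u (A' @ p # q # B')" and v': "reach (A' @ p' # q' # B') v []"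
    and len: "length A' = length A" "length B' = length B"
  shows "p' = q \<and> q' = p"
proof -
  \<comment> \<open>The combined states just below and just above the crossing both have an even
    number of entries \<open>True\<close>. They agree outside the crossing, so those parts cancel in
    the sum. The two choices of \<open>f\<close> used below isolate the ends where the reference
    colouring is \<open>True\<close> and those where it is \<open>False\<close>.\<close>
  have parity: "even (of_bool (f p a) + of_bool (f q b) + of_bool (f p' b) + of_bool (f q' a) :: nat)"
    for f :: "bool \<Rightarrow> bool \<Rightarrow> bool"
  proof -
    have "reach [] u (map2 f (A' @ p # q # B') (A @ a # b # B))"
      using reach_map2[OF u' u, of f] by simp
    moreover have "reach (map2 f (A' @ p' # q' # B') (A @ b # a # B)) v []"
      using reach_map2[OF v' v, of f] len by simp
    ultimately show ?thesis
      using len by (auto dest!: reach_parity simp: zip_append of_bool_def split: if_splits)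
  qed
  from parity[of "(\<and>)"] parity[of "\<lambda>x y. x \<and> \<not> y"] ab show ?thesis
    by (cases a; cases b) (auto simp: of_bool_def split: if_splits)
qed

text \<open>States split by whether the two colours at the crossing agree. Only those that agree
  extend over the vertical smoothing. Over the crossing both kinds extend, in equal number, because
  adding the fixed colouring exchanges them: hence the factor 2, that is, one component
  more.\<close>

lemma runs_mixed:
  assumes u: "reach [] u (A @ a # b # B)" and v: "reach (A @ b # a # B) v []" and ab: "a \<noteq> b"
  defines "i \<equiv> length A"
  shows "runs [] (u @ [(X c, i)] @ v) [] = 2 * runs [] (u @ v) []"
    and "runs [] (u @ [(Cap, i), (Cup, i)] @ v) [] = runs [] (u @ v) []"
proof -
  define m where "m = length A + 2 + length B"
  define g where "g s = runs [] u s" for s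
  define h where "h s = runs s v []" for s
  define D where "D = {s \<in> states m. s ! i = s ! Suc i}"
  define sw where "sw s = s[i := s ! Suc i, Suc i := s ! i]" for s :: "bool list"
  define \<chi> where "\<chi> = A @ a # b # B"
  have tu: "tangle (length []) u m"
    using reach_tangle[OF u] by (simp add: m_def)
  have split: "\<exists>A' p q B'. s = A' @ p # q # B' \<and> length A' = i \<and> length B' = length B" if "s \<in> states m" for s
  proof -
    have "drop i s = s ! i # s ! Suc i # drop (Suc (Suc i)) s"
      using that by (simp add: m_def i_def Cons_nth_drop_Suc)
    then have "s = take i s @ s ! i # s ! Suc i # drop (Suc (Suc i)) s"
      by (metis append_take_drop_id)
    moreover have "length (take i s) = i" "length (drop (Suc (Suc i)) s) = length B"
      using that by (simp_all add: m_def i_def)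
    ultimately show ?thesis by blast
  qed
  have sw: "sw (A' @ p # q # B') = A' @ q # p # B'" if "length A' = i" for A' p q B'
    using that by (simp add: sw_def list_update_append nth_append)
  have nth: "(A' @ p # q # B') ! i = p" "(A' @ p # q # B') ! Suc i = q" if "length A' = i" for A' p q and B' :: "bool list"
    using that by (auto simp: nth_append)
  \<comment> \<open>For strands running straight up, \<open>opposite_ends\<close> forces
    \<open>p = q\<close>.\<close>
  have outside: "g s * h s = 0" if sD: "s \<in> states m - D" for s
  proof -
    obtain A' p q B' where s: "s = A' @ p # q # B'" "length A' = i" "length B' = length B"
      using sD split[of s] by blast
    then have "p \<noteq> q"
      using sD by (auto simp: D_def nth)
    then have "\<not> (reach [] u s \<and> reach s v [])"
      using opposite_ends[OF u v ab, of A' p q B' p q] s by (auto simp: i_def)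
    then show ?thesis
      by (auto simp: g_def h_def runs_eq_0)
  qed
  have uv: "runs [] (u @ v) [] = (\<Sum>s \<in> D. g s * h s)"
    unfolding runs_append[OF tu] g_def[symmetric] h_def[symmetric]
    using outside by (intro sum.mono_neutral_right) (auto simp: D_def)
  have "runs [] (u @ [(X c, i)] @ v) [] = (\<Sum>s \<in> states m. g s * h (sw s))"
    unfolding runs_append[OF tu]
  proof (rule sum.cong[OF refl])
    fix s assume "s \<in> states m"
    then obtain A' p q B' where s: "s = A' @ p # q # B'" "length A' = i"
      using split by blast
    have "{s1. col_step (X c, i) s s1} = {sw s}"
      using col_step_append[of "X c" A' "p # q # B'"] s by (auto simp: sw)
    then show "runs [] u s * runs s ([(X c, i)] @ v) [] = g s * h (sw s)"
      by (simp add: runs_Cons' g_def h_def)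
  qed
  also have "\<dots> = (\<Sum>s \<in> D. g s * h (sw s)) + (\<Sum>s \<in> states m - D. g s * h (sw s))"
    by (subst sum.subset_diff[of D]) (auto simp: D_def)
  also have "(\<Sum>s \<in> D. g s * h (sw s)) = (\<Sum>s \<in> D. g s * h s)"
  proof (intro sum.cong refl)
    fix s assume "s \<in> D"
    then have "sw s = s"
      unfolding D_def sw_def by (metis (mono_tags, lifting) list_update_id mem_Collect_eq)
    then show "g s * h (sw s) = g s * h s"
      by simp
  qed
  \<comment> \<open>The fixed colouring reads \<open>a, b\<close> below the crossing and
    \<open>b, a\<close> above it. When the colours of \<open>s\<close> differ, adding
    \<open>\<chi>\<close> to \<open>s\<close> therefore gives the same state as adding the upper
    state to the exchanged \<open>sw s\<close>.\<close>
  also have "(\<Sum>s \<in> states m - D. g s * h (sw s)) = (\<Sum>s \<in> D. g s * h s)"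
  proof (rule sum.reindex_bij_witness[of _ "\<lambda>s. xor s \<chi>" "\<lambda>s. xor s \<chi>"])
    have \<chi>: "length \<chi> = m" "\<chi> ! i \<noteq> \<chi> ! Suc i" "i < m" "Suc i < m"
      using ab by (auto simp: \<chi>_def m_def i_def nth_append)
    show "xor (xor s \<chi>) \<chi> = s" "xor s \<chi> \<in> D" if "s \<in> states m - D" for s
      using that \<chi> by (auto simp: D_def xor_xor)
    show "xor (xor s \<chi>) \<chi> = s" "xor s \<chi> \<in> states m - D" if "s \<in> D" for s
      using that \<chi> by (auto simp: D_def xor_xor)
    show "g (xor s \<chi>) * h (xor s \<chi>) = g s * h (sw s)" if sD: "s \<in> states m - D" for s
    proof -
      obtain A' p q B' where s: "s = A' @ p # q # B'" "length A' = i" "length B' = length B"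
        using sD split[of s] by blast
      then have pq: "p \<noteq> q"
        using sD by (auto simp: D_def nth)
      have "xor s \<chi> = xor (sw s) (A @ b # a # B)"
        using s pq ab by (auto simp: sw \<chi>_def i_def)
      then have "h (xor s \<chi>) = h (sw s)"
        using runs_xor[OF v, of "sw s" "[]"] s by (simp add: h_def sw i_def)
      moreover have "g (xor s \<chi>) = g s"
        using runs_xor[OF u, of "[]" s] s by (simp add: g_def \<chi>_def i_def)
      ultimately show ?thesis by simp
    qed
  qed
  finally show "runs [] (u @ [(X c, i)] @ v) [] = 2 * runs [] (u @ v) []"
    using uv by simp
  have "runs [] (u @ [(Cap, i), (Cup, i)] @ v) [] = (\<Sum>s \<in> states m. g s * h s)"
    unfolding runs_append[OF tu]
  proof (rule sum.cong[OF refl])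
    fix s assume s_states: "s \<in> states m"
    then obtain A' p q B' where s: "s = A' @ p # q # B'" "length A' = i" "length B' = length B"
      using split by blast
    have cap: "{s1. col_step (Cap, i) s s1} = (if p = q then {A' @ B'} else {})"
      using col_step_append[of Cap A' "p # q # B'"] s by auto
    have cup: "{s1. col_step (Cup, i) (A' @ B') s1} = (\<lambda>r. A' @ r # r # B') ` {p, \<not> p}"
      using col_step_append[of Cup A' B'] s by auto
    have "g s * runs s ([(Cap, i), (Cup, i)] @ v) [] = g s * h s"
    proof (cases "p = q")
      case True
      have "runs s ([(Cap, i), (Cup, i)] @ v) [] = h s + h (A' @ (\<not> p) # (\<not> p) # B')"
      proof -
        have "A' @ p # p # B' = s" "s \<noteq> A' @ (\<not> p) # (\<not> p) # B'"
          using True s by auto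
        then show ?thesis
          using True by (simp add: runs_Cons' cap cup h_def sum.reindex inj_on_def)
      qed
      \<comment> \<open>The new minimum could take the other colour than the maximum below it, but
        \<open>opposite_ends\<close> rules this out, as it would need
        \<open>\<not> p = p\<close>.\<close>
      moreover have "\<not> (reach [] u s \<and> reach (A' @ (\<not> p) # (\<not> p) # B') v [])"
        using opposite_ends[OF u v ab, of A' p q B' "\<not> p" "\<not> p"] s by (auto simp: i_def)
      then have "g s * h (A' @ (\<not> p) # (\<not> p) # B') = 0"
        by (auto simp: g_def h_def runs_eq_0)
      ultimately show ?thesis
        by (simp add: distrib_left)
    next
      case False
      then have "s \<in> states m - D"
        using s_states s by (auto simp: D_def nth)
      with False show ?thesis
        using outside[of s] by (simp add: runs_Cons' cap)
    qed
    then show "runs [] u s * runs s ([(Cap, i), (Cup, i)] @ v) [] = g s * h s"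
      by (simp add: g_def)
  qed
  then show "runs [] (u @ [(Cap, i), (Cup, i)] @ v) [] = runs [] (u @ v) []"
    unfolding runs_append[OF tu, of v] g_def h_def by simp
qed


subsection \<open>Colourings and components\<close>

lemma run_nth:
  "run s w c s' \<longleftrightarrow> length c = length w \<and> (\<forall>t < length w. col_step (w ! t) ((s # c) ! t) (c ! t)) \<and> last (s # c) = s'"
proof (induction w arbitrary: s c)
  case (Cons x w)
  show ?case
    by (cases c) (auto simp: Cons.IH All_less_Suc2)
qed auto

text \<open>The coordinatewise form runs parallel to the introduction rules of
  \<open>joined\<close>, so that colourings become functions constant along arcs.\<close>

lemma col_step_iff:
  "col_step (e, p) s s' \<longleftrightarrow> p + inputs e \<le> length s \<and> length s' + inputs e = length s + outputs e \<and>
     (\<forall>j < p. s ! j = s' ! j) \<and>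
     (\<forall>d. p + inputs e + d < length s \<longrightarrow> s ! (p + inputs e + d) = s' ! (p + outputs e + d)) \<and>
     (case e of Cup \<Rightarrow> s' ! p = s' ! Suc p | Cap \<Rightarrow> s ! p = s ! Suc p
      | X c \<Rightarrow> s ! p = s' ! Suc p \<and> s ! Suc p = s' ! p)"
proof (induction p arbitrary: s s')
  case 0
  have nth_eq: "(\<forall>d < length r. r ! d = r' ! d) \<longleftrightarrow> r = r'" if "length r = length r'" for r r' :: "bool list"
    using that by (simp add: list_eq_iff_nth_eq)
  show ?case
  proof (cases e)
    case Cup
    show ?thesis
    proof (cases "length s' = length s + 2")
      case True
      then obtain x y r where s': "s' = x # y # r" "length s = length r"
        by (metis add_2_eq_Suc' length_Suc_conv)
      then show ?thesis
        using nth_eq[OF s'(2)] by (simp add: Cup eq_commute conj_commute)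
    qed (auto simp: Cup)
  next
    case Cap
    show ?thesis
    proof (cases "2 \<le> length s \<and> length s' = length s - 2")
      case True
      then obtain x y r where s: "s = x # y # r" "length r = length s'"
        by (metis add_2_eq_Suc' le_add_diff_inverse2 length_Suc_conv)
      then show ?thesis
        using nth_eq[OF s(2)] by (simp add: Cap eq_commute conj_commute)
    qed (auto simp: Cap)
  next
    case (X c)
    show ?thesis
    proof (cases "2 \<le> length s \<and> length s' = length s")
      case True
      then obtain x y r x' y' r' where s: "s = x # y # r" "s' = x' # y' # r'"
        by (cases s; cases "tl s"; cases s'; cases "tl s'") auto
      with True have len: "length r = length r'"
        by simp
      then show ?thesis
        using nth_eq[OF len] s by (simp add: X, argo)
    qed (auto simp: X)
  qed
next
  case (Suc p)
  show ?case
  proof (cases "s = [] \<or> s' = []")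
    case False
    then obtain x r y r' where "s = x # r" "s' = y # r'"
      by (meson neq_Nil_conv)
    then show ?thesis
      using Suc.IH[of r r'] by (cases e) (simp_all add: All_less_Suc2 eq_commute[of y x] conj_ac)
  qed (cases e; auto)
qed

lemma width_tangle:
  assumes "tangle 0 L l" "t \<le> length L"
  shows "tangle 0 (take t L) (width L t)"
proof -
  obtain k where "tangle 0 (take t L) k"
    using assms(1) tangle_append[of 0 "take t L" "drop t L" l] by auto
  then show ?thesis
    unfolding width_def by (rule theI) (use \<open>tangle 0 (take t L) k\<close> tangle_unique in blast)
qed

lemma width_0 [simp]: "width L 0 = 0"
  by (simp add: width_def)

lemma width_Suc:
  assumes "tangle 0 L l" "t < length L" "L ! t = (e, p)"
  shows "p + inputs e \<le> width L t" "width L (Suc t) = width L t - inputs e + outputs e"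
proof -
  have "tangle 0 (take t L @ [(e, p)]) (width L (Suc t))"
    using width_tangle[OF assms(1), of "Suc t"] assms by (simp add: take_Suc_conv_app_nth)
  then have "tangle (width L t) [(e, p)] (width L (Suc t))"
    using tangle_append_iff width_tangle[OF assms(1), of t] assms(2) by simp
  then show "p + inputs e \<le> width L t" "width L (Suc t) = width L t - inputs e + outputs e"
    by auto
qed

lemma run_width:
  assumes "run [] L c []" "t \<le> length L"
  shows "length (([] # c) ! t) = width L t"
  using assms(2)
proof (induction t)
  case (Suc t)
  obtain e p where ep: "L ! t = (e, p)" by (cases "L ! t")
  have "col_step (e, p) (([] # c) ! t) (c ! t)"
    using assms(1) Suc.prems ep unfolding run_nth by (metis Suc_le_eq)
  then show ?case
    using col_step_length Suc width_Suc[of L 0 t e p] run_tangle[OF assms(1)] ep by simp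
qed simp

lemma joined_constant:
  assumes c: "run [] L c []" and j: "joined L P Q"
  shows "([] # c) ! fst P ! snd P = ([] # c) ! fst Q ! snd Q"
proof -
  have step: "col_step (L ! t) (([] # c) ! t) (c ! t)" if "t < length L" for t
    using c that by (simp add: run_nth)
  show ?thesis
    using j
  proof cases
    case (right t e p d)
    then show ?thesis
      using step[of t] run_width[OF c, of t] by (simp add: col_step_iff)
  qed (use step in \<open>force simp: col_step_iff\<close>)+
qed

lemma same_component_constant:
  assumes "run [] L c []" "same_component L P Q"
  shows "([] # c) ! fst P ! snd P = ([] # c) ! fst Q ! snd Q"
  using assms(2) unfolding same_component_def
  by (induction rule: equivclp_induct) (use joined_constant[OF assms(1)] in auto)

lemma joined_points:
  assumes "tangle 0 L 0" "joined L P Q"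
  shows "P \<in> points L \<and> Q \<in> points L"
  using assms(2)
proof cases
  case (right t e p d)
  then show ?thesis
    using width_Suc[OF assms(1), of t e p] by (auto simp: points_def)
qed (use width_Suc[OF assms(1)] in \<open>fastforce simp: points_def\<close>)+

definition colouring_of :: "diagram \<Rightarrow> (nat \<times> nat \<Rightarrow> bool) \<Rightarrow> bool list list" where
  "colouring_of L g = map (\<lambda>t. map (\<lambda>j. g (Suc t, j)) [0..<width L (Suc t)]) [0..<length L]"

lemma nth_colouring_of:
  assumes "t \<le> length L"
  shows "([] # colouring_of L g) ! t = map (\<lambda>j. g (t, j)) [0..<width L t]"
  using assms by (cases t) (simp_all add: colouring_of_def)

lemma run_colouring_of:
  assumes L: "tangle 0 L 0" and g: "\<And>P Q. joined L P Q \<Longrightarrow> g P = g Q"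
  shows "run [] L (colouring_of L g) []"
  unfolding run_nth
proof (intro conjI allI impI)
  show "length (colouring_of L g) = length L"
    by (simp add: colouring_of_def)
  have "width L (length L) = 0"
    using width_tangle[OF L, of "length L"] L tangle_unique by simp
  then show "last ([] # colouring_of L g) = []"
    by (simp add: colouring_of_def last_conv_nth)
  fix t assume t: "t < length L"
  obtain e p where ep: "L ! t = (e, p)" by (cases "L ! t")
  have w: "p + inputs e \<le> width L t" "width L (Suc t) + inputs e = width L t + outputs e"
    using width_Suc[OF L t ep] by simp_all
  define r r' where "r = ([] # colouring_of L g) ! t" and "r' = colouring_of L g ! t"
  have "r = map (\<lambda>j. g (t, j)) [0..<width L t]"
    unfolding r_def using t by (intro nth_colouring_of) simp
  then have r: "length r = width L t" "\<And>j. j < width L t \<Longrightarrow> r ! j = g (t, j)"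
    by simp_all
  have "r' = map (\<lambda>j. g (Suc t, j)) [0..<width L (Suc t)]"
    using nth_colouring_of[of "Suc t" L g] t by (simp add: r'_def)
  then have r': "length r' = width L (Suc t)" "\<And>j. j < width L (Suc t) \<Longrightarrow> r' ! j = g (Suc t, j)"
    by (simp_all del: upt_Suc)
  note j = joined.intros[of t L, OF t]
  have "col_step (e, p) r r'"
    unfolding col_step_iff
    using w r r' j(1,2)[THEN g, OF ep] j(3-)[THEN g] ep by (auto split: tile.splits)
  then show "col_step (L ! t) (([] # colouring_of L g) ! t) (colouring_of L g ! t)"
    by (simp add: ep r_def r'_def)
qed

definition component_rel :: "diagram \<Rightarrow> ((nat \<times> nat) \<times> nat \<times> nat) set" where
  "component_rel L = {(P, Q). P \<in> points L \<and> Q \<in> points L \<and> same_component L P Q}"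

lemma equiv_component_rel: "equiv (points L) (component_rel L)"
  unfolding component_rel_def same_component_def
  by (intro equivI refl_onI symI transI) (auto intro: equivclp_sym equivclp_trans)

lemma components_alt: "components L = points L // component_rel L"
  by (simp add: components_def component_rel_def)

lemma finite_points: "finite (points L)"
proof -
  have "points L \<subseteq> (SIGMA t:{..length L}. {..<width L t})"
    by (auto simp: points_def)
  then show ?thesis
    by (rule finite_subset) auto
qed

lemma finite_components: "finite (components L)"
  unfolding components_alt by (intro finite_quotient finite_points) (auto simp: component_rel_def)

lemma Union_components: "\<Union> (components L) = points L"
  unfolding components_alt by (rule Union_quotient[OF equiv_component_rel])

lemma component_disjoint:
  assumes "C \<in> components L" "C' \<in> components L" "P \<in> C" "P \<in> C'"
  shows "C = C'"
  using quotient_disj[OF equiv_component_rel, of C L C'] assms unfolding components_alt by blast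

lemma component_nonempty: "C \<in> components L \<Longrightarrow> C \<noteq> {}"
  unfolding components_alt using in_quotient_imp_non_empty[OF equiv_component_rel] by blast

lemma component_same:
  assumes "C \<in> components L" "P \<in> C" "Q \<in> C"
  shows "same_component L P Q"
  using quotient_eqI in_quotient_imp_in_rel[OF equiv_component_rel, of C L] assms
  unfolding components_alt component_rel_def by auto

lemma run_of_components:
  assumes L: "tangle 0 L 0" and S: "S \<subseteq> components L"
  shows "run [] L (colouring_of L (\<lambda>P. P \<in> \<Union> S)) []"
proof (rule run_colouring_of[OF L])
  fix P Q assume j: "joined L P Q"
  then have "(P, Q) \<in> component_rel L" "(Q, P) \<in> component_rel L"
    using joined_points[OF L j] by (auto simp: component_rel_def same_component_def)
  then have "P \<in> C \<longleftrightarrow> Q \<in> C" if "C \<in> components L" for C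
    using that in_quotient_imp_closed[OF equiv_component_rel] unfolding components_alt by blast
  then show "(P \<in> \<Union> S) = (Q \<in> \<Union> S)"
    using S by blast
qed

text \<open>A colouring is constant on components, so it amounts to the set of components of colour
  \<open>True\<close>.\<close>

lemma runs_num_components:
  assumes L: "tangle 0 L 0"
  shows "runs [] L [] = 2 ^ num_components L"
proof -
  define colour where "colour c P = ([] # c) ! fst P ! snd P" for c :: "bool list list" and P :: "nat \<times> nat"
  define f where "f c = {C \<in> components L. \<exists>P \<in> C. colour c P}" for c
  define h where "h S = colouring_of L (\<lambda>P. P \<in> \<Union> S)" for S
  have colour_h: "colour (h S) P \<longleftrightarrow> P \<in> \<Union> S" if points: "P \<in> points L" for P S
  proof -
    obtain t j where "P = (t, j)" "t \<le> length L" "j < width L t"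
      using points by (auto simp: points_def)
    then show ?thesis
      by (simp add: colour_def h_def nth_colouring_of)
  qed
  have "bij_betw f {c. run [] L c []} (Pow (components L))"
  proof (rule bij_betw_byWitness[where f' = h])
    show "f ` {c. run [] L c []} \<subseteq> Pow (components L)"
      by (auto simp: f_def)
    show "h ` Pow (components L) \<subseteq> {c. run [] L c []}"
      using run_of_components[OF L] by (auto simp: h_def)
    show "\<forall>S \<in> Pow (components L). f (h S) = S"
    proof
      fix S assume S: "S \<in> Pow (components L)"
      have "(\<exists>P \<in> C. colour (h S) P) \<longleftrightarrow> C \<in> S" if C: "C \<in> components L" for C
      proof -
        have "C \<subseteq> points L"
          using C Union_components by blast
        then have "(\<exists>P \<in> C. colour (h S) P) \<longleftrightarrow> (\<exists>P \<in> C. P \<in> \<Union> S)"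
          using colour_h by blast
        also have "\<dots> \<longleftrightarrow> C \<in> S"
          using S C component_disjoint[OF C] component_nonempty[OF C] by blast
        finally show ?thesis .
      qed
      then show "f (h S) = S"
        using S by (auto simp: f_def)
    qed
    show "\<forall>c \<in> {c. run [] L c []}. h (f c) = c"
    proof
      fix c assume "c \<in> {c. run [] L c []}"
      then have c: "run [] L c []" by simp
      show "h (f c) = c"
      proof (rule nth_equalityI)
        show l: "length (h (f c)) = length c"
          using c by (simp add: h_def colouring_of_def run_nth)
        fix t assume "t < length (h (f c))"
        then have t: "t < length L" "t < length c"
          using l c by (simp_all add: run_nth)
        show "h (f c) ! t = c ! t"
        proof (rule nth_equalityI)
          show l': "length (h (f c) ! t) = length (c ! t)"
            using run_width[OF c, of "Suc t"] t by (simp add: h_def colouring_of_def)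
          fix j assume j: "j < length (h (f c) ! t)"
          then have P: "(Suc t, j) \<in> points L"
            using run_width[OF c, of "Suc t"] t l' by (simp add: points_def)
          then obtain C where C: "C \<in> components L" "(Suc t, j) \<in> C"
            using Union_components by blast
          have "h (f c) ! t ! j \<longleftrightarrow> colour (h (f c)) (Suc t, j)"
            by (simp add: colour_def)
          also have "\<dots> \<longleftrightarrow> (Suc t, j) \<in> \<Union> (f c)"
            using P by (rule colour_h)
          also have "\<dots> \<longleftrightarrow> C \<in> f c"
            using C component_disjoint[OF _ C(1) _ C(2)] unfolding f_def by blast
          also have "\<dots> \<longleftrightarrow> (\<exists>P \<in> C. colour c P)"
            using C(1) by (simp add: f_def)
          also have "\<dots> \<longleftrightarrow> colour c (Suc t, j)"
          proof -
            have "colour c P \<longleftrightarrow> colour c (Suc t, j)" if "P \<in> C" for P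
              unfolding colour_def by (rule same_component_constant[OF c component_same[OF C(1) that C(2)]])
            then show ?thesis
              using C(2) by blast
          qed
          finally show "h (f c) ! t ! j = c ! t ! j"
            by (simp add: colour_def)
        qed
      qed
    qed
  qed
  then have "runs [] L [] = card (Pow (components L))"
    unfolding runs_def by (rule bij_betw_same_card)
  then show ?thesis
    by (simp add: card_Pow finite_components num_components_def)
qed

text \<open>One component is coloured \<open>True\<close> and the rest \<open>False\<close>. The
  bottom level, which \<open>c\<close> omits, has no points, so both colours do occur in
  \<open>c\<close>.\<close>

lemma two_colours:
  assumes L: "tangle 0 L 0" and n: "num_components L \<ge> 2"
  shows "\<exists>c. run [] L c [] \<and> (\<forall>b. \<exists>s \<in> set c. b \<in> set s)"
proof -
  obtain C C' where C: "C \<in> components L" "C' \<in> components L" "C \<noteq> C'"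
    using n unfolding num_components_def
    by (metis card_le_Suc0_iff_eq finite_components not_less_eq_eq numeral_2_eq_2)
  define c where "c = colouring_of L (\<lambda>P. P \<in> \<Union> {C})"
  have colour: "\<exists>s \<in> set c. (P \<in> C) \<in> set s" if P: "P \<in> points L" for P
  proof -
    obtain t j where "P = (Suc t, j)" "t < length L" "j < width L (Suc t)"
      using P by (cases "fst P") (auto simp: points_def)
    then show ?thesis
      by (force simp: c_def colouring_of_def)
  qed
  obtain P P' where P: "P \<in> C" "P' \<in> C'"
    using C component_nonempty by blast
  then have "P \<in> points L" "P' \<in> points L" "P' \<notin> C"
    using C component_disjoint Union_components by blast+
  then have "\<exists>s \<in> set c. b \<in> set s" for b
    using colour[of P] colour[of P'] P by (cases b) simp_all
  then show ?thesis
    using run_of_components[OF L, of "{C}"] C(1) by (auto simp: c_def)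
qed

lemma num_components_pos:
  assumes "link_diagram L"
  shows "num_components L \<ge> 1"
proof -
  obtain e p L' where L: "L = (e, p) # L'"
    using assms by (cases L) (auto simp: link_diagram_def)
  have L0: "tangle 0 L 0"
    using assms by (simp add: link_diagram_def)
  then have "e = Cup"
    using L by (cases e) auto
  then have "(1, 0) \<in> points L"
    using L width_Suc[OF L0, of 0 e p] by (simp add: points_def)
  then have "components L \<noteq> {}"
    using Union_components by blast
  then show ?thesis
    using finite_components[of L] by (simp add: num_components_def Suc_le_eq card_gt_0_iff)
qed

text \<open>A colouring that tells the two strands apart certifies different components. Given in
  two halves, below and above the crossing, this certificate is the working form of a mixed crossing
  from here on.\<close>

lemma mixed_crossingI:
  assumes u: "reach [] u (A @ a # b # B)" and v: "reach (A @ b # a # B) v []" and ab: "a \<noteq> b"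
  shows "mixed_crossing (u @ [(X c, length A)] @ v) (length u) (length A)"
proof -
  obtain c1 where c1: "run [] u c1 (A @ a # b # B)"
    using u by (auto simp: reach_def)
  have "col_step (X c, length A) (A @ a # b # B) (A @ b # a # B)"
    by (simp add: col_step_append)
  then have "reach (A @ a # b # B) ([(X c, length A)] @ v) []"
    using v by auto
  then obtain c2 where "run (A @ a # b # B) ([(X c, length A)] @ v) c2 []"
    unfolding reach_def by blast
  with c1 have run: "run [] (u @ [(X c, length A)] @ v) (c1 @ c2) []"
    using run_append by blast
  have "length c1 = length u" "last ([] # c1) = A @ a # b # B"
    using c1 by (simp_all only: run_nth)
  then have "([] # c1 @ c2) ! length u = A @ a # b # B"
    by (cases c1 rule: rev_cases) (auto simp: nth_append nth_Cons')
  then show ?thesis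
    using same_component_constant[OF run, of "(length u, length A)" "(length u, Suc (length A))"] ab
    by (auto simp: mixed_crossing_def nth_append)
qed


section \<open>Separating the components\<close>

lemma isotopic_widen:
  assumes "isotopic k l a b"
  shows "isotopic (k + d) (l + d) a b"
  using assms unfolding isotopic_def
proof (induction rule: equivclp_induct)
  case (step y z)
  then have "isotopy_step (k + d) (l + d) y z \<or> isotopy_step (k + d) (l + d) z y"
    unfolding isotopy_step_def using tangle_widen by blast
  with step.IH show ?case
    by (rule equivclp_into_equivclp)
qed simp

text \<open>At descending positions, \<open>X Neg\<close> carries a single strand to the left under
  \<open>n\<close> others.\<close>

definition under_left :: "nat \<Rightarrow> nat \<Rightarrow> diagram" where
  "under_left i n = map (Pair (X Neg)) (rev [i..<i + n])"

lemma slide_left_tile: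
  assumes "k = Suc (i + inputs e + d)" "l = Suc (i + outputs e + d)"
  shows "isotopic k l (under_left i (inputs e) @ [(e, Suc i)]) ((e, i) # under_left i (outputs e))"
proof (cases e)
  case Cup
  have "isotopic k l ([] @ [(Cup, Suc i), (X Pos, i)] @ [(X Neg, i)])
      ([] @ [(Cup, i), (X (switch Pos), Suc i)] @ [(X Neg, i)])"
    using assms Cup by (intro isotopic_planar planar_move.intros) auto
  moreover have "isotopic k l ([(Cup, Suc i)] @ [(X Pos, i), (X (switch Pos), i)] @ []) ([(Cup, Suc i)] @ [])"
    using assms Cup by (intro isotopic_reidemeister2) auto
  ultimately have "isotopic k l [(Cup, Suc i)] [(Cup, i), (X Neg, Suc i), (X Neg, i)]"
    by (auto intro: isotopic_trans isotopic_sym)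
  then show ?thesis
    using Cup by (simp add: under_left_def upt_rec numeral_2_eq_2)
next
  case Cap
  have "isotopic k l ([(X Neg, Suc i)] @ [(X Neg, i), (Cap, Suc i)] @ [])
      ([(X Neg, Suc i)] @ [(X (switch Neg), Suc i), (Cap, i)] @ [])"
    using assms Cap by (intro isotopic_planar planar_move.intros) auto
  moreover have "isotopic k l ([] @ [(X Neg, Suc i), (X (switch Neg), Suc i)] @ [(Cap, i)]) ([] @ [(Cap, i)])"
    using assms Cap by (intro isotopic_reidemeister2) auto
  ultimately have "isotopic k l [(X Neg, Suc i), (X Neg, i), (Cap, Suc i)] [(Cap, i)]"
    by (auto intro: isotopic_trans)
  then show ?thesis
    using Cap by (simp add: under_left_def upt_rec numeral_2_eq_2)
next
  case (X c)
  then have "isotopic k l ([] @ [(X c, i), (X Neg, Suc i), (X Neg, i)] @ [])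
      ([] @ [(X Neg, Suc i), (X Neg, i), (X c, Suc i)] @ [])"
    using assms by (intro isotopic_reidemeister3) auto
  then show ?thesis
    using X by (simp add: under_left_def upt_rec numeral_2_eq_2 isotopic_sym)
qed

text \<open>A cable of \<open>n\<close> strands running over \<open>m\<close> others. A tile has
  zero or two ends on either side, so only the widths 0 and 2 occur; the right strand of the cable
  crosses first.\<close>

definition over_right2 :: "nat \<Rightarrow> nat \<Rightarrow> nat \<Rightarrow> diagram" where
  "over_right2 i m n = (if n = 0 then [] else over_right (Suc i) m @ over_right i m)"

lemma inputs_cases: "inputs e = 0 \<or> inputs e = 2" and outputs_cases: "outputs e = 0 \<or> outputs e = 2"
  by (cases e; simp)+

lemma tangle_over_right2: "i + m + n \<le> k \<Longrightarrow> n = 0 \<or> n = 2 \<Longrightarrow> tangle k (over_right2 i m n) k"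
  by (auto simp: over_right2_def tangle_over_right intro: tangle_appendI[OF tangle_over_right])

lemma tangle_under_left: "i + n < k \<Longrightarrow> tangle k (under_left i n) k"
proof (induction n)
  case (Suc n)
  then have "Suc (Suc (k - 2)) = k"
    by simp
  with Suc show ?case
    by (simp add: under_left_def)
qed (simp add: under_left_def)

text \<open>The last crossed strand is seen as passing under the whole cable. This lets a tile on
  the cable be moved past the crossed strands one at a time.\<close>

lemma over_right2_Suc:
  assumes "n = 0 \<or> n = 2" "k = i + m + n + Suc d"
  shows "isotopic k k (over_right2 i (Suc m) n) (over_right2 i m n @ under_left (i + m) n)"
proof (cases "n = 0")
  case False
  then have n: "n = 2"
    using assms by simp
  have "isotopic (Suc (i + m) + (Suc (Suc d))) (Suc (i + m) + (Suc (Suc d)))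
      (shift (Suc (i + m)) [(X Neg, 0)] @ over_right i m) (over_right i m @ shift (Suc (i + m)) [(X Neg, 0)])"
    by (intro isotopic_exchange) (auto simp: tangle_over_right)
  then have "isotopic k k ([(X Neg, Suc (i + m))] @ over_right i m) (over_right i m @ [(X Neg, Suc (i + m))])"
    using assms n by simp
  then have "isotopic k k (over_right (Suc i) m @ ([(X Neg, Suc (i + m))] @ over_right i m) @ [(X Neg, i + m)])
      (over_right (Suc i) m @ (over_right i m @ [(X Neg, Suc (i + m))]) @ [(X Neg, i + m)])"
    by (rule isotopic_context) (use assms n in \<open>auto simp: tangle_over_right\<close>)
  then show ?thesis
    using n by (simp add: over_right2_def over_right_Suc under_left_def upt_rec numeral_2_eq_2)
qed (simp add: over_right2_def under_left_def)

lemma slide_right2: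
  assumes "k = i + m + inputs e + d" "l = i + m + outputs e + d"
  shows "isotopic k l (over_right2 i m (inputs e) @ [(e, i + m)]) ((e, i) # over_right2 i m (outputs e))"
  using assms
proof (induction m arbitrary: d)
  case 0
  then show ?case
    by (simp add: over_right2_def)
next
  case (Suc m)
  have "isotopic k l (over_right2 i (Suc m) (inputs e) @ [(e, i + Suc m)])
      ((over_right2 i m (inputs e) @ under_left (i + m) (inputs e)) @ [(e, i + Suc m)])"
    using Suc.prems inputs_cases by (intro isotopic_append[OF over_right2_Suc[where d = d]]) auto
  also have "isotopic k l \<dots> (over_right2 i m (inputs e) @ ((e, i + m) # under_left (i + m) (outputs e)))"
    using isotopic_prepend[OF slide_left_tile[of k "i + m" e d l] tangle_over_right2[of i m "inputs e" k]]
      Suc.prems inputs_cases[of e] by simp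
  also have "isotopic k l \<dots> (((e, i) # over_right2 i m (outputs e)) @ under_left (i + m) (outputs e))"
    using isotopic_append[OF Suc.IH[of "Suc d"] tangle_under_left[of "i + m" "outputs e" l]] Suc.prems by simp
  also have "isotopic k l \<dots> ([(e, i)] @ over_right2 i (Suc m) (outputs e))"
    using isotopic_prepend[OF isotopic_sym[OF over_right2_Suc[OF outputs_cases, of l i m e d]], of k "[(e, i)]"]
      Suc.prems by simp
  finally show ?case
    by simp
qed

text \<open>
  \<open>spread r\<close> leads from the sorted state, all strands of colour \<open>True\<close> on the left, to the state
  \<open>rev r\<close>, with the strands of colour \<open>True\<close> on top of the others.
\<close>

fun spread :: "bool list \<Rightarrow> diagram" where
  "spread [] = []"
| "spread (b # r) = (if b then over_right (count_list r True) (count_list r False) else []) @ spread r"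

lemma count_True_False: "count_list r True + count_list r False = length r"
  by (induction r) auto

lemma tangle_spread: "length r \<le> k \<Longrightarrow> tangle k (spread r) k"
proof (induction r)
  case (Cons b r)
  then show ?case
    using count_True_False[of r] tangle_over_right[of "count_list r True" "count_list r False" k]
    by (auto intro: tangle_appendI)
qed simp

text \<open>States are reversed: \<open>S\<close> lists the strands left of the tile and
  \<open>R\<close> those right of it. \<open>pos\<close> is the place of the tile in the sorted
  order: behind the \<open>True\<close> strands of \<open>S\<close>, or, if the tile is
  \<open>False\<close>, behind all \<open>True\<close> strands and the \<open>False\<close> ones of
  \<open>S\<close>.\<close>

lemma spread_tile:
  fixes a :: bool
  defines "pos R S \<equiv> (if a then count_list S True else count_list R True + length S)"
  shows "isotopic (length R + inputs e + length S) (length R + outputs e + length S)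
    (spread (R @ replicate (inputs e) a @ S) @ [(e, length S)])
    ((e, pos R S) # spread (R @ replicate (outputs e) a @ S))"
proof (induction R)
  case Nil
  have exch: "isotopic (inputs e + length S) (outputs e + length S) (spread S @ [(e, length S)]) ((e, length S) # spread S)"
    using isotopic_exchange[OF tangle_spread[of S "length S"], of "inputs e" "[(e, 0)]" "outputs e"]
    by (simp add: isotopic_sym add.commute)
  show ?case
  proof (cases a)
    case False
    then have "spread (replicate n a @ S) = spread S" for n
      by (induction n) auto
    then show ?thesis
      using exch False by (simp add: pos_def)
  next
    case True
    have sp: "spread (replicate n True @ S) = over_right2 (count_list S True) (count_list S False) n @ spread S"
      if "n = 0 \<or> n = 2" for n
      using that by (auto simp: over_right2_def numeral_2_eq_2)
    let ?t = "count_list S True" and ?f = "count_list S False"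
    have "isotopic (inputs e + length S) (outputs e + length S)
        (over_right2 ?t ?f (inputs e) @ spread S @ [(e, length S)])
        (over_right2 ?t ?f (inputs e) @ (e, length S) # spread S)"
      using count_True_False[of S] inputs_cases[of e]
      by (intro isotopic_prepend[OF exch] tangle_over_right2) auto
    also have "isotopic (inputs e + length S) (outputs e + length S) \<dots>
        (((e, ?t) # over_right2 ?t ?f (outputs e)) @ spread S)"
      using isotopic_append[OF slide_right2[of "inputs e + length S" ?t ?f e 0 "outputs e + length S"]
        tangle_spread[of S]] count_True_False[of S] by simp
    finally show ?thesis
      using True by (simp add: sp[OF inputs_cases] sp[OF outputs_cases] pos_def)
  qed
next
  case (Cons b R)
  let ?r = "R @ replicate (inputs e) a @ S" and ?r' = "R @ replicate (outputs e) a @ S"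
  let ?k = "length (b # R) + inputs e + length S" and ?l = "length (b # R) + outputs e + length S"
  have IH: "isotopic ?k ?l (spread ?r @ [(e, length S)]) ((e, pos R S) # spread ?r')"
    using isotopic_widen[OF Cons.IH, of 1] by simp
  show ?case
  proof (cases b)
    case False
    then show ?thesis
      using IH by (cases a) (simp_all add: pos_def)
  next
    case True
    let ?over = "\<lambda>r. over_right (count_list r True) (count_list r False)"
    have count: "count_list (replicate n y) x = (if y = x then n else 0)" for n and x y :: bool
      by (induction n) auto
    have len: "count_list R True + count_list R False = length R" "count_list S True + count_list S False = length S"
      by (rule count_True_False)+
    have "tangle ?k (?over ?r) ?k"
      using len by (intro tangle_over_right) (auto simp: count)
    from isotopic_prepend[OF IH this]
    have "isotopic ?k ?l (?over ?r @ spread ?r @ [(e, length S)]) ((?over ?r @ [(e, pos R S)]) @ spread ?r')"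
      by simp
    also have "isotopic ?k ?l \<dots> (((e, pos (b # R) S) # ?over ?r') @ spread ?r')"
    proof (rule isotopic_append)
      show "tangle ?l (spread ?r') ?l"
        by (rule tangle_spread) simp
      show "isotopic ?k ?l (?over ?r @ [(e, pos R S)]) ((e, pos (b # R) S) # ?over ?r')"
      proof (cases a)
        case a: True
        let ?m = "count_list R False + count_list S False"
        have "isotopic (count_list S True + inputs e + count_list R True + Suc ?m)
            (count_list S True + outputs e + count_list R True + Suc ?m)
            (shift (count_list S True + inputs e + count_list R True) (over_right 0 ?m) @ [(e, count_list S True)])
            ((e, count_list S True) # shift (count_list S True + outputs e + count_list R True) (over_right 0 ?m))"
          by (intro isotopic_exchange_tile[OF tangle_over_right]) auto
        moreover have "count_list S True + n + count_list R True + Suc ?m = length (b # R) + n + length S" for n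
          using len by simp
        ultimately show ?thesis
          using a by (simp add: pos_def count ac_simps)
      next
        \<comment> \<open>The \<open>True\<close> strand added at the far right has to run over the
          tile.\<close>
        case a: False
        let ?i = "count_list R True + count_list S True"
        have "isotopic ?k ?l (over_right ?i (count_list S False + inputs e + count_list R False) @ [(e, ?i + count_list S False)])
          ((e, Suc (?i + count_list S False)) # over_right ?i (count_list S False + outputs e + count_list R False))"
          using len by (intro slide_right[where d = 0]) auto
        moreover have "pos R S = ?i + count_list S False" "pos (b # R) S = Suc (?i + count_list S False)"
          using a True len by (auto simp: pos_def)
        ultimately show ?thesis
          using a by (simp add: count ac_simps)
      qed
    qed
    finally show ?thesis
      using True by simp
  qed
qed

text \<open>The added crossing is one more overcrossing of a \<open>True\<close> strand, and
  \<open>spread\<close> of the exchanged state already contains it; only heights differ.\<close>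

lemma spread_mixed:
  "isotopic (length R + 2 + length S) (length R + 2 + length S)
    (spread (R @ False # True # S) @ [(X Neg, length S)]) (spread (R @ True # False # S))"
proof (induction R)
  case Nil
  let ?o = "over_right (count_list S True) (count_list S False)"
  have "isotopic (length S + 2) (length S + 2) (spread S @ [(X Neg, length S)]) ((X Neg, length S) # spread S)"
    using isotopic_exchange[OF tangle_spread[of S "length S"], of 2 "[(X Neg, 0)]" 2] by (simp add: isotopic_sym)
  then have "isotopic (length S + 2) (length S + 2) (?o @ spread S @ [(X Neg, length S)]) (?o @ (X Neg, length S) # spread S)"
    by (rule isotopic_prepend) (use count_True_False[of S] in \<open>auto intro!: tangle_over_right\<close>)
  then show ?case
    using count_True_False[of S] by (simp add: over_right_Suc add.commute)
next
  case (Cons b R)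
  let ?r = "R @ False # True # S"
  let ?k = "length (b # R) + 2 + length S"
  have "isotopic ?k ?k (spread ?r @ [(X Neg, length S)]) (spread (R @ True # False # S))"
    using isotopic_widen[OF Cons.IH, of 1] by simp
  then have "isotopic ?k ?k (over_right (count_list ?r True) (count_list ?r False) @ spread ?r @ [(X Neg, length S)])
      (over_right (count_list ?r True) (count_list ?r False) @ spread (R @ True # False # S))"
    by (rule isotopic_prepend)
      (use count_True_False[of R] count_True_False[of S] in \<open>auto intro!: tangle_over_right simp: count_list_append\<close>)
  with isotopic_widen[OF Cons.IH, of 1] show ?case
    by (simp add: count_list_append)
qed

lemma spread_mixed':
  "isotopic (length R + 2 + length S) (length R + 2 + length S)
    (spread (R @ True # False # S) @ [(X Pos, length S)]) (spread (R @ False # True # S))"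
proof -
  let ?k = "length R + 2 + length S"
  have "isotopic ?k ?k (spread (R @ True # False # S) @ [(X Pos, length S)])
      ((spread (R @ False # True # S) @ [(X Neg, length S)]) @ [(X Pos, length S)])"
    by (rule isotopic_append[OF isotopic_sym[OF spread_mixed]]) simp
  also have "isotopic ?k ?k \<dots> (spread (R @ False # True # S))"
    using isotopic_reidemeister2[of ?k "spread (R @ False # True # S)" Neg "length S" "[]" ?k]
      tangle_appendI[OF tangle_spread[of "R @ False # True # S" ?k], of "[(X Neg, length S), (X Pos, length S)]" ?k]
    by simp
  finally show ?thesis .
qed

section \<open>Switching crossings of differently coloured strands\<close>

definition mixed_switch :: "diagram \<Rightarrow> diagram \<Rightarrow> bool" where
  "mixed_switch L L' \<longleftrightarrow> (\<exists>u v A B a b c. reach [] u (A @ a # b # B) \<and> reach (A @ b # a # B) v [] \<and> a \<noteq> b \<and>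
     L = u @ [(X c, length A)] @ v \<and> L' = u @ [(X (switch c), length A)] @ v)"

lemma mixed_switchI:
  assumes "reach [] u (A @ a # b # B)" "reach (A @ b # a # B) v []" "a \<noteq> b"
  shows "mixed_switch (u @ [(X c, length A)] @ v) (u @ [(X (switch c), length A)] @ v)"
  using assms unfolding mixed_switch_def by blast

text \<open>A counterpart of link homotopy, with crossing changes between different components in
  place of changes at self-crossings.\<close>

definition mixed_homotopic :: "diagram \<Rightarrow> diagram \<Rightarrow> bool" where
  "mixed_homotopic = equivclp (sup (isotopy_step 0 0) mixed_switch)"

lemma mixed_homotopic_refl [simp]: "mixed_homotopic L L"
  by (simp add: mixed_homotopic_def)

lemma mixed_homotopic_trans [trans]:
  "mixed_homotopic L L' \<Longrightarrow> mixed_homotopic L' L'' \<Longrightarrow> mixed_homotopic L L''"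
  unfolding mixed_homotopic_def by (rule equivclp_trans)

lemma mixed_switch_homotopic: "mixed_switch L L' \<Longrightarrow> mixed_homotopic L L'"
  by (auto simp: mixed_homotopic_def)

lemma isotopic_mixed_homotopic: "isotopic 0 0 L L' \<Longrightarrow> mixed_homotopic L L'"
  unfolding isotopic_def
proof (induction rule: equivclp_induct)
  case (step y z)
  then have "mixed_homotopic y z"
    by (auto simp: mixed_homotopic_def)
  with step.IH show ?case
    by (rule mixed_homotopic_trans)
qed simp

lemma mixed_homotopic_induct [consumes 1, case_names refl isotopy switch]:
  assumes "mixed_homotopic L L'" "P L"
    and "\<And>y z. mixed_homotopic L y \<Longrightarrow> P y \<Longrightarrow> isotopic 0 0 y z \<Longrightarrow> P z"
    and "\<And>y z. mixed_homotopic L y \<Longrightarrow> P y \<Longrightarrow> mixed_switch y z \<Longrightarrow> P z"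
  shows "P L'"
  using assms(1) unfolding mixed_homotopic_def
proof (induction rule: equivclp_induct)
  case (step y z)
  have "isotopic 0 0 y z" if "isotopy_step 0 0 y z \<or> isotopy_step 0 0 z y"
    using that by (auto simp: isotopic_def)
  moreover have "mixed_switch y z" if zy: "mixed_switch z y"
  proof -
    obtain u v A B a b c where *: "reach [] u (A @ a # b # B)" "reach (A @ b # a # B) v []" "a \<noteq> b"
        "z = u @ [(X c, length A)] @ v" "y = u @ [(X (switch c), length A)] @ v"
      using zy unfolding mixed_switch_def by blast
    have "switch (switch c) = c"
      by (cases c) auto
    then show ?thesis
      using mixed_switchI[OF *(1-3), of "switch c"] *(4,5) by simp
  qed
  ultimately show ?case
    using step assms(3,4)[of y z] unfolding mixed_homotopic_def by (auto simp: sup_fun_def)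
qed (rule assms(2))

lemma mixed_switch_tangle: "mixed_switch y z \<Longrightarrow> tangle 0 y 0 \<and> tangle 0 z 0"
  unfolding mixed_switch_def
proof (elim exE conjE)
  fix u v A B c and a b :: bool
  assume *: "reach [] u (A @ a # b # B)" "reach (A @ b # a # B) v []"
    "y = u @ [(X c, length A)] @ v" "z = u @ [(X (switch c), length A)] @ v"
  have "reach [] (u @ [(X c, length A)] @ v) []" for c
    using * by (intro reach_appendI[OF *(1)]) (auto simp: col_step_append)
  then show ?thesis
    unfolding *(3,4) using reach_tangle by fastforce
qed

lemma mixed_homotopic_closed: "mixed_homotopic L L' \<Longrightarrow> tangle 0 L 0 \<Longrightarrow> tangle 0 L' 0"
  by (induction rule: mixed_homotopic_induct) (auto simp: isotopic_tangle dest: mixed_switch_tangle)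

lemma mixed_homotopic_link:
  assumes "mixed_homotopic L L'" "link_diagram L"
  shows "link_diagram L'"
  using assms
proof (induction rule: mixed_homotopic_induct)
  case (isotopy y z)
  then show ?case
    using isotopic_tangle isotopic_empty unfolding link_diagram_def by blast
next
  case (switch y z)
  then show ?case
    using mixed_switch_tangle[of y z] by (auto simp: link_diagram_def mixed_switch_def)
qed

lemma mixed_homotopic_components:
  assumes "mixed_homotopic L L'" "tangle 0 L 0"
  shows "num_components L' = num_components L"
proof -
  have "runs [] L' [] = runs [] L []"
    using assms(1)
  proof (induction rule: mixed_homotopic_induct)
    case (isotopy y z)
    then show ?case
      using runs_isotopic[of 0 0 y z "[]" "[]"] by simp
  next
    case (switch y z)
    then show ?case
      unfolding mixed_switch_def using runs_switch by metis
  qed simp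
  then show ?thesis
    using assms mixed_homotopic_closed by (simp add: runs_num_components)
qed

text \<open>Allows a colouring of one closed word to be extended over closed words stacked below and
  above it.\<close>

lemma reach_constant:
  "tangle k w l \<Longrightarrow> reach (replicate k b) w (replicate l b)"
proof (induction w arbitrary: k)
  case (Cons x w)
  obtain e p where x: "x = (e, p)" by (cases x)
  obtain d where d: "k = p + inputs e + d" "tangle (p + outputs e + d) w l"
    using Cons.prems unfolding x by (rule tangle_ConsE)
  have "col_step (e, 0) (replicate (inputs e) b @ replicate d b) (replicate (outputs e) b @ replicate d b)"
    by (cases e) (auto simp: numeral_2_eq_2)
  then have "col_step x (replicate k b) (replicate (p + outputs e + d) b)"
    using col_step_append[of e "replicate p b" "replicate (inputs e) b @ replicate d b"] d(1) x
    by (simp add: replicate_add)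
  with Cons.IH[OF d(2)] show ?case
    by auto
qed simp

lemma mixed_homotopic_context:
  assumes "mixed_homotopic L L'" "tangle 0 P 0" "tangle 0 Q 0"
  shows "mixed_homotopic (P @ L @ Q) (P @ L' @ Q)"
  using assms(1)
proof (induction rule: mixed_homotopic_induct)
  case (isotopy y z)
  have "isotopic 0 0 (P @ y @ Q) (P @ z @ Q)"
    using isotopy.hyps(2) assms by (intro isotopic_context) auto
  with isotopy.IH show ?case
    using isotopic_mixed_homotopic mixed_homotopic_trans by blast
next
  case (switch y z)
  have PQ: "reach [] P []" "reach [] Q []"
    using reach_constant[of 0 P 0] reach_constant[of 0 Q 0] assms by auto
  obtain u v A B a b c where *: "reach [] u (A @ a # b # B)" "reach (A @ b # a # B) v []" "a \<noteq> b"
      "y = u @ [(X c, length A)] @ v" "z = u @ [(X (switch c), length A)] @ v"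
    using switch.hyps(2) unfolding mixed_switch_def by blast
  have "reach [] (P @ u) (A @ a # b # B)" "reach (A @ b # a # B) (v @ Q) []"
    using PQ *(1,2) by (auto intro: reach_appendI)
  then have "mixed_switch (P @ y @ Q) (P @ z @ Q)"
    using mixed_switchI[of "P @ u" A a b B "v @ Q" c] *(3-5) by simp
  with switch.IH show ?case
    using mixed_switch_homotopic mixed_homotopic_trans by blast
qed simp

lemma col_step_cases:
  assumes "col_step (e, p) s s'"
  obtains (same) A B a where "length A = p" "s = A @ replicate (inputs e) a @ B" "s' = A @ replicate (outputs e) a @ B"
  | (mixed) A B a b c where "length A = p" "e = X c" "a \<noteq> b" "s = A @ a # b # B" "s' = A @ b # a # B"
proof -
  have "p \<le> length s"
    using col_step_length[OF assms] by simp
  define A where "A = take p s"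
  define r where "r = drop p s"
  have A: "s = A @ r" "length A = p"
    using \<open>p \<le> length s\<close> by (simp_all add: A_def r_def)
  then obtain r' where r': "s' = A @ r'" "col_step (e, 0) r r'"
    using assms col_step_append[of e A r s'] by auto
  show thesis
  proof (cases e)
    case Cup
    with r' A same[of A _ r] show thesis
      by (auto simp: numeral_2_eq_2)
  next
    case Cap
    with r' A same[of A _ r'] show thesis
      by (auto simp: numeral_2_eq_2)
  next
    case (X c)
    then obtain x y t where xy: "r = x # y # t" "r' = y # x # t"
      using r' by auto
    show thesis
    proof (cases "x = y")
      case True
      with X xy r' A same[of A x t] show thesis
        by (simp add: numeral_2_eq_2)
    next
      case False
      with X xy r' A mixed[of A c x y t] show thesis
        by simp
    qed
  qed
qed

lemma count_list_replicate: "count_list (replicate n y) x = (if y = x then n else 0)"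
  by (induction n) auto

text \<open>
  Sorting the strands by colour at every level turns the word into a closed word \<open>P\<close> in the
  strands of colour \<open>True\<close> and a closed word \<open>Q\<close> in the others.
\<close>

lemma sorted_word:
  assumes "run [] w c s"
  shows "\<exists>P Q. tangle 0 P (count_list s True) \<and> tangle 0 Q (count_list s False) \<and>
    (\<forall>v. reach s v [] \<longrightarrow>
      mixed_homotopic (w @ v) (P @ shift (count_list s True) Q @ spread (rev s) @ v)) \<and>
    ((\<exists>r \<in> set c. True \<in> set r) \<longrightarrow> P \<noteq> []) \<and> ((\<exists>r \<in> set c. False \<in> set r) \<longrightarrow> Q \<noteq> [])"
  using assms
proof (induction w arbitrary: c s rule: rev_induct)
  case Nil
  then show ?case
    by (intro exI[of _ "[]"]) simp
next
  case (snoc x w c' s')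
  obtain e p where x: "x = (e, p)" by (cases x)
  obtain c s where c: "c' = c @ [s']" "run [] w c s" "col_step (e, p) s s'"
    using snoc.prems x by (auto simp: run_append)
  let ?k = "count_list s True" and ?m = "count_list s False"
  let ?k' = "count_list s' True" and ?m' = "count_list s' False"
  obtain P Q where P: "tangle 0 P ?k" and Q: "tangle 0 Q ?m"
    and PQ: "\<And>v. reach s v [] \<Longrightarrow> mixed_homotopic (w @ v) (P @ shift ?k Q @ spread (rev s) @ v)"
    and P0: "(\<exists>r \<in> set c. True \<in> set r) \<Longrightarrow> P \<noteq> []" and Q0: "(\<exists>r \<in> set c. False \<in> set r) \<Longrightarrow> Q \<noteq> []"
    using snoc.IH[OF c(2)] by blast
  have reach_w: "reach [] w s"
    using c(2) by (auto simp: reach_def)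
  have tPQ: "tangle 0 (P @ shift ?k Q) (?k + ?m)"
    using tangle_appendI[OF P] tangle_shift[OF Q, of ?k] by simp
  have len: "?k + ?m = length s" "?k' + ?m' = length s'"
    by (rule count_True_False)+
  have nonempty: "count_list r a \<noteq> 0 \<longleftrightarrow> a \<in> set r" for r and a :: bool
    by (simp add: count_list_0_iff)
  show ?case
    using c(3)
  proof (cases rule: col_step_cases)
    case (same A B a)
    define q where "q = (if a then count_list A True else count_list (rev B) True + length A)"
    have rev: "rev s = rev B @ replicate (inputs e) a @ rev A" "rev s' = rev B @ replicate (outputs e) a @ rev A"
      using same by simp_all
    have main: "mixed_homotopic ((w @ [x]) @ v) (P @ shift ?k Q @ (e, q) # spread (rev s') @ v)"
      if v: "reach s' v []" for v
    proof -
      have "mixed_homotopic (w @ [x] @ v) (P @ shift ?k Q @ spread (rev s) @ [x] @ v)"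
        using v c(3) x by (intro PQ) auto
      moreover have "isotopic (length s) (length s') (spread (rev s) @ [x]) ((e, q) # spread (rev s'))"
        using spread_tile[of "rev B" e "rev A" a] same x unfolding rev by (cases a) (simp_all add: q_def ac_simps)
      then have "isotopic 0 0 ((P @ shift ?k Q) @ (spread (rev s) @ [x]) @ v)
          ((P @ shift ?k Q) @ ((e, q) # spread (rev s')) @ v)"
        by (rule isotopic_context) (use tPQ len reach_tangle[OF v] in auto)
      ultimately show ?thesis
        using isotopic_mixed_homotopic mixed_homotopic_trans by fastforce
    qed
    show ?thesis
    proof (cases a)
      case True
      have k: "?k = q + inputs e + count_list B True" "?k' = q + outputs e + count_list B True" "?m' = ?m"
        using same True by (simp_all add: q_def count_list_replicate)
      have P': "tangle 0 (P @ [(e, q)]) ?k'"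
        using k by (intro tangle_appendI[OF P]) simp
      have "mixed_homotopic ((w @ [x]) @ v) ((P @ [(e, q)]) @ shift ?k' Q @ spread (rev s') @ v)"
        if v: "reach s' v []" for v
      proof -
        \<comment> \<open>The tile descends on the left of all of \<open>Q\<close> to join
          \<open>P\<close>.\<close>
        have "isotopic (?k + 0) (?k' + ?m) (shift ?k Q @ [(e, q)]) ((e, q) # shift ?k' Q)"
          using k(1,2) by (rule isotopic_exchange_tile[OF Q])
        then have "isotopic 0 0 (P @ (shift ?k Q @ [(e, q)]) @ spread (rev s') @ v)
            (P @ ((e, q) # shift ?k' Q) @ spread (rev s') @ v)"
          by (rule isotopic_context)
            (use P k len reach_tangle[OF v] in \<open>auto intro!: tangle_appendI[OF tangle_spread]\<close>)
        from mixed_homotopic_trans[OF main[OF v] isotopic_mixed_homotopic] this show ?thesis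
          by simp
      qed
      moreover have "Q \<noteq> []" if "False \<in> set s'"
        using that nonempty[of s' False] Q k by auto
      ultimately show ?thesis
        using P' Q k(3) Q0 c(1) by (intro exI[of _ "P @ [(e, q)]"] exI[of _ Q]) auto
    next
      case False
      define q' where "q' = count_list A False"
      have k: "?k' = ?k" "?m = q' + inputs e + count_list B False" "?m' = q' + outputs e + count_list B False"
        "q = ?k + q'"
        using same False count_True_False[of A] by (simp_all add: q_def q'_def count_list_replicate)
      have Q': "tangle 0 (Q @ [(e, q')]) ?m'"
        using k by (intro tangle_appendI[OF Q]) simp
      have "mixed_homotopic ((w @ [x]) @ v) (P @ shift ?k' (Q @ [(e, q')]) @ spread (rev s') @ v)"
        if v: "reach s' v []" for v
        using main[OF v] k(1,4) by (simp add: add.commute)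
      moreover have "P \<noteq> []" if "True \<in> set s'"
        using that nonempty[of s' True] P k by auto
      ultimately show ?thesis
        using P Q' k(1) P0 c(1) by (intro exI[of _ P] exI[of _ "Q @ [(e, q')]"]) auto
    qed
  next
    case (mixed A B a b d)
    \<comment> \<open>\<open>a\<close> is the colour of the strand arriving from the left, so
      \<open>d'\<close> is the type that puts the \<open>True\<close> strand on top, as
      \<open>spread\<close> requires.\<close>
    define d' where "d' = (if a then Neg else Pos)"
    have iso: "isotopic (length s') (length s') (spread (rev s) @ [(X d', p)]) (spread (rev s'))"
      using spread_mixed[of "rev B" "rev A"] spread_mixed'[of "rev B" "rev A"] mixed
      by (cases a; cases b) (auto simp: d'_def ac_simps)
    have k: "?k' = ?k" "?m' = ?m" "length s = length s'"
      using mixed by simp_all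
    have "mixed_homotopic ((w @ [x]) @ v) (P @ shift ?k' Q @ spread (rev s') @ v)" if v: "reach s' v []" for v
    proof -
      have "mixed_homotopic (w @ [x] @ v) (w @ [(X d', p)] @ v)"
      proof (cases "d' = d")
        case False
        then have "d' = switch d"
          by (cases d; cases d') auto
        then show ?thesis
          using mixed_switchI[of w A a b B v d] reach_w v mixed x by (auto intro: mixed_switch_homotopic)
      qed (simp add: x mixed)
      also have "mixed_homotopic \<dots> (P @ shift ?k Q @ spread (rev s) @ [(X d', p)] @ v)"
        using v c(3) mixed(2) col_step_crossing[of d p d'] by (intro PQ) auto
      also have "mixed_homotopic \<dots> (P @ shift ?k Q @ spread (rev s') @ v)"
      proof -
        have "isotopic 0 0 ((P @ shift ?k Q) @ (spread (rev s) @ [(X d', p)]) @ v) ((P @ shift ?k Q) @ spread (rev s') @ v)"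
          using iso by (rule isotopic_context) (use tPQ k len reach_tangle[OF v] in auto)
        then show ?thesis
          using isotopic_mixed_homotopic by simp
      qed
      finally show ?thesis
        using k by simp
    qed
    moreover have "P \<noteq> []" if "True \<in> set s'"
      using that nonempty[of s' True] P k by auto
    moreover have "Q \<noteq> []" if "False \<in> set s'"
      using that nonempty[of s' False] Q k by auto
    ultimately show ?thesis
      using P Q k P0 Q0 c(1) by (intro exI[of _ P] exI[of _ Q]) auto
  qed
qed

text \<open>At the closed top the state is empty and \<open>spread\<close> contributes nothing. Both
  colours occur, so neither half is the empty word.\<close>

lemma split_link:
  assumes "tangle 0 L 0" "num_components L \<ge> 2"
  obtains P Q where "link_diagram P" "link_diagram Q" "mixed_homotopic L (P @ Q)"
proof -
  obtain c where c: "run [] L c []" "\<And>b. \<exists>s \<in> set c. b \<in> set s"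
    using two_colours[OF assms] by blast
  obtain P Q where "tangle 0 P 0" "tangle 0 Q 0" "P \<noteq> []" "Q \<noteq> []"
    "\<And>v. reach [] v [] \<Longrightarrow> mixed_homotopic (L @ v) (P @ shift 0 Q @ spread (rev []) @ v)"
    using sorted_word[OF c(1)] c(2) by auto
  then show thesis
    using that[of P Q] by (force simp: link_diagram_def dest: spec[of _ "[]"])
qed

text \<open>Between two closed words the only state is the empty one, so the numbers of colourings
  multiply.\<close>

lemma num_components_append:
  assumes "tangle 0 P 0" "tangle 0 Q 0"
  shows "num_components (P @ Q) = num_components P + num_components Q"
proof -
  have "tangle 0 (P @ Q) 0"
    using assms by (rule tangle_appendI)
  moreover have "states 0 = {[]}"
    by auto
  ultimately have "2 ^ num_components (P @ Q) = (2 :: nat) ^ (num_components P + num_components Q)"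
    using runs_append[of "[]" P 0 Q "[]"] assms by (simp add: power_add flip: runs_num_components)
  then show ?thesis
    by simp
qed

lemma mixed_homotopic_knots:
  assumes "link_diagram L"
  shows "\<exists>Ks. Ks \<noteq> [] \<and> (\<forall>K \<in> set Ks. knot_diagram K) \<and> mixed_homotopic L (concat Ks)"
  using assms
proof (induction "num_components L" arbitrary: L rule: less_induct)
  case less
  then have L: "tangle 0 L 0"
    by (simp add: link_diagram_def)
  show ?case
  proof (cases "num_components L \<ge> 2")
    case True
    then obtain P Q where PQ: "link_diagram P" "link_diagram Q" "mixed_homotopic L (P @ Q)"
      using split_link[OF L] by blast
    then have t: "tangle 0 P 0" "tangle 0 Q 0"
      by (simp_all add: link_diagram_def)
    have "num_components L = num_components P + num_components Q"
      using mixed_homotopic_components[OF PQ(3) L] num_components_append[OF t] by simp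
    then have "num_components P < num_components L" "num_components Q < num_components L"
      using num_components_pos[OF PQ(1)] num_components_pos[OF PQ(2)] by simp_all
    then obtain Ks Js where *: "Ks \<noteq> []" "\<forall>K \<in> set Ks. knot_diagram K" "mixed_homotopic P (concat Ks)"
      "\<forall>K \<in> set Js. knot_diagram K" "mixed_homotopic Q (concat Js)"
      using less.hyps PQ by meson
    note PQ(3)
    also have "mixed_homotopic (P @ Q) (concat Ks @ Q)"
      using mixed_homotopic_context[OF *(3) _ t(2), of "[]"] by simp
    also have "mixed_homotopic \<dots> (concat Ks @ concat Js)"
      using mixed_homotopic_context[OF *(5) mixed_homotopic_closed[OF *(3) t(1)], of "[]"] by simp
    finally show ?thesis
      using * by (intro exI[of _ "Ks @ Js"]) auto
  next
    case False
    then have "knot_diagram L"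
      using num_components_pos[OF less.prems] less.prems by (simp add: knot_diagram_def)
    then show ?thesis
      by (intro exI[of _ "[L]"]) simp
  qed
qed

lemma num_components_knots:
  assumes "\<forall>K \<in> set Ks. knot_diagram K" "Ks \<noteq> []"
  shows "num_components (concat Ks) = length Ks \<and> link_diagram (concat Ks)"
  using assms(2,1)
proof (induction Ks rule: list_nonempty_induct)
  case (cons K Ks)
  then show ?case
    by (auto simp: num_components_append knot_diagram_def link_diagram_def intro: tangle_appendI)
qed (simp add: knot_diagram_def)


section \<open>Uniqueness\<close>

lemma mixed_components:
  assumes u: "reach [] u (A @ a # b # B)" and v: "reach (A @ b # a # B) v []" and ab: "a \<noteq> b"
  defines "i \<equiv> length A"
  shows "link_diagram (u @ [(X c, i)] @ v)" "link_diagram (u @ [(Cap, i), (Cup, i)] @ v)" "link_diagram (u @ v)"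
    and "num_components (u @ [(X c, i)] @ v) = Suc (num_components (u @ v))"
    and "num_components (u @ [(Cap, i), (Cup, i)] @ v) = num_components (u @ v)"
proof -
  have "u \<noteq> []"
    using u by auto
  have t: "tangle 0 u (length A + 2 + length B)" "tangle (length A + 2 + length B) v 0"
    using reach_tangle[OF u] reach_tangle[OF v] by simp_all
  then have tangle: "tangle 0 (u @ [(X c, i)] @ v) 0" "tangle 0 (u @ [(Cap, i), (Cup, i)] @ v) 0" "tangle 0 (u @ v) 0"
    by (simp_all add: tangle_append_iff[OF t(1)] i_def)
  with \<open>u \<noteq> []\<close> show "link_diagram (u @ [(X c, i)] @ v)" "link_diagram (u @ [(Cap, i), (Cup, i)] @ v)"
    "link_diagram (u @ v)"
    by (simp_all add: link_diagram_def)
  have "(2 :: nat) ^ num_components (u @ [(X c, i)] @ v) = 2 ^ Suc (num_components (u @ v))"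
    using runs_mixed(1)[OF u v ab, of c] tangle by (simp add: i_def runs_num_components)
  then show "num_components (u @ [(X c, i)] @ v) = Suc (num_components (u @ v))"
    by (rule power_inject_exp[THEN iffD1, rotated]) simp
  have "(2 :: nat) ^ num_components (u @ [(Cap, i), (Cup, i)] @ v) = 2 ^ num_components (u @ v)"
    using runs_mixed(2)[OF u v ab] tangle by (simp add: i_def runs_num_components)
  then show "num_components (u @ [(Cap, i), (Cup, i)] @ v) = num_components (u @ v)"
    by (rule power_inject_exp[THEN iffD1, rotated]) simp
qed

lemma mixed_skein_unique:
  fixes H :: "diagram \<Rightarrow> laurent"
  assumes inv: "\<And>w w'. link_diagram w \<Longrightarrow> isotopic 0 0 w w' \<Longrightarrow> H w = H w'"
    and skein: "\<And>u v A B a b. reach [] u (A @ a # b # B) \<Longrightarrow> reach (A @ b # a # B) v [] \<Longrightarrow> a \<noteq> b \<Longrightarrow>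
      H (u @ [(X Pos, length A)] @ v) - H (u @ [(X Neg, length A)] @ v) =
      \<zeta> * (H (u @ [(Cap, length A), (Cup, length A)] @ v) - H (u @ v))"
    and knots: "\<And>Ks. Ks \<noteq> [] \<Longrightarrow> \<forall>K \<in> set Ks. knot_diagram K \<Longrightarrow> H (concat Ks) = 0"
    and L: "link_diagram L"
  shows "H L = 0"
  using L
proof (induction "num_components L" arbitrary: L rule: less_induct)
  case less
  obtain Ks where Ks: "Ks \<noteq> []" "\<forall>K \<in> set Ks. knot_diagram K" "mixed_homotopic L (concat Ks)"
    using mixed_homotopic_knots[OF less.prems] by blast
  have L0: "tangle 0 L 0"
    using less.prems by (simp add: link_diagram_def)
  have "H (concat Ks) = H L"
    using Ks(3)
  proof (induction rule: mixed_homotopic_induct)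
    case (isotopy y z)
    then show ?case
      using inv[of y z] mixed_homotopic_link less.prems by simp
  next
    case (switch y z)
    obtain u v A B a b c where *: "reach [] u (A @ a # b # B)" "reach (A @ b # a # B) v []" "a \<noteq> b"
      "y = u @ [(X c, length A)] @ v" "z = u @ [(X (switch c), length A)] @ v"
      using switch.hyps(2) unfolding mixed_switch_def by blast
    note mixed = mixed_components[OF *(1-3)]
    have "num_components y = num_components L"
      using switch.hyps(1) L0 by (rule mixed_homotopic_components)
    \<comment> \<open>Each smoothing has one component less than \<open>L\<close>.\<close>
    then have "H (u @ v) = 0" "H (u @ [(Cap, length A), (Cup, length A)] @ v) = 0"
      using mixed * less.hyps by simp_all
    then have "H (u @ [(X Pos, length A)] @ v) = H (u @ [(X Neg, length A)] @ v)"
      using skein[OF *(1-3)] by simp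
    then have "H y = H z"
      using *(4,5) by (cases c) simp_all
    then show ?case
      using switch.IH by simp
  qed simp
  then show ?case
    using knots[OF Ks(1,2)] by simp
qed

section \<open>Rescaling and specialisation of \<open>D[T]\<close>\<close>

locale split_invariant =
  fixes T DT :: "diagram \<Rightarrow> laurent"
  assumes T: "is_T T" and DT: "is_DT T DT"
begin

lemma DT_isotopic: "link_diagram w \<Longrightarrow> isotopic 0 0 w w' \<Longrightarrow> DT w = DT w'"
  using invariant_isotopic DT by (auto simp: is_DT_def)

lemma DT_skein:
  assumes u: "reach [] u (A @ a # b # B)" and v: "reach (A @ b # a # B) v []" and ab: "a \<noteq> b"
  shows "DT (u @ [(X Pos, length A)] @ v) - DT (u @ [(X Neg, length A)] @ v) =
      ipow iz 1 * (DT (u @ [(Cap, length A), (Cup, length A)] @ v) - DT (u @ v))"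
proof -
  have "conway_quadruple u (length A) v (u @ [(X Pos, length A)] @ v) (u @ [(X Neg, length A)] @ v)
      (u @ [(Cap, length A), (Cup, length A)] @ v) (u @ v)"
    using mixed_components(1)[OF u v ab] by (simp add: conway_quadruple_def)
  then show ?thesis
    using mixed_crossingI[OF u v ab, of Pos] DT unfolding is_DT_def by blast
qed

lemma DT_knots:
  assumes "Ks \<noteq> []" "\<forall>K \<in> set Ks. knot_diagram K"
  shows "DT (concat Ks) = ipow iE (1 - int (length Ks)) * T (concat Ks)"
proof -
  have "unlinked_knots (length Ks) (concat Ks)"
    using assms num_components_knots[OF assms(2,1)] by (auto simp: unlinked_knots_def link_equivalent_def)
  moreover have "length Ks \<ge> 1"
    using assms(1) by (cases Ks) auto
  ultimately show ?thesis
    using DT unfolding is_DT_def by blast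
qed

lemma num_components_isotopic:
  "link_diagram w \<Longrightarrow> isotopic 0 0 w w' \<Longrightarrow> num_components w' = num_components w"
  using mixed_homotopic_components isotopic_mixed_homotopic by (auto simp: link_diagram_def)

text \<open>\<open>E^(1-n)\<close> takes one value on both crossings and one on both smoothings, so
  it satisfies the mixed relation with zero on either side.\<close>

lemma at_a_1_DT:
  assumes L: "link_diagram L"
  shows "at_a_1 (DT L) = ipow iE (1 - int (num_components L))"
proof -
  define H where "H L = at_a_1 (DT L) - ipow iE (1 - int (num_components L))" for L
  have "H L = 0"
  proof (rule mixed_skein_unique[where \<zeta> = "ipow iz 1", OF _ _ _ L])
    show "H w = H w'" if "link_diagram w" "isotopic 0 0 w w'" for w w'
      using DT_isotopic[OF that] num_components_isotopic[OF that] by (simp add: H_def)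
    show "H (u @ [(X Pos, length A)] @ v) - H (u @ [(X Neg, length A)] @ v) =
        ipow iz 1 * (H (u @ [(Cap, length A), (Cup, length A)] @ v) - H (u @ v))"
      if "reach [] u (A @ a # b # B)" "reach (A @ b # a # B) v []" "a \<noteq> b" for u v A B a b
    proof -
      have "at_a_1 (ipow iz 1) = ipow iz 1"
        by (simp add: at_a_1_def subst_frag_of ipow_def)
      then show ?thesis
        using arg_cong[OF DT_skein[OF that], of at_a_1] mixed_components[OF that]
        by (simp add: H_def at_a_1_def subst_diff subst_mult)
    qed
    show "H (concat Ks) = 0" if "Ks \<noteq> []" "\<forall>K \<in> set Ks. knot_diagram K" for Ks
    proof -
      have "num_components (concat Ks) = length Ks" "link_diagram (concat Ks)"
        using num_components_knots[OF that(2,1)] by simp_all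
      then show ?thesis
        using DT_knots[OF that] at_a_1_T[OF T, of "concat Ks"]
        by (simp add: H_def at_a_1_def subst_mult subst_frag_of ipow_def frag_extend_cmul)
    qed
  qed
  then show ?thesis
    by (simp add: H_def)
qed

lemma DT_rescale:
  assumes L: "link_diagram L"
  shows "DT L = (ipow iz 1 * ipow iw (-1)) ^ (num_components L - 1) * hat_subst (DD_of DT L)"
proof -
  \<comment> \<open>The two successive substitutions amount to one, which fixes \<open>w\<close> and
    \<open>a\<close> and therefore every value of \<open>T\<close>.\<close>
  define \<sigma> where "\<sigma> = (\<lambda>x. frag_extend (frag_of(iz := frag_of iw, iE := frag_of iE + frag_of iz - frag_of iw))
    ((frag_of(iw := frag_of iz)) x))"
  have \<sigma>_subst: "hat_subst (DD_of DT L) = subst \<sigma> (DT L)" for L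
    by (simp only: hat_subst_def DD_of_def subst_subst \<sigma>_def)
  have \<sigma>: "\<sigma> iz = frag_of iw" "\<sigma> iw = frag_of iw" "\<sigma> ia = frag_of ia" "\<sigma> iE = frag_of iE + frag_of iz - frag_of iw"
    by (simp_all add: \<sigma>_def)
  define q where "q = ipow iz 1 * ipow iw (-1)"
  have q_w: "q * ipow iw 1 = ipow iz 1"
    using ipow_inverse[of iw 1] by (simp add: q_def mult.assoc mult.commute[of "ipow iw (-1)"])
  \<comment> \<open>Here \<open>n\<close> stands for the number of components minus one; the power
    of \<open>z / w\<close> coming from the new \<open>E\<close> cancels that of
    \<open>q\<close>.\<close>
  have q_power: "q ^ n * subst \<sigma> (ipow iE (- int n)) = ipow iE (- int n)" for n
  proof -
    have "q = frag_of (frag_of iz - frag_of iw)"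
      by (simp add: q_def ipow_def frag_of_mult)
    then have "q ^ n = frag_of (frag_cmul (int n) (frag_of iz - frag_of iw))"
    proof (induction n)
      case (Suc n)
      then show ?case
        by (simp add: frag_of_mult frag_cmul_distrib)
    qed simp
    moreover have "frag_cmul (int n) (frag_of iz - frag_of iw) +
        frag_cmul (- int n) (frag_of iE + frag_of iz - frag_of iw) = frag_cmul (- int n) (frag_of iE)"
      by (rule poly_mapping_eqI) (simp add: lookup_add lookup_minus algebra_simps)
    ultimately show ?thesis
      unfolding subst_ipow by (simp only: \<sigma> ipow_def frag_of_mult)
  qed
  define H where "H L = DT L - q ^ (num_components L - 1) * subst \<sigma> (DT L)" for L
  have "H L = 0"
  proof (rule mixed_skein_unique[where \<zeta> = "ipow iz 1", OF _ _ _ L])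
    show "H w = H w'" if "link_diagram w" "isotopic 0 0 w w'" for w w'
      using DT_isotopic[OF that] num_components_isotopic[OF that] by (simp add: H_def)
    show "H (u @ [(X Pos, length A)] @ v) - H (u @ [(X Neg, length A)] @ v) =
        ipow iz 1 * (H (u @ [(Cap, length A), (Cup, length A)] @ v) - H (u @ v))"
      if "reach [] u (A @ a # b # B)" "reach (A @ b # a # B) v []" "a \<noteq> b" for u v A B a b
    proof -
      let ?p = "DT (u @ [(X Pos, length A)] @ v)" and ?m = "DT (u @ [(X Neg, length A)] @ v)"
      let ?c = "DT (u @ [(Cap, length A), (Cup, length A)] @ v)" and ?i = "DT (u @ v)"
      note skein = DT_skein[OF that] and mixed = mixed_components[OF that]
      obtain n where n: "num_components (u @ v) = Suc n"
        using num_components_pos[OF mixed(3)] by (cases "num_components (u @ v)") auto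
      have "subst \<sigma> ?p - subst \<sigma> ?m = ipow iw 1 * (subst \<sigma> ?c - subst \<sigma> ?i)"
        using arg_cong[OF skein, of "subst \<sigma>"] by (simp add: subst_diff subst_mult subst_frag_of ipow_def \<sigma>)
      \<comment> \<open>One of the \<open>n + 1\<close> factors \<open>q\<close> is spent on turning
        \<open>w\<close> into \<open>z\<close>; the other \<open>n\<close> are what the smoothings
        carry.\<close>
      then have "q ^ Suc n * (subst \<sigma> ?p - subst \<sigma> ?m) = q ^ n * (q * ipow iw 1) * (subst \<sigma> ?c - subst \<sigma> ?i)"
        by (simp add: mult_ac)
      then have eq: "q ^ Suc n * (subst \<sigma> ?p - subst \<sigma> ?m) = ipow iz 1 * (q ^ n * subst \<sigma> ?c - q ^ n * subst \<sigma> ?i)"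
        by (simp add: q_w right_diff_distrib mult_ac)
      have "(?p - q ^ Suc n * subst \<sigma> ?p) - (?m - q ^ Suc n * subst \<sigma> ?m) =
          (?p - ?m) - q ^ Suc n * (subst \<sigma> ?p - subst \<sigma> ?m)"
        by (simp add: right_diff_distrib)
      also have "\<dots> = ipow iz 1 * ((?c - q ^ n * subst \<sigma> ?c) - (?i - q ^ n * subst \<sigma> ?i))"
        unfolding skein eq by (simp add: right_diff_distrib)
      finally have "(?p - q ^ Suc n * subst \<sigma> ?p) - (?m - q ^ Suc n * subst \<sigma> ?m) =
          ipow iz 1 * ((?c - q ^ n * subst \<sigma> ?c) - (?i - q ^ n * subst \<sigma> ?i))" .
      then show ?thesis
        unfolding H_def mixed(4,5) n by simp
    qed
    show "H (concat Ks) = 0" if Ks: "Ks \<noteq> []" "\<forall>K \<in> set Ks. knot_diagram K" for Ks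
    proof -
      have n: "num_components (concat Ks) = length Ks" and "link_diagram (concat Ks)"
        using num_components_knots[OF Ks(2,1)] by simp_all
      then have "laurent_in {iw, ia} (T (concat Ks))"
        using T by (simp add: is_T_def)
      then have "subst \<sigma> (T (concat Ks)) = T (concat Ks)"
        by (rule subst_id_on) (auto simp: \<sigma>)
      moreover obtain m where m: "length Ks = Suc m"
        using Ks by (cases Ks) auto
      ultimately show ?thesis
        using DT_knots[OF Ks] q_power[of m] by (simp add: H_def n m subst_mult flip: mult.assoc)
    qed
  qed
  then show ?thesis
    by (simp add: H_def \<sigma>_subst q_def)
qed

text \<open>Setting a = 1 commutes with setting w = z, and \<open>E^(1-n)\<close> survives
  both.\<close>

lemma DD_determines_components:
  assumes "link_diagram L" "link_diagram L'" "DD_of DT L = DD_of DT L'"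
  shows "num_components L = num_components L'"
proof -
  have "at_a_1 (DD_of DT L) = ipow iE (1 - int (num_components L))" if L: "link_diagram L" for L
  proof -
    have "(\<lambda>x. frag_extend (frag_of(ia := 0)) ((frag_of(iw := frag_of iz)) x)) =
        (\<lambda>x. frag_extend (frag_of(iw := frag_of iz)) ((frag_of(ia := 0)) x))"
      by (rule ext) (simp add: fun_upd_def)
    then have "at_a_1 (DD_of DT L) = subst (frag_of(iw := frag_of iz)) (at_a_1 (DT L))"
      by (simp only: at_a_1_def DD_of_def subst_subst)
    then show ?thesis
      by (simp add: at_a_1_DT[OF L] subst_frag_of ipow_def frag_extend_cmul)
  qed
  then show ?thesis
    using assms by (metis ipow_inject diff_left_imp_eq of_nat_eq_iff)
qed

end

theorem proposition6:
  fixes T DT :: "diagram \<Rightarrow> laurent"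
  assumes "is_T T"
    and "is_DT T DT"
  shows "topologically_equivalent DT (DD_of DT) \<and>
    (\<forall>L n. link_diagram L \<and> num_components L = n \<and> n \<ge> 1 \<longrightarrow>
       DT L = (ipow iz 1 * ipow iw (-1)) ^ (n - 1) * hat_subst (DD_of DT L))"
proof -
  interpret split_invariant T DT
    using assms by unfold_locales
  have "DT L = DT L' \<longleftrightarrow> DD_of DT L = DD_of DT L'" if "link_diagram L" "link_diagram L'" for L L'
  proof
    show "DD_of DT L = DD_of DT L'" if "DT L = DT L'"
      using that by (simp add: DD_of_def)
    \<comment> \<open>Equal values of \<open>D[D]\<close> yield equal numbers of components, hence
      equal prefactors in the rescaling.\<close>
    show "DT L = DT L'" if "DD_of DT L = DD_of DT L'"
      using DT_rescale[OF \<open>link_diagram L\<close>] DT_rescale[OF \<open>link_diagram L'\<close>] that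
        DD_determines_components[OF \<open>link_diagram L\<close> \<open>link_diagram L'\<close> that] by metis
  qed
  then show ?thesis
    using DT_rescale by (auto simp: topologically_equivalent_def)
qed

end
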